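(* Let $\Bbbk$ be a countable totally ordered division ring and let $L$ be a distributive $0$-lattice of cardinality at most $\aleph_1$. The following are equivalent: (i) there exists a $\Bbbk$-vector lattice $E$ such that $L\cong\operatorname{Id_c}E$; (ii) there exists an Abelian lattice-ordered group $G$ such that $L\cong\operatorname{Id_c}G$; (iii) the lattice $L$ is completely normal and it has countably based differences.
   Context: "Countable" means "at most countable". A $\Bbbk$-vector lattice, for a totally ordered division ring $\Bbbk$, is a left $\Bbbk$-vector space $E$ endowed with a translation-invariant lattice order such that $\Bbbk^+E^+\subseteq E^+$, where $G^+=\{x\in G\mid 0\le x\}$. Write $|x|=x\vee(-x)$. For $a\in E$ the principal $\ell$-ideal generated by $a$ is $\langle a\rangle=\{x\in E\mid (\exists\lambda\in\Bbbk^+)\ |x|\le\lambda|a|\}$, and $\operatorname{Id_c}E=\{\langle a\rangle\mid a\in E^+\}$, ordered by inclusion. For an Abelian lattice-ordered group $G$, $\operatorname{Id_c}G$ is likewise the set, ordered by inclusion, of all principal $\ell$-ideals $\langle a\rangle=\{x\in G\mid (\exists n\in\mathbb{N})\ |x|\le n|a|\}$, $a\in G^+$. Both are distributive lattices with least element $\{0\}$, with $\langle a\rangle\vee\langle b\rangle=\langle a\vee b\rangle$ and $\langle a\rangle\wedge\langle b\rangle=\langle a\wedge b\rangle$ for positive $a,b$. The symbol $\cong$ denotes lattice isomorphism. A distributive $0$-lattice is a distributive lattice with a least element $0$. It is completely normal if for all $a,b\in L$ there are $x,y\in L$ such that $a\vee b=a\vee y=x\vee b$ and $x\wedge y=0$.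 A lattice $L$ has countably based differences if for all $a,b\in L$ there exists a countable subset $C$ of $L$ such that for every $x\in L$, $a\le b\vee x$ if and only if $c\le x$ for some $c\in C$. *)

theory Defs
  imports
    "HOL-Algebra.Module"
    "HOL-Algebra.Lattice"
    "HOL-Library.Countable_Set"
begin

unbundle cardinal_syntax

section \<open>Properties of distributive lattices with zero\<close>

text \<open>
  A distributive lattice with least element is a type of sort
  \<open>{distrib_lattice, bounded_lattice_bot}\<close>. The qualified names \<open>sup_class.sup\<close> and
  \<open>inf_class.inf\<close> are needed because HOL-Algebra reuses \<open>sup\<close> and \<open>inf\<close>.
\<close>

definition completely_normal :: "'a::{lattice, order_bot} itself \<Rightarrow> bool" where
  "completely_normal _ \<longleftrightarrow>
     (\<forall>a b :: 'a. \<exists>x y.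
        sup_class.sup a b = sup_class.sup a y \<and>
        sup_class.sup a b = sup_class.sup x b \<and>
        inf_class.inf x y = bot)"

definition countably_based_differences :: "'a::lattice itself \<Rightarrow> bool" where
  "countably_based_differences _ \<longleftrightarrow>
     (\<forall>a b :: 'a. \<exists>C. countable C \<and>
        (\<forall>x. a \<le> sup_class.sup b x \<longleftrightarrow> (\<exists>c\<in>C. c \<le> x)))"

text \<open>Isomorphisms from a lattice given by a type onto a lattice given by a carrier.\<close>

definition lattice_iso :: "('a::lattice \<Rightarrow> 'b) \<Rightarrow> 'b gorder \<Rightarrow> bool" where
  "lattice_iso f M \<longleftrightarrow>
     bij_betw f UNIV (carrier M) \<and>
     (\<forall>x y. f (sup_class.sup x y) = f x \<squnion>\<^bsub>M\<^esub> f y) \<and>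
     (\<forall>x y. f (inf_class.inf x y) = f x \<sqinter>\<^bsub>M\<^esub> f y)"


section \<open>Abelian lattice-ordered groups\<close>

text \<open>
  Groups are written additively, so, as for modules in HOL-Algebra, the record of rings is
  extended; its multiplicative fields \<open>mult\<close> and \<open>one\<close> play no role.
\<close>

record 'a lgroup = "'a ring" +
  lgroup_le :: "'a \<Rightarrow> 'a \<Rightarrow> bool"

definition lgroup_order :: "('a, 'm) lgroup_scheme \<Rightarrow> 'a gorder" where
  "lgroup_order G = \<lparr>carrier = carrier G, eq = (=), le = lgroup_le G\<rparr>"

locale abelian_lgroup = abelian_group G for G (structure) +
  assumes lattice_order: "Lattice.lattice (lgroup_order G)"
    and translation_invariant:
      "\<lbrakk>x \<in> carrier G; y \<in> carrier G; z \<in> carrier G; lgroup_le G x y\<rbrakk>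
        \<Longrightarrow> lgroup_le G (x \<oplus> z) (y \<oplus> z)"

definition positive_cone :: "('a, 'm) lgroup_scheme \<Rightarrow> 'a set" where
  "positive_cone G = {x \<in> carrier G. lgroup_le G \<zero>\<^bsub>G\<^esub> x}"

definition labs :: "('a, 'm) lgroup_scheme \<Rightarrow> 'a \<Rightarrow> 'a" where
  "labs G x = x \<squnion>\<^bsub>lgroup_order G\<^esub> (\<ominus>\<^bsub>G\<^esub> x)"

definition principal_lideal :: "('a, 'm) lgroup_scheme \<Rightarrow> 'a \<Rightarrow> 'a set" where
  "principal_lideal G a =
     {x \<in> carrier G. \<exists>n::nat. lgroup_le G (labs G x) ([n] \<cdot>\<^bsub>G\<^esub> labs G a)}"

definition Idc_group :: "('a, 'm) lgroup_scheme \<Rightarrow> 'a set gorder" where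
  "Idc_group G =
     \<lparr>carrier = principal_lideal G ` positive_cone G, eq = (=), le = (\<subseteq>)\<rparr>"


section \<open>Vector lattices over a totally ordered division ring\<close>

text \<open>
  The scalars form a type of sort \<open>{division_ring, linordered_ring}\<close>; multiplication of scalars
  is not assumed commutative, which is why the locales for modules and vector spaces of the
  libraries do not apply.
\<close>

record ('k, 'a) vlattice = "'a lgroup" +
  scal :: "'k \<Rightarrow> 'a \<Rightarrow> 'a" (infixr \<open>\<star>\<index>\<close> 75)

locale vector_lattice = abelian_lgroup E
  for E :: "('k::{division_ring, linordered_ring}, 'a) vlattice" (structure) +
  assumes scal_closed: "x \<in> carrier E \<Longrightarrow> r \<star> x \<in> carrier E"
    and scal_add_left: "x \<in> carrier E \<Longrightarrow> (r + s) \<star> x = r \<star> x \<oplus> s \<star> x"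
    and scal_add_right:
      "\<lbrakk>x \<in> carrier E; y \<in> carrier E\<rbrakk> \<Longrightarrow> r \<star> (x \<oplus> y) = r \<star> x \<oplus> r \<star> y"
    and scal_assoc: "x \<in> carrier E \<Longrightarrow> (r * s) \<star> x = r \<star> s \<star> x"
    and scal_one: "x \<in> carrier E \<Longrightarrow> 1 \<star> x = x"
    and scal_positive: "\<lbrakk>0 \<le> r; x \<in> positive_cone E\<rbrakk> \<Longrightarrow> r \<star> x \<in> positive_cone E"

definition principal_videal ::
    "('k::{division_ring, linordered_ring}, 'a) vlattice \<Rightarrow> 'a \<Rightarrow> 'a set" where
  "principal_videal E a =
     {x \<in> carrier E. \<exists>r::'k. 0 \<le> r \<and> lgroup_le E (labs E x) (r \<star>\<^bsub>E\<^esub> labs E a)}"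

definition Idc_vector ::
    "('k::{division_ring, linordered_ring}, 'a) vlattice \<Rightarrow> 'a set gorder" where
  "Idc_vector E =
     \<lparr>carrier = principal_videal E ` positive_cone E, eq = (=), le = (\<subseteq>)\<rparr>"

end

theory Submission
  imports Defs "HOL-Library.Poly_Mapping" "HOL-Library.Countable_Set_Type"
begin

text \<open>
  In an ideal lattice the differences of \<open>\<langle>a\<rangle>\<close> and \<open>\<langle>b\<rangle>\<close> are based on the ideals generated by the positive
  parts of \<open>a - n b\<close>, which gives (iii). For the converse, let \<open>V\<close> be a vector space and let \<open>p\<close> map
  \<open>V\<close> onto the lattice \<open>L\<close> in such a way that \<open>p v\<close> behaves like the ideal generated by \<open>v\<^sup>+\<close>. Every prime
  filter of \<open>L\<close> then defines a total preorder of \<open>V\<close>. If \<open>p\<close> is archimedean, i.e. \<open>p u \<le> p v \<or> c\<close> implies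
  \<open>p u \<and> p (u - r v) \<le> c\<close> for some scalar \<open>r\<close>, then the functions on the prime filters that are piecewise
  in \<open>V\<close> form a vector lattice whose ideal lattice is \<open>L\<close>.

  The map \<open>p\<close> is built along a well-order of \<open>L\<close> with countable initial segments, adjoining one basis
  vector \<open>e\<close> at a time to a countable space \<open>U\<close>. The values on \<open>U + k e\<close> are determined by the cut of \<open>e\<close>
  in \<open>U\<close>, that is by \<open>p (e - u)\<close> and \<open>p (u - e)\<close>. As differences are countably based, the cut has to meet
  countably many requirements, and these can be met one at a time by specifying the cut at one more
  vector \<open>t\<close>. Complete normality makes this possible: it separates the prime filters where the values
  specified so far force \<open>e > t\<close> from those where they force \<open>e < t\<close>.
\<close>

text \<open>The obstacle is that \<open>archimedean\<close> contains an existential quantifier over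
  scalars, while the values on \<open>U + k e\<close> are final once \<open>e\<close> is adjoined.
  So \<open>e\<close> must meet this condition together with all of \<open>U\<close> at once. As
  long as only finitely many values of the cut are fixed, one scalar exceeds the finitely many
  bounds found in \<open>U\<close>, and specifying the cut at one vector built from this scalar
  settles a requirement for good. The quantifier over all \<open>c\<close> is reduced to a sequence
  by countably based differences, so countably many requirements suffice if \<open>U\<close> is
  countable; this is where countable scalars and the bound aleph_1 enter. The value of
  \<open>e\<close> itself is free: it is prescribed as the element of \<open>L\<close> that indexes
  \<open>e\<close>, which makes \<open>p\<close> surjective. For groups the scalars are taken to be
  the rationals, because there multiples by natural numbers are cofinal among the nonnegative
  multiples, so that both notions of principal ideal coincide.\<close>

notation sup_class.sup (infixl "\<curlyvee>" 65)
notation inf_class.inf (infixl "\<curlywedge>" 70)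

section \<open>Prime filters\<close>

text \<open>The empty set qualifies: it is the point at which all vectors count as equivalent. Hence
  the space of prime filters is nonempty for every lattice.\<close>

definition prime_filter :: "'l::{distrib_lattice, bounded_lattice_bot} set \<Rightarrow> bool" where
  "prime_filter P \<longleftrightarrow> bot \<notin> P \<and> (\<forall>a b. a \<curlyvee> b \<in> P \<longleftrightarrow> a \<in> P \<or> b \<in> P) \<and>
     (\<forall>a b. a \<curlywedge> b \<in> P \<longleftrightarrow> a \<in> P \<and> b \<in> P)"

lemma prime_filterD:
  assumes "prime_filter P"
  shows "bot \<notin> P" "a \<curlyvee> b \<in> P \<longleftrightarrow> a \<in> P \<or> b \<in> P" "a \<curlywedge> b \<in> P \<longleftrightarrow> a \<in> P \<and> b \<in> P"
  using assms unfolding prime_filter_def by auto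

lemma prime_filter_mono:
  assumes "prime_filter P" "a \<in> P" "a \<le> b" shows "b \<in> P"
  using prime_filterD(3)[OF assms(1), of a b] assms(2,3) by (simp add: inf_absorb1)

text \<open>A filter maximal among those that contain \<open>a\<close> and omit \<open>b\<close> is
  prime: adjoining an outside element generates a filter containing \<open>b\<close>, and by
  distributivity two such failures combine into one for the join.\<close>

lemma prime_filter_separation:
  fixes a b :: "'l::{distrib_lattice, bounded_lattice_bot}"
  assumes "\<not> a \<le> b"
  obtains P where "prime_filter P" "a \<in> P" "b \<notin> P"
proof -
  define \<F> where "\<F> = {Q. (\<forall>x\<in>Q. \<forall>y. x \<le> y \<longrightarrow> y \<in> Q) \<and> (\<forall>x\<in>Q. \<forall>y\<in>Q. x \<curlywedge> y \<in> Q) \<and> a \<in> Q \<and> b \<notin> Q}"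
  have "{x. a \<le> x} \<in> \<F>" using assms by (auto simp: \<F>_def)
  moreover have "\<Union>C \<in> \<F>" if C: "subset.chain \<F> C" "C \<noteq> {}" for C
  proof -
    have sub: "C \<subseteq> \<F>" using C by (auto simp: subset.chain_def)
    have "x \<curlywedge> y \<in> \<Union>C" if xy: "x \<in> X" "X \<in> C" "y \<in> Y" "Y \<in> C" for x y X Y
    proof -
      have "X \<subseteq> Y \<or> Y \<subseteq> X" using C(1) xy by (auto simp: subset_chain_def)
      then obtain Z where Z: "Z \<in> C" "x \<in> Z" "y \<in> Z" using xy(1,3) xy(2,4) by (metis subsetD)
      then have "x \<curlywedge> y \<in> Z" using sub by (auto simp: \<F>_def)
      then show ?thesis using Z by blast
    qed
    moreover have "y \<in> \<Union>C" if "x \<in> \<Union>C" "x \<le> y" for x y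
      using that sub unfolding \<F>_def by blast
    moreover have "a \<in> \<Union>C" "b \<notin> \<Union>C" using sub C(2) unfolding \<F>_def by auto
    ultimately show ?thesis unfolding \<F>_def by simp
  qed
  ultimately obtain M where M: "M \<in> \<F>" and max: "\<And>X. X \<in> \<F> \<Longrightarrow> M \<subseteq> X \<Longrightarrow> X = M"
    using subset_Zorn_nonempty[of \<F>] by (metis empty_iff)
  have up: "\<And>x y. x \<in> M \<Longrightarrow> x \<le> y \<Longrightarrow> y \<in> M" and inf: "\<And>x y. x \<in> M \<Longrightarrow> y \<in> M \<Longrightarrow> x \<curlywedge> y \<in> M"
    and a: "a \<in> M" and b: "b \<notin> M" using M by (auto simp: \<F>_def)
  have gen: "\<exists>m\<in>M. m \<curlywedge> x \<le> b" if x: "x \<notin> M" for x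
  proof (rule ccontr)
    assume no: "\<not> (\<exists>m\<in>M. m \<curlywedge> x \<le> b)"
    let ?X = "{z. \<exists>m\<in>M. m \<curlywedge> x \<le> z}"
    have "?X \<in> \<F>"
    proof -
      have "y \<curlywedge> z \<in> ?X" if yz: "y \<in> ?X" "z \<in> ?X" for y z
      proof -
        obtain m n where mn: "m \<in> M" "m \<curlywedge> x \<le> y" "n \<in> M" "n \<curlywedge> x \<le> z" using yz by auto
        have "(m \<curlywedge> n) \<curlywedge> x \<le> m \<curlywedge> x" "(m \<curlywedge> n) \<curlywedge> x \<le> n \<curlywedge> x" by (intro inf_mono; simp)+
        then have "(m \<curlywedge> n) \<curlywedge> x \<le> y \<curlywedge> z" using mn by (intro le_infI) (blast intro: order_trans)+
        then show ?thesis using inf mn by blast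
      qed
      moreover have "a \<in> ?X" using a by (auto intro: le_infI1)
      moreover have "z \<in> ?X" if "y \<in> ?X" "y \<le> z" for y z using that order_trans by blast
      moreover have "b \<notin> ?X" using no by blast
      ultimately show ?thesis unfolding \<F>_def by blast
    qed
    moreover have "M \<subseteq> ?X" by (auto intro: le_infI1)
    ultimately have "?X = M" using max by blast
    moreover have "x \<in> ?X" using a by (auto intro: le_infI2)
    ultimately show False using x by blast
  qed
  have prime: "x \<in> M \<or> y \<in> M" if xy: "x \<curlyvee> y \<in> M" for x y
  proof (rule ccontr)
    assume "\<not> (x \<in> M \<or> y \<in> M)"
    then obtain m n where mn: "m \<in> M" "m \<curlywedge> x \<le> b" "n \<in> M" "n \<curlywedge> y \<le> b" using gen by blast
    have "(m \<curlywedge> n) \<curlywedge> x \<le> m \<curlywedge> x" "(m \<curlywedge> n) \<curlywedge> y \<le> n \<curlywedge> y" by (intro inf_mono; simp)+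
    then have "(m \<curlywedge> n) \<curlywedge> (x \<curlyvee> y) \<le> b"
      unfolding inf_sup_distrib1 using mn(2,4) by (intro le_supI) (blast intro: order_trans)+
    moreover have "(m \<curlywedge> n) \<curlywedge> (x \<curlyvee> y) \<in> M" using inf mn(1,3) xy by blast
    ultimately show False using up b by blast
  qed
  have "bot \<notin> M" using up b by (meson bot_least)
  moreover have "x \<in> M \<or> y \<in> M \<Longrightarrow> x \<curlyvee> y \<in> M" "x \<curlywedge> y \<in> M \<Longrightarrow> x \<in> M \<and> y \<in> M" for x y
    using up[OF _ sup_ge1] up[OF _ sup_ge2] up[OF _ inf_le1] up[OF _ inf_le2] by blast+
  ultimately have "prime_filter M" unfolding prime_filter_def using inf prime by blast
  then show thesis using that a b by blast
qed

lemma le_iff_prime_filter: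
  fixes a b :: "'l::{distrib_lattice, bounded_lattice_bot}"
  shows "a \<le> b \<longleftrightarrow> (\<forall>P. prime_filter P \<longrightarrow> a \<in> P \<longrightarrow> b \<in> P)"
  using prime_filter_separation prime_filter_mono by metis

text \<open>The usual way to prove inequalities in \<open>L\<close> below: at a prime filter they
  become statements about a total preorder of vectors, which are settled by comparing
  vectors.\<close>

lemma le_by_prime_filter:
  fixes a b :: "'l::{distrib_lattice, bounded_lattice_bot}"
  assumes "\<And>P. prime_filter P \<Longrightarrow> a \<in> P \<Longrightarrow> b \<notin> P \<Longrightarrow> False"
  shows "a \<le> b"
  using assms le_iff_prime_filter by blast

lemma prime_filter_Inf_fin:
  assumes "prime_filter P" "finite A" "A \<noteq> {}"
  shows "Inf_fin A \<in> P \<longleftrightarrow> A \<subseteq> P"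
  using assms(2,3) by (induction rule: finite_ne_induct) (auto simp: prime_filterD[OF assms(1)])

text \<open>Describing the join by membership covers the empty family too, with
  \<open>bot\<close>.\<close>

lemma finite_join:
  fixes f :: "'i \<Rightarrow> 'l::{distrib_lattice, bounded_lattice_bot}"
  assumes "finite I"
  shows "\<exists>x. \<forall>P. prime_filter P \<longrightarrow> (x \<in> P \<longleftrightarrow> (\<exists>i\<in>I. f i \<in> P))"
  using assms
proof induction
  case empty
  show ?case by (rule exI[of _ bot]) (auto simp: prime_filterD)
next
  case (insert i I)
  then obtain x where "\<forall>P. prime_filter P \<longrightarrow> (x \<in> P \<longleftrightarrow> (\<exists>i\<in>I. f i \<in> P))" by blast
  then show ?case by (intro exI[of _ "f i \<curlyvee> x"]) (auto simp: prime_filterD)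
qed

section \<open>Consequences of complete normality\<close>

text \<open>The witnesses for (a, b) and for (b, a) are unrelated. Each pair yields a difference of
  \<open>a\<close> over \<open>b\<close>; the meet of the two is a single function whose values at
  (a, b) and (b, a) are disjoint.\<close>

lemma completely_normal_difference:
  assumes "completely_normal (TYPE('l::{distrib_lattice, bounded_lattice_bot}))"
  obtains \<delta> :: "'l \<Rightarrow> 'l \<Rightarrow> 'l::{distrib_lattice, bounded_lattice_bot}" where "\<And>a b. a \<le> b \<curlyvee> \<delta> a b" "\<And>a b. \<delta> a b \<curlywedge> \<delta> b a = bot"
proof -
  obtain X Y :: "'l \<Rightarrow> 'l \<Rightarrow> 'l" where
    XY: "\<And>a b. a \<curlyvee> b = a \<curlyvee> Y a b" "\<And>a b. a \<curlyvee> b = X a b \<curlyvee> b" "\<And>a b. X a b \<curlywedge> Y a b = bot"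
    using assms unfolding completely_normal_def by metis
  define \<delta> where "\<delta> a b = X a b \<curlywedge> Y b a" for a b
  have 1: "a \<le> b \<curlyvee> \<delta> a b" for a b
  proof -
    have "a \<le> b \<curlyvee> X a b" "a \<le> b \<curlyvee> Y b a"
      using sup_ge2[of a b] sup_ge1[of a b] XY(1)[of b a] XY(2)[of a b] by (simp_all add: sup_commute)
    then show ?thesis unfolding \<delta>_def sup_inf_distrib1 by simp
  qed
  have 2: "\<delta> a b \<curlywedge> \<delta> b a = bot" for a b
  proof -
    have "\<delta> a b \<curlywedge> \<delta> b a \<le> X a b \<curlywedge> Y a b" unfolding \<delta>_def by (intro inf_mono) simp_all
    then show ?thesis using XY(3) by (simp add: bot_unique)
  qed
  show thesis using 1 2 by (rule that)
qed

text \<open>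
  The element \<open>d T\<close> replaces the difference between a join-irreducible element, namely the meet
  of \<open>T\<close>, and its lower cover in the sublattice generated by \<open>F\<close>.
\<close>

definition spread :: "'l set \<Rightarrow> ('l::{distrib_lattice, bounded_lattice_bot} set \<Rightarrow> 'l) \<Rightarrow> bool" where
  "spread F d \<longleftrightarrow> (\<forall>T a. T \<subseteq> F \<longrightarrow> a \<in> T \<longrightarrow> d T \<le> a) \<and>
    (\<forall>T T'. T \<subseteq> F \<longrightarrow> T' \<subseteq> F \<longrightarrow> \<not> T \<subseteq> T' \<longrightarrow> \<not> T' \<subseteq> T \<longrightarrow> d T \<curlywedge> d T' = bot) \<and>
    (\<forall>a z. a \<in> F \<longrightarrow> (\<forall>P. prime_filter P \<longrightarrow> a \<in> P \<longrightarrow> d (P \<inter> F) \<le> z) \<longrightarrow> a \<le> z)"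

text \<open>The third property is proved by induction on the size of \<open>F - T\<close>. At a
  prime filter that contains the meet of \<open>T\<close> but not \<open>z\<close>, the trace on
  \<open>F\<close> is exactly \<open>T\<close>, as larger traces are covered by induction. Then no
  meet of an incomparable \<open>T'\<close> lies in it, so all the differences do, and with them
  \<open>d T\<close>.\<close>

lemma spread_exists:
  fixes F :: "'l::{distrib_lattice, bounded_lattice_bot} set"
  assumes cn: "completely_normal TYPE('l)" and fin: "finite F"
  shows "\<exists>d. spread F d"
proof -
  obtain \<delta> :: "'l \<Rightarrow> 'l \<Rightarrow> 'l" where \<delta>: "\<And>a b. a \<le> b \<curlyvee> \<delta> a b" "\<And>a b. \<delta> a b \<curlywedge> \<delta> b a = bot"
    using completely_normal_difference[OF cn] by blast
  \<comment> \<open>The meet of the empty set is an unspecified value. It does no harm: the empty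
    set is comparable with every \<open>T'\<close>, and \<open>spread\<close> asserts nothing about
    its value there.\<close>
  define D where "D T = insert (Inf_fin T) ((\<lambda>T'. \<delta> (Inf_fin T) (Inf_fin T')) `
      {T'. T' \<subseteq> F \<and> \<not> T \<subseteq> T' \<and> \<not> T' \<subseteq> T})" for T
  define d where "d T = Inf_fin (D T)" for T
  have finD: "finite (D T)" "D T \<noteq> {}" for T unfolding D_def using fin by auto
  have d1: "d T \<le> a" if "T \<subseteq> F" "a \<in> T" for T a
  proof -
    have "d T \<le> Inf_fin T" unfolding d_def using finD by (intro Inf_fin.coboundedI) (auto simp: D_def)
    also have "\<dots> \<le> a" using that fin by (intro Inf_fin.coboundedI) (auto intro: finite_subset)
    finally show ?thesis .
  qed
  have d2: "d T \<curlywedge> d T' = bot" if "T \<subseteq> F" "T' \<subseteq> F" "\<not> T \<subseteq> T'" "\<not> T' \<subseteq> T" for T T'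
  proof -
    have "d T \<le> \<delta> (Inf_fin T) (Inf_fin T')" unfolding d_def using finD that
      by (intro Inf_fin.coboundedI) (auto simp: D_def)
    moreover have "d T' \<le> \<delta> (Inf_fin T') (Inf_fin T)" unfolding d_def using finD that
      by (intro Inf_fin.coboundedI) (auto simp: D_def)
    ultimately show ?thesis using \<delta>(2) by (metis bot_unique inf_mono)
  qed
  have d3: "a \<le> z" if a: "a \<in> F" and z: "\<And>P. prime_filter P \<Longrightarrow> a \<in> P \<Longrightarrow> d (P \<inter> F) \<le> z" for a z
  proof -
    have "Inf_fin T \<le> z" if "T \<subseteq> F" "a \<in> T" for T
      using that
    proof (induction "card (F - T)" arbitrary: T rule: less_induct)
      case less
      have finT: "finite T" "T \<noteq> {}" using less.prems fin finite_subset by auto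
      show ?case
      proof (rule le_by_prime_filter)
        fix P assume P: "prime_filter P" "Inf_fin T \<in> P" "z \<notin> P"
        have TP: "T \<subseteq> P" using prime_filter_Inf_fin[OF P(1) finT] P(2) by simp
        have bigger: "Inf_fin T' \<le> z" if "T \<subset> T'" "T' \<subseteq> F" for T'
          using that less.prems fin by (intro less.hyps) (auto intro!: psubset_card_mono)
        have eq: "T = P \<inter> F"
        proof (rule ccontr)
          assume "T \<noteq> P \<inter> F"
          then have "T \<subset> P \<inter> F" using TP less.prems by blast
          then have "Inf_fin (P \<inter> F) \<le> z" "P \<inter> F \<noteq> {}" using bigger by auto
          moreover from this have "Inf_fin (P \<inter> F) \<in> P"
            using prime_filter_Inf_fin[OF P(1), of "P \<inter> F"] fin by simp
          ultimately show False using P(1,3) prime_filter_mono by blast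
        qed
        have "D T \<subseteq> P"
        proof -
          have "\<delta> (Inf_fin T) (Inf_fin T') \<in> P" if T': "T' \<subseteq> F" "\<not> T \<subseteq> T'" "\<not> T' \<subseteq> T" for T'
          proof -
            have "Inf_fin T' \<notin> P"
            proof
              assume "Inf_fin T' \<in> P"
              moreover have "finite T'" "T' \<noteq> {}" using T' fin finite_subset by auto
              ultimately have "T' \<subseteq> P" using prime_filter_Inf_fin[OF P(1)] by simp
              then show False using T' eq by blast
            qed
            moreover have "Inf_fin T' \<curlyvee> \<delta> (Inf_fin T) (Inf_fin T') \<in> P"
              using prime_filter_mono[OF P(1,2) \<delta>(1)] .
            ultimately show ?thesis using prime_filterD(2)[OF P(1)] by blast
          qed
          then show ?thesis using P(2) by (auto simp: D_def)
        qed
        then have "d T \<in> P" unfolding d_def using prime_filter_Inf_fin[OF P(1) finD] by blast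
        moreover have "d T \<le> z" using z[OF P(1)] eq less.prems(2) by blast
        ultimately show False using P(1,3) prime_filter_mono by blast
      qed
    qed
    from this[of "{a}"] show ?thesis using a by simp
  qed
  show ?thesis unfolding spread_def using d1 d2 d3 by (intro exI[of _ d]) simp
qed

text \<open>The elements \<open>x\<close> and \<open>y\<close> stand in for \<open>X\<close> and
  \<open>Y\<close>, which need not be definable by elements of the lattice. Two conditions bound
  them from below by differences inside \<open>F\<close>, the last two from above, relative to
  \<open>w\<close>.\<close>

definition separating ::
    "'l::{distrib_lattice, bounded_lattice_bot} set \<Rightarrow> 'l set set \<Rightarrow> 'l set set \<Rightarrow> 'l \<Rightarrow> 'l \<Rightarrow> bool" where
  "separating F X Y x y \<longleftrightarrow> x \<curlywedge> y = bot \<and>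
    (\<forall>a\<in>F. \<forall>b\<in>F. (\<forall>P. prime_filter P \<longrightarrow> a \<in> P \<longrightarrow> b \<notin> P \<longrightarrow> P \<in> X) \<longrightarrow> a \<le> b \<curlyvee> x) \<and>
    (\<forall>a\<in>F. \<forall>b\<in>F. (\<forall>P. prime_filter P \<longrightarrow> a \<in> P \<longrightarrow> b \<notin> P \<longrightarrow> P \<in> Y) \<longrightarrow> a \<le> b \<curlyvee> y) \<and>
    (\<forall>w z. (\<forall>P\<in>X. \<exists>f \<in> P \<inter> F. f \<curlywedge> w \<le> z) \<longrightarrow> x \<curlywedge> w \<le> z) \<and>
    (\<forall>w z. (\<forall>P\<in>Y. \<exists>f \<in> P \<inter> F. f \<curlywedge> w \<le> z) \<longrightarrow> y \<curlywedge> w \<le> z)"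

text \<open>Take for \<open>x\<close> the join of \<open>d\<close> over the finitely many traces on
  \<open>F\<close> of members of \<open>X\<close>, and likewise for \<open>y\<close>. Incomparable
  traces give disjointness; the upper bounds hold because \<open>d T\<close> is below every element
  of \<open>T\<close>, the lower ones by the third property of \<open>spread\<close>.\<close>

lemma separating_exists:
  fixes F :: "'l::{distrib_lattice, bounded_lattice_bot} set"
  assumes cn: "completely_normal TYPE('l)" and fin: "finite F"
    and XY: "\<And>P Q. P \<in> X \<Longrightarrow> Q \<in> Y \<Longrightarrow> \<not> P \<inter> F \<subseteq> Q"  "\<And>P Q. P \<in> X \<Longrightarrow> Q \<in> Y \<Longrightarrow> \<not> Q \<inter> F \<subseteq> P"
  shows "\<exists>x y. separating F X Y x y"
proof -
  obtain d where d: "spread F d" using spread_exists[OF cn fin] by blast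
  note spread = d[unfolded spread_def]
  have d1: "d T \<le> a" if "T \<subseteq> F" "a \<in> T" for T a using spread[THEN conjunct1] that by blast
  have d2: "d T \<curlywedge> d T' = bot" if "T \<subseteq> F" "T' \<subseteq> F" "\<not> T \<subseteq> T'" "\<not> T' \<subseteq> T" for T T'
    using spread[THEN conjunct2, THEN conjunct1] that by blast
  have d3: "a \<le> z" if "a \<in> F" "\<And>P. prime_filter P \<Longrightarrow> a \<in> P \<Longrightarrow> d (P \<inter> F) \<le> z" for a z
    using spread[THEN conjunct2, THEN conjunct2] that by simp
  have join: "\<exists>x. \<forall>Q. prime_filter Q \<longrightarrow> (x \<in> Q \<longleftrightarrow> (\<exists>P\<in>Z. d (P \<inter> F) \<in> Q))" for Z
  proof -
    have "finite ((\<lambda>P. P \<inter> F) ` Z)" by (rule finite_subset[of _ "Pow F"]) (use fin in auto)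
    from finite_join[OF this, of d] show ?thesis by simp
  qed
  obtain x where x: "\<And>Q. prime_filter Q \<Longrightarrow> x \<in> Q \<longleftrightarrow> (\<exists>P\<in>X. d (P \<inter> F) \<in> Q)" using join by blast
  obtain y where y: "\<And>Q. prime_filter Q \<Longrightarrow> y \<in> Q \<longleftrightarrow> (\<exists>P\<in>Y. d (P \<inter> F) \<in> Q)" using join by blast
  have low: "a \<le> b \<curlyvee> z" if "a \<in> F" "b \<in> F" "\<And>P. prime_filter P \<Longrightarrow> a \<in> P \<Longrightarrow> b \<notin> P \<Longrightarrow> P \<in> Z"
    and z: "\<And>Q. prime_filter Q \<Longrightarrow> z \<in> Q \<longleftrightarrow> (\<exists>P\<in>Z. d (P \<inter> F) \<in> Q)" for a b z Z
  proof (rule d3)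
    show "a \<in> F" by fact
    fix P assume P: "prime_filter P" "a \<in> P"
    show "d (P \<inter> F) \<le> b \<curlyvee> z"
    proof (cases "b \<in> P")
      case True
      then show ?thesis using d1[of "P \<inter> F" b] that(2) by (auto intro: le_supI1)
    next
      case False
      then have "d (P \<inter> F) \<le> z" using that P by (auto simp: le_iff_prime_filter)
      then show ?thesis by (rule le_supI2)
    qed
  qed
  have up: "z \<curlywedge> w \<le> c" if f: "\<And>P. P \<in> Z \<Longrightarrow> \<exists>f \<in> P \<inter> F. f \<curlywedge> w \<le> c"
    and z: "\<And>Q. prime_filter Q \<Longrightarrow> z \<in> Q \<longleftrightarrow> (\<exists>P\<in>Z. d (P \<inter> F) \<in> Q)" for w c z Z
  proof (rule le_by_prime_filter)
    fix Q assume Q: "prime_filter Q" "z \<curlywedge> w \<in> Q" "c \<notin> Q"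
    then obtain P where P: "P \<in> Z" "d (P \<inter> F) \<in> Q" using z prime_filterD(3) by metis
    obtain g where "g \<in> P \<inter> F" "g \<curlywedge> w \<le> c" using f P by blast
    then show False using d1[of "P \<inter> F" g] P Q prime_filterD(3) prime_filter_mono by (metis inf_le2)
  qed
  have "x \<curlywedge> y \<le> bot"
  proof (rule le_by_prime_filter)
    fix Q assume Q: "prime_filter Q" "x \<curlywedge> y \<in> Q"
    then obtain P P' where P: "P \<in> X" "d (P \<inter> F) \<in> Q" "P' \<in> Y" "d (P' \<inter> F) \<in> Q"
      using x y prime_filterD(3) by metis
    then have "d (P \<inter> F) \<curlywedge> d (P' \<inter> F) = bot" using XY by (intro d2) auto
    then show False using P Q prime_filterD by metis
  qed
  then have xy: "x \<curlywedge> y = bot" by (simp add: bot_unique)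
  have "separating F X Y x y"
    unfolding separating_def
  proof (intro conjI ballI allI impI xy)
    show "a \<le> b \<curlyvee> x" if "a \<in> F" "b \<in> F" "\<forall>P. prime_filter P \<longrightarrow> a \<in> P \<longrightarrow> b \<notin> P \<longrightarrow> P \<in> X" for a b
      by (rule low[of a b X]) (use that x in blast)+
    show "a \<le> b \<curlyvee> y" if "a \<in> F" "b \<in> F" "\<forall>P. prime_filter P \<longrightarrow> a \<in> P \<longrightarrow> b \<notin> P \<longrightarrow> P \<in> Y" for a b
      by (rule low[of a b Y]) (use that y in blast)+
    show "x \<curlywedge> w \<le> z" if "\<forall>P\<in>X. \<exists>f \<in> P \<inter> F. f \<curlywedge> w \<le> z" for w z
      by (rule up[of X]) (use that x in blast)+
    show "y \<curlywedge> w \<le> z" if "\<forall>P\<in>Y. \<exists>f \<in> P \<inter> F. f \<curlywedge> w \<le> z" for w z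
      by (rule up[of Y]) (use that y in blast)+
  qed
  then show ?thesis by blast
qed

section \<open>Scalars and vector spaces\<close>

lemma ordered_division_ring_pos:
  fixes a b :: "'k::{division_ring, linordered_ring}"
  shows "(0::'k) < 1" "0 < a \<Longrightarrow> 0 < b \<Longrightarrow> 0 < a * b" "0 < a \<Longrightarrow> 0 < inverse a"
proof -
  show one: "(0::'k) < 1" using zero_le_square[of "1::'k"] by (simp add: less_le)
  show mult: "0 < a * b" if "0 < a" "0 < b" for a b :: 'k
    using that mult_nonneg_nonneg[of a b] by (simp add: less_le)
  show "0 < inverse a" if a: "0 < a"
  proof (rule ccontr)
    assume "\<not> 0 < inverse a"
    then have "0 \<le> - inverse a" by simp
    then have "0 \<le> a * (- inverse a)" using a by (intro mult_nonneg_nonneg) auto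
    then show False using a one by simp
  qed
qed

text \<open>Lets one scalar beat the finitely many archimedean bounds that belong to the points of a
  finite cut or to the values of piecewise functions.\<close>

lemma finite_strict_upper_bound:
  fixes f :: "'i \<Rightarrow> 'k::{division_ring, linordered_ring}"
  assumes "finite I"
  shows "\<exists>r>0. \<forall>i\<in>I. f i < r"
  using assms
proof induction
  case empty
  show ?case using ordered_division_ring_pos(1) by auto
next
  case (insert i I)
  then obtain r where r: "r > 0" "\<forall>i\<in>I. f i < r" by blast
  define q where "q = max r (f i) + 1"
  have "max r (f i) < q" using ordered_division_ring_pos(1)[where 'k='k] by (simp add: q_def)
  then have "r < q" "f i < q" by simp_all
  then show ?case using r by (intro exI[of _ q]) (auto intro: less_trans)
qed

locale kspace =
  fixes scale :: "'k::{division_ring, linordered_ring} \<Rightarrow> 'v::ab_group_add \<Rightarrow> 'v" (infixr "*s" 75)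
  assumes scale_right_add: "r *s (x + y) = r *s x + r *s y"
    and scale_left_add: "(r + s) *s x = r *s x + s *s x"
    and scale_scale: "r *s (s *s x) = (r * s) *s x"
    and scale_one: "1 *s x = x"
begin

lemma scale_zero_right [simp]: "r *s 0 = 0"
  using scale_right_add[of r 0 0] by simp

lemma scale_zero_left [simp]: "0 *s x = 0"
  using scale_left_add[of 0 0 x] by simp

lemma scale_minus_right: "r *s (- x) = - (r *s x)"
  using scale_right_add[of r x "- x"] by (simp add: eq_neg_iff_add_eq_0 add.commute)

lemma scale_minus_left: "(- r) *s x = - (r *s x)"
  using scale_left_add[of r "- r" x] by (simp add: eq_neg_iff_add_eq_0 add.commute)

lemma scale_right_diff: "r *s (x - y) = r *s x - r *s y"
  using scale_right_add[of r x "- y"] by (simp add: scale_minus_right)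

lemma scale_left_diff: "(r - s) *s x = r *s x - s *s x"
  using scale_left_add[of r "- s" x] by (simp add: scale_minus_left)

lemma scale_inverse [simp]:
  "r \<noteq> 0 \<Longrightarrow> r *s (inverse r *s x) = x" "r \<noteq> 0 \<Longrightarrow> inverse r *s (r *s x) = x"
  by (simp_all add: scale_scale scale_one)

definition subspace :: "'v set \<Rightarrow> bool" where
  "subspace U \<longleftrightarrow> 0 \<in> U \<and> (\<forall>x\<in>U. \<forall>y\<in>U. x + y \<in> U) \<and> (\<forall>r. \<forall>x\<in>U. r *s x \<in> U)"

lemma subspaceD:
  assumes "subspace U"
  shows "0 \<in> U" "x \<in> U \<Longrightarrow> y \<in> U \<Longrightarrow> x + y \<in> U" "x \<in> U \<Longrightarrow> r *s x \<in> U"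
    "x \<in> U \<Longrightarrow> - x \<in> U" "x \<in> U \<Longrightarrow> y \<in> U \<Longrightarrow> x - y \<in> U"
proof -
  show 0: "0 \<in> U" "x \<in> U \<Longrightarrow> y \<in> U \<Longrightarrow> x + y \<in> U" "x \<in> U \<Longrightarrow> r *s x \<in> U" for x y r
    using assms unfolding subspace_def by auto
  show m: "- x \<in> U" if "x \<in> U" for x
    using 0(3)[OF that, of "-1"] by (simp add: scale_minus_left scale_one)
  show "x \<in> U \<Longrightarrow> y \<in> U \<Longrightarrow> x - y \<in> U" using 0(2)[of x "- y"] m by simp
qed

section \<open>Valuations\<close>

text \<open>
  The element \<open>p v\<close> stands for the ideal generated by the positive part of \<open>v\<close>; at a prime filter
  \<open>P\<close> the vectors \<open>v\<close> with \<open>p v \<in> P\<close> are the strictly positive ones of a total preorder.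
\<close>

definition valuation :: "'v set \<Rightarrow> ('v \<Rightarrow> 'l::{distrib_lattice, bounded_lattice_bot}) \<Rightarrow> bool" where
  "valuation U p \<longleftrightarrow> p 0 = bot \<and> (\<forall>c. \<forall>u\<in>U. 0 < c \<longrightarrow> p (c *s u) = p u) \<and>
     (\<forall>u\<in>U. \<forall>v\<in>U. p (u + v) \<le> p u \<curlyvee> p v) \<and> (\<forall>u\<in>U. p u \<curlywedge> p (- u) = bot)"

text \<open>In terms of positive parts: if \<open>u\<^sup>+\<close> lies in the ideal of \<open>v\<^sup>+\<close> up to \<open>c\<close>, then a multiple of \<open>v\<^sup>+\<close>
  bounds \<open>u\<^sup>+\<close> up to \<open>c\<close>.\<close>

definition archimedean :: "'v set \<Rightarrow> ('v \<Rightarrow> 'l::{distrib_lattice, bounded_lattice_bot}) \<Rightarrow> bool" where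
  "archimedean U p \<longleftrightarrow>
     (\<forall>u\<in>U. \<forall>v\<in>U. \<forall>c. p u \<le> p v \<curlyvee> c \<longrightarrow> (\<exists>r>0. p u \<curlywedge> p (u - r *s v) \<le> c))"

end

locale valued_space = kspace scale
  for scale :: "'k::{division_ring, linordered_ring} \<Rightarrow> 'v::ab_group_add \<Rightarrow> 'v" (infixr "*s" 75) +
  fixes U :: "'v set" and p :: "'v \<Rightarrow> 'l::{distrib_lattice, bounded_lattice_bot}"
  assumes subspace: "subspace U" and valuation: "valuation U p"
begin

lemmas [simp, intro] = subspaceD[OF subspace]

lemma p_zero: "p 0 = bot" and p_scale: "0 < c \<Longrightarrow> u \<in> U \<Longrightarrow> p (c *s u) = p u"
  and p_add: "u \<in> U \<Longrightarrow> v \<in> U \<Longrightarrow> p (u + v) \<le> p u \<curlyvee> p v" and p_disjoint: "u \<in> U \<Longrightarrow> p u \<curlywedge> p (- u) = bot"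
  using valuation unfolding valuation_def by auto

definition lt :: "'l set \<Rightarrow> 'v \<Rightarrow> 'v \<Rightarrow> bool" where
  "lt P x y \<longleftrightarrow> p (y - x) \<in> P"

context
  fixes P :: "'l set"
  assumes P: "prime_filter P"
begin

lemma lt_irrefl: "\<not> lt P x x"
  using P by (simp add: lt_def p_zero prime_filterD)

lemma lt_asym: "lt P x y \<Longrightarrow> x \<in> U \<Longrightarrow> y \<in> U \<Longrightarrow> \<not> lt P y x"
  using p_disjoint[of "y - x"] prime_filterD[OF P] unfolding lt_def by (metis minus_diff_eq subspaceD(5) subspace)

text \<open>Subadditivity of \<open>p\<close> is negative transitivity. Together with asymmetry it
  makes \<open>lt P\<close> a strict weak order, that is, the strict part of a total
  preorder.\<close>

lemma lt_negtrans:
  assumes "lt P x z" "x \<in> U" "y \<in> U" "z \<in> U" shows "lt P x y \<or> lt P y z"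
proof -
  have "p ((y - x) + (z - y)) \<le> p (y - x) \<curlyvee> p (z - y)" using assms by (intro p_add) auto
  moreover have "(y - x) + (z - y) = z - x" by simp
  ultimately have "p (y - x) \<curlyvee> p (z - y) \<in> P"
    using prime_filter_mono[OF P] assms(1) unfolding lt_def by metis
  then show ?thesis using prime_filterD(2)[OF P] by (simp add: lt_def)
qed

lemma lt_le_trans: "lt P x y \<Longrightarrow> \<not> lt P z y \<Longrightarrow> x \<in> U \<Longrightarrow> y \<in> U \<Longrightarrow> z \<in> U \<Longrightarrow> lt P x z"
  using lt_negtrans by blast

lemma le_lt_trans: "\<not> lt P y x \<Longrightarrow> lt P y z \<Longrightarrow> x \<in> U \<Longrightarrow> y \<in> U \<Longrightarrow> z \<in> U \<Longrightarrow> lt P x z"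
  using lt_negtrans by blast

lemma lt_trans: "lt P x y \<Longrightarrow> lt P y z \<Longrightarrow> x \<in> U \<Longrightarrow> y \<in> U \<Longrightarrow> z \<in> U \<Longrightarrow> lt P x z"
  using lt_negtrans lt_asym by blast

lemma lt_scale: "0 < c \<Longrightarrow> x \<in> U \<Longrightarrow> y \<in> U \<Longrightarrow> lt P (c *s x) (c *s y) \<longleftrightarrow> lt P x y"
  using p_scale[of c "y - x"] by (simp add: lt_def scale_right_diff)

lemma lt_scale_zero: "0 < c \<Longrightarrow> x \<in> U \<Longrightarrow> lt P 0 (c *s x) \<longleftrightarrow> lt P 0 x"
  using lt_scale[of c 0 x] by simp

end

lemma lt_minus: "lt P (- x) (- y) \<longleftrightarrow> lt P y x"
  by (simp add: lt_def)

lemma lt_add: "lt P (x + z) (y + z) \<longleftrightarrow> lt P x y" "lt P (z + x) (z + y) \<longleftrightarrow> lt P x y"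
  "lt P (x - z) (y - z) \<longleftrightarrow> lt P x y" "lt P x (x + y) \<longleftrightarrow> lt P 0 y" "lt P (x + y) x \<longleftrightarrow> lt P y 0"
  by (simp_all add: lt_def algebra_simps)

lemma in_iff_lt: "p x \<in> P \<longleftrightarrow> lt P 0 x" "p (- x) \<in> P \<longleftrightarrow> lt P x 0" "p (x - y) \<in> P \<longleftrightarrow> lt P y x"
  by (simp_all add: lt_def)

section \<open>Inserting a cut\<close>

text \<open>
  A cut records a new vector \<open>e\<close> to be added to \<open>U\<close>: the elements \<open>A s\<close> and \<open>B s\<close> stand for
  \<open>p (e - s)\<close> and \<open>p (s - e)\<close>.
\<close>

definition cut :: "'v set \<Rightarrow> ('v \<Rightarrow> 'l) \<Rightarrow> ('v \<Rightarrow> 'l) \<Rightarrow> bool" where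
  "cut S A B \<longleftrightarrow> (\<forall>s\<in>S. A s \<curlywedge> B s = bot) \<and>
     (\<forall>s\<in>S. \<forall>t\<in>S. A s \<le> A t \<curlyvee> p (t - s) \<and> B s \<le> B t \<curlyvee> p (s - t) \<and> p (t - s) \<le> A s \<curlyvee> B t)"

text \<open>With \<open>A s \<in> P\<close> read as s < e and \<open>B s \<in> P\<close> as e < s,
  these are asymmetry and negative transitivity for comparisons that involve
  \<open>e\<close>.\<close>

lemma cut_prime:
  assumes "cut S A B" "prime_filter P" "s \<in> S"
  shows "A s \<in> P \<Longrightarrow> B s \<notin> P" "t \<in> S \<Longrightarrow> A s \<in> P \<Longrightarrow> A t \<in> P \<or> lt P s t"
    "t \<in> S \<Longrightarrow> B s \<in> P \<Longrightarrow> B t \<in> P \<or> lt P t s" "t \<in> S \<Longrightarrow> lt P s t \<Longrightarrow> A s \<in> P \<or> B t \<in> P"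
proof -
  show "B s \<notin> P" if "A s \<in> P"
    using that prime_filterD(1,3)[OF assms(2)] assms(1,3) unfolding cut_def by metis
  assume t: "t \<in> S"
  have le: "A s \<le> A t \<curlyvee> p (t - s)" "B s \<le> B t \<curlyvee> p (s - t)" "p (t - s) \<le> A s \<curlyvee> B t"
    using assms t unfolding cut_def by auto
  show "A t \<in> P \<or> lt P s t" if "A s \<in> P"
    using prime_filter_mono[OF assms(2) that le(1)] prime_filterD(2)[OF assms(2)] by (simp add: lt_def)
  show "B t \<in> P \<or> lt P t s" if "B s \<in> P"
    using prime_filter_mono[OF assms(2) that le(2)] prime_filterD(2)[OF assms(2)] by (simp add: lt_def)
  show "A s \<in> P \<or> B t \<in> P" if "lt P s t"
    using prime_filter_mono[OF assms(2) _ le(3)] that prime_filterD(2)[OF assms(2)] by (simp add: lt_def)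
qed

lemma cut_uminus:
  assumes "cut S A B" shows "cut (uminus ` S) (\<lambda>s. B (- s)) (\<lambda>s. A (- s))"
  using assms unfolding cut_def by (auto simp: inf_commute sup_commute)

text \<open>The prime filters at which the given cuts force \<open>e > t\<close>, respectively \<open>e < t\<close>.\<close>

definition above :: "'v set \<Rightarrow> ('v \<Rightarrow> 'l) \<Rightarrow> ('v \<Rightarrow> 'l) \<Rightarrow> 'v \<Rightarrow> 'l set set" where
  "above S A B t = {P. prime_filter P \<and> (\<exists>s\<in>S. A s \<in> P \<and> \<not> lt P s t \<or> lt P t s \<and> B s \<notin> P)}"

definition below :: "'v set \<Rightarrow> ('v \<Rightarrow> 'l) \<Rightarrow> ('v \<Rightarrow> 'l) \<Rightarrow> 'v \<Rightarrow> 'l set set" where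
  "below S A B t = {P. prime_filter P \<and> (\<exists>s\<in>S. B s \<in> P \<and> \<not> lt P t s \<or> lt P s t \<and> A s \<notin> P)}"

text \<open>If all listed elements of \<open>P\<close> were in \<open>Q\<close>, a witness
  \<open>r\<close> for e < t at \<open>Q\<close> would satisfy e \<le> r \<le> t at
  \<open>Q\<close>. These are negations of strict comparisons, so they pass back to
  \<open>P\<close>, where e > t is forced.\<close>

lemma above_below_incomparable:
  assumes cut: "cut S A B" and S: "S \<subseteq> U" and t: "t \<in> U"
    and P: "P \<in> above S A B t" and Q: "Q \<in> below S A B t"
  shows "\<exists>s\<in>S. A s \<in> P \<and> A s \<notin> Q \<or> B s \<in> P \<and> B s \<notin> Q \<or> (\<exists>s'\<in>insert t S. lt P s s' \<and> \<not> lt Q s s' \<or> lt P s' s \<and> \<not> lt Q s' s)"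
proof (rule ccontr)
  assume "\<not> ?thesis"
  then have mono: "\<And>s. s \<in> S \<Longrightarrow> A s \<in> P \<Longrightarrow> A s \<in> Q" "\<And>s. s \<in> S \<Longrightarrow> B s \<in> P \<Longrightarrow> B s \<in> Q"
    "\<And>s s'. s \<in> S \<Longrightarrow> s' \<in> insert t S \<Longrightarrow> lt P s s' \<Longrightarrow> lt Q s s'"
    "\<And>s s'. s \<in> S \<Longrightarrow> s' \<in> insert t S \<Longrightarrow> lt P s' s \<Longrightarrow> lt Q s' s" by blast+
  have pr: "prime_filter P" "prime_filter Q" using P Q by (auto simp: above_def below_def)
  obtain s where s: "s \<in> S" "A s \<in> P \<and> \<not> lt P s t \<or> lt P t s \<and> B s \<notin> P" using P by (auto simp: above_def)
  obtain r where r: "r \<in> S" "B r \<in> Q \<and> \<not> lt Q t r \<or> lt Q r t \<and> A r \<notin> Q" using Q by (auto simp: below_def)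
  have inU: "s \<in> U" "r \<in> U" using s r S by auto
  have Ar: "A r \<notin> P" using r mono(1)[of r] cut_prime(1)[OF cut pr(2), of r] by blast
  have "\<not> lt Q t r" using r lt_asym[OF pr(2), of r t] inU t by blast
  then have tr: "\<not> lt P t r" using mono(4)[of r t] r by blast
  show False
  proof (cases "A s \<in> P \<and> \<not> lt P s t")
    case True
    then have "lt P s r" using cut_prime(2)[OF cut pr(1), of s r] s r Ar by blast
    then show False using lt_negtrans[OF pr(1), of s r t] True tr inU t by blast
  next
    case False
    then have "lt P t s" "B s \<notin> P" using s by auto
    then have "lt P r s" using lt_negtrans[OF pr(1), of t s r] tr inU t by blast
    then show False using cut_prime(4)[OF cut pr(1), of r s] \<open>B s \<notin> P\<close> Ar s r by blast
  qed
qed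


text \<open>Replacing \<open>e\<close> by \<open>- e\<close> exchanges \<open>A\<close> and \<open>B\<close>, and \<open>above\<close> and \<open>below\<close>.\<close>

lemma above_uminus:
  "above (uminus ` S) (\<lambda>s. B (- s)) (\<lambda>s. A (- s)) (- t) = below S A B t"
  "below (uminus ` S) (\<lambda>s. B (- s)) (\<lambda>s. A (- s)) (- t) = above S A B t"
  by (simp_all add: above_def below_def lt_minus)

text \<open>Noninclusion in the other direction, by passing to - e. Both directions are needed
  because \<open>d\<close> is disjoint only on incomparable traces.\<close>

lemma below_above_incomparable:
  assumes cut: "cut S A B" and S: "S \<subseteq> U" and t: "t \<in> U"
    and P: "P \<in> above S A B t" and Q: "Q \<in> below S A B t"
  shows "\<exists>s\<in>S. A s \<in> Q \<and> A s \<notin> P \<or> B s \<in> Q \<and> B s \<notin> P \<or> (\<exists>s'\<in>insert t S. lt Q s s' \<and> \<not> lt P s s' \<or> lt Q s' s \<and> \<not> lt P s' s)"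
proof -
  have "insert (- t) (uminus ` S) = uminus ` insert t S" by simp
  then show ?thesis
    using above_below_incomparable[OF cut_uminus[OF cut], of "- t" Q P] S t P Q
    by (simp only: above_uminus lt_minus bex_simps(7) minus_minus) (auto simp: lt_minus)
qed

lemma above_upper:
  assumes cut: "cut S A B" and S: "S \<subseteq> U" and t: "t \<in> U" and s: "s \<in> S" and P: "P \<in> above S A B t"
  shows "A s \<in> P \<or> lt P t s"
proof -
  have pr: "prime_filter P" using P by (auto simp: above_def)
  obtain r where r: "r \<in> S" "A r \<in> P \<and> \<not> lt P r t \<or> lt P t r \<and> B r \<notin> P" using P by (auto simp: above_def)
  have "r \<in> U" "s \<in> U" using S s r by auto
  then show ?thesis
    using r s t cut_prime(2)[OF cut pr, of r s] cut_prime(4)[OF cut pr, of s r] lt_negtrans[OF pr, of r s t]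
      lt_negtrans[OF pr, of t r s] by blast
qed

lemma below_upper:
  assumes "cut S A B" "S \<subseteq> U" "t \<in> U" "s \<in> S" "P \<in> below S A B t"
  shows "B s \<in> P \<or> lt P s t"
  using above_upper[OF cut_uminus[OF assms(1)], of "- t" "- s" P] assms(2-5)
  by (auto simp: above_uminus lt_minus)

text \<open>The prime filters forcing e > t and those forcing e < t have incomparable traces on the
  values fixed so far, so complete normality provides disjoint values at \<open>t\<close>. The last
  two conclusions keep these values small, with \<open>G\<close> at the disposal of the caller: this
  is how archimedean requirements are imposed. If \<open>t\<close> is already in \<open>S\<close>,
  its old values have these bounds, since \<open>A t \<in> P\<close> itself forces e > t at
  \<open>P\<close>.\<close>

lemma insert_cut:
  assumes cn: "completely_normal TYPE('l)" and cut: "cut S A B" and fin: "finite S" and S: "S \<subseteq> U"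
    and t: "t \<in> U" and G: "finite G"
  obtains A' B' where "\<And>s. s \<in> S \<Longrightarrow> A' s = A s \<and> B' s = B s" "cut (insert t S) A' B'"
    "\<And>w z. (\<And>P. P \<in> above S A B t \<Longrightarrow> \<exists>g \<in> G \<inter> P. g \<curlywedge> w \<le> z) \<Longrightarrow> A' t \<curlywedge> w \<le> z"
    "\<And>w z. (\<And>P. P \<in> below S A B t \<Longrightarrow> \<exists>g \<in> G \<inter> P. g \<curlywedge> w \<le> z) \<Longrightarrow> B' t \<curlywedge> w \<le> z"
proof (cases "t \<in> S")
  case True
  have le: "a \<curlywedge> w \<le> z"
    if a: "\<And>P. prime_filter P \<Longrightarrow> a \<in> P \<Longrightarrow> P \<in> X" and X: "\<And>P. P \<in> X \<Longrightarrow> \<exists>g \<in> G \<inter> P. g \<curlywedge> w \<le> z" for a w z X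
  proof (rule le_by_prime_filter)
    fix P assume P: "prime_filter P" "a \<curlywedge> w \<in> P" "z \<notin> P"
    then have "P \<in> X" "w \<in> P" using a by (auto simp: prime_filterD)
    then show False using X P prime_filter_mono[OF P(1)] prime_filterD(3)[OF P(1)] by blast
  qed
  have "P \<in> above S A B t" if "prime_filter P" "A t \<in> P" for P
    using True that lt_irrefl by (auto simp: above_def)
  moreover have "P \<in> below S A B t" if "prime_filter P" "B t \<in> P" for P
    using True that lt_irrefl by (auto simp: below_def)
  moreover have "insert t S = S" using True by blast
  ultimately show thesis using cut le[of "A t" "above S A B t"] le[of "B t" "below S A B t"]
    by (intro that[of A B]) auto
next
  case False
  define F where "F = A ` S \<union> B ` S \<union> (\<lambda>(x, y). p (x - y)) ` (insert t S \<times> insert t S) \<union> G"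
  have finF: "finite F" using fin G by (simp add: F_def)
  have inF: "\<And>s. s \<in> S \<Longrightarrow> A s \<in> F" "\<And>s. s \<in> S \<Longrightarrow> B s \<in> F" "G \<subseteq> F"
    "\<And>x y. x \<in> insert t S \<Longrightarrow> y \<in> insert t S \<Longrightarrow> p (x - y) \<in> F"
    unfolding F_def by auto
  have inc: "\<not> P \<inter> F \<subseteq> Q" "\<not> Q \<inter> F \<subseteq> P"
    if P: "P \<in> above S A B t" and Q: "Q \<in> below S A B t" for P Q
  proof -
    show "\<not> P \<inter> F \<subseteq> Q"
    proof
      assume "P \<inter> F \<subseteq> Q"
      then have sub: "\<And>a. a \<in> F \<Longrightarrow> a \<in> P \<Longrightarrow> a \<in> Q" by blast
      show False using above_below_incomparable[OF cut S t P Q]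
        sub[OF inF(1)] sub[OF inF(2)] sub[OF inF(4)] unfolding lt_def by blast
    qed
    show "\<not> Q \<inter> F \<subseteq> P"
    proof
      assume "Q \<inter> F \<subseteq> P"
      then have sub: "\<And>a. a \<in> F \<Longrightarrow> a \<in> Q \<Longrightarrow> a \<in> P" by blast
      show False using below_above_incomparable[OF cut S t P Q]
        sub[OF inF(1)] sub[OF inF(2)] sub[OF inF(4)] unfolding lt_def by blast
    qed
  qed
  obtain x y where sep: "separating F (above S A B t) (below S A B t) x y"
    using separating_exists[OF cn finF inc] by blast
  have xy: "x \<curlywedge> y = bot" using sep unfolding separating_def by blast
  have x: "a \<le> b \<curlyvee> x" if "a \<in> F" "b \<in> F" "\<And>P. prime_filter P \<Longrightarrow> a \<in> P \<Longrightarrow> b \<notin> P \<Longrightarrow> P \<in> above S A B t" for a b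
    using sep that unfolding separating_def by simp
  have y: "a \<le> b \<curlyvee> y" if "a \<in> F" "b \<in> F" "\<And>P. prime_filter P \<Longrightarrow> a \<in> P \<Longrightarrow> b \<notin> P \<Longrightarrow> P \<in> below S A B t" for a b
    using sep that unfolding separating_def by simp
  have xu: "x \<curlywedge> w \<le> z" if "\<And>P. P \<in> above S A B t \<Longrightarrow> \<exists>f \<in> P \<inter> F. f \<curlywedge> w \<le> z" for w z
    using sep that unfolding separating_def by simp
  have yu: "y \<curlywedge> w \<le> z" if "\<And>P. P \<in> below S A B t \<Longrightarrow> \<exists>f \<in> P \<inter> F. f \<curlywedge> w \<le> z" for w z
    using sep that unfolding separating_def by simp
  define A' where "A' = A(t := x)"
  define B' where "B' = B(t := y)"
  have old: "A' s = A s" "B' s = B s" "s \<noteq> t" if "s \<in> S" for s using that False by (auto simp: A'_def B'_def)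
  have new: "A' t = x" "B' t = y" by (auto simp: A'_def B'_def)
  \<comment> \<open>Lower bounds for \<open>x\<close>: where the left side belongs to a prime filter
    and the old term on the right does not, \<open>s\<close> is a witness that e > t is
    forced.\<close>
  have "A s \<le> p (t - s) \<curlyvee> x" "p (s - t) \<le> B s \<curlyvee> x" if "s \<in> S" for s
    using that by (auto intro!: x inF simp: above_def lt_def)
  moreover have "B s \<le> p (s - t) \<curlyvee> y" "p (t - s) \<le> A s \<curlyvee> y" if "s \<in> S" for s
    using that by (auto intro!: y inF simp: below_def lt_def)
  moreover have "x \<le> A s \<curlyvee> p (s - t)" if s: "s \<in> S" for s
  proof -
    have "A s \<curlywedge> x \<le> A s \<curlyvee> p (s - t)" "p (s - t) \<curlywedge> x \<le> A s \<curlyvee> p (s - t)"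
      by (simp_all add: le_infI1)
    then have "\<exists>f \<in> P \<inter> F. f \<curlywedge> x \<le> A s \<curlyvee> p (s - t)" if P: "P \<in> above S A B t" for P
      using above_upper[OF cut S t s P] inF(1)[OF s] inF(4)[of s t] s unfolding lt_def by blast
    from xu[OF this] show ?thesis by simp
  qed
  moreover have "y \<le> B s \<curlyvee> p (t - s)" if s: "s \<in> S" for s
  proof -
    have "B s \<curlywedge> y \<le> B s \<curlyvee> p (t - s)" "p (t - s) \<curlywedge> y \<le> B s \<curlyvee> p (t - s)"
      by (simp_all add: le_infI1)
    then have "\<exists>f \<in> P \<inter> F. f \<curlywedge> y \<le> B s \<curlyvee> p (t - s)" if P: "P \<in> below S A B t" for P
      using below_upper[OF cut S t s P] inF(2)[OF s] inF(4)[of t s] s unfolding lt_def by blast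
    from yu[OF this] show ?thesis by simp
  qed
  ultimately have "cut (insert t S) A' B'"
    using cut xy unfolding cut_def by (simp add: old new p_zero sup_commute)
  moreover have "A' t \<curlywedge> w \<le> z" if *: "\<And>P. P \<in> above S A B t \<Longrightarrow> \<exists>g \<in> G \<inter> P. g \<curlywedge> w \<le> z" for w z
    unfolding new by (rule xu) (use * inF(3) in blast)
  moreover have "B' t \<curlywedge> w \<le> z" if *: "\<And>P. P \<in> below S A B t \<Longrightarrow> \<exists>g \<in> G \<inter> P. g \<curlywedge> w \<le> z" for w z
    unfolding new by (rule yu) (use * inF(3) in blast)
  ultimately show thesis using old by (intro that[of A' B']) auto
qed

end

section \<open>Meeting single archimedean requirements by extending a finite cut\<close>

locale archimedean_space = valued_space scale U p
  for scale :: "'k::{division_ring, linordered_ring} \<Rightarrow> 'v::ab_group_add \<Rightarrow> 'v" (infixr "*s" 75)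
    and U and p :: "'v \<Rightarrow> 'l::{distrib_lattice, bounded_lattice_bot}" +
  assumes archimedean: "archimedean U p"
    and completely_normal: "completely_normal TYPE('l)"
begin

definition finite_cut :: "'v set \<Rightarrow> ('v \<Rightarrow> 'l) \<Rightarrow> ('v \<Rightarrow> 'l) \<Rightarrow> bool" where
  "finite_cut S A B \<longleftrightarrow> finite S \<and> S \<subseteq> U \<and> cut S A B"

definition extends :: "'v set \<Rightarrow> ('v \<Rightarrow> 'l) \<Rightarrow> ('v \<Rightarrow> 'l) \<Rightarrow> 'v set \<Rightarrow> ('v \<Rightarrow> 'l) \<Rightarrow> ('v \<Rightarrow> 'l) \<Rightarrow> bool" where
  "extends S A B S' A' B' \<longleftrightarrow> S \<subseteq> S' \<and> (\<forall>s\<in>S. A' s = A s \<and> B' s = B s)"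

lemma extends_refl: "extends S A B S A B"
  by (simp add: extends_def)

lemma extends_trans: "extends S A B S' A' B' \<Longrightarrow> extends S' A' B' S'' A'' B'' \<Longrightarrow> extends S A B S'' A'' B''"
  unfolding extends_def by (metis subset_iff)

lemma finite_cut_extend:
  assumes "finite_cut S A B" "t \<in> U"
  obtains S' A' B' where "finite_cut S' A' B'" "extends S A B S' A' B'" "t \<in> S'"
proof -
  have 1: "cut S A B" "finite S" "S \<subseteq> U" using assms by (auto simp: finite_cut_def)
  obtain A' B' where "\<And>s. s \<in> S \<Longrightarrow> A' s = A s \<and> B' s = B s" "cut (insert t S) A' B'"
    using insert_cut[OF completely_normal 1 assms(2), of "{}"] by (metis finite.emptyI)
  then show thesis using 1 assms by (intro that[of "insert t S" A' B']) (auto simp: finite_cut_def extends_def)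
qed

text \<open>The instance of archimedeanity for \<open>e - u\<close> and \<open>v\<close>.\<close>

lemma finite_cut_above:
  assumes fc: "finite_cut S A B" and u: "u \<in> S" and v: "v \<in> U" and le: "A u \<le> p v \<curlyvee> c"
  obtains S' A' B' r where "finite_cut S' A' B'" "extends S A B S' A' B'"
    "r > 0" "u + r *s v \<in> S'" "A' u \<curlywedge> A' (u + r *s v) \<le> c"
proof -
  have S: "cut S A B" "finite S" "S \<subseteq> U" using fc by (auto simp: finite_cut_def)
  have uU: "u \<in> U" using S u by blast
  \<comment> \<open>\<open>B s\<close> is moved into the error term, which is harmless: a witness
    \<open>s\<close> forcing e > t at \<open>P\<close> always has \<open>B s\<close> outside
    \<open>P\<close>.\<close>
  have "\<exists>r>0. p (s - u) \<curlywedge> p (s - u - r *s v) \<le> c \<curlyvee> B s" if s: "s \<in> S" for s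
  proof -
    have "p (s - u) \<le> A u \<curlyvee> B s" using S(1) s u unfolding cut_def by blast
    also have "\<dots> \<le> p v \<curlyvee> (c \<curlyvee> B s)" using le by (metis sup_assoc sup_mono order_refl)
    finally show ?thesis using archimedean s S(3) uU v unfolding archimedean_def by (meson subsetD subspaceD(5) subspace)
  qed
  then obtain q where q: "\<And>s. s \<in> S \<Longrightarrow> q s > 0" "\<And>s. s \<in> S \<Longrightarrow> p (s - u) \<curlywedge> p (s - u - q s *s v) \<le> c \<curlyvee> B s"
    by metis
  obtain r where r: "r > 0" "\<And>s. s \<in> S \<Longrightarrow> q s < r" using finite_strict_upper_bound[OF S(2)] by metis
  define t where "t = u + r *s v"
  have t: "t \<in> U" using uU v by (auto simp: t_def)
  \<comment> \<open>Suppose that \<open>c\<close> fails, v \<ge> 0 and e > t is forced. If u < e,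
    then v > 0 and the witness \<open>s\<close> lies above u + q s v, against the choice of
    \<open>q s\<close>. If not, e \<le> u \<le> t.\<close>
  have claim: "c \<in> P \<or> lt P v 0" if P: "P \<in> above S A B t" for P
  proof (rule ccontr)
    assume "\<not> ?thesis"
    then have neg: "c \<notin> P" "\<not> lt P v 0" by auto
    have pr: "prime_filter P" using P by (auto simp: above_def)
    obtain s where s: "s \<in> S" "A s \<in> P \<and> \<not> lt P s t \<or> lt P t s \<and> B s \<notin> P" using P by (auto simp: above_def)
    have sU: "s \<in> U" using s S by blast
    have st: "\<not> lt P s t" using s(2) lt_asym[OF pr, of t s] t sU by blast
    have tu: "\<not> lt P t u"
    proof
      assume "lt P t u"
      then have "lt P (r *s v) 0" using lt_add(5) by (simp add: t_def)
      then show False using neg(2) lt_scale[OF pr r(1), of v 0] v by simp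
    qed
    show False
    proof (cases "A u \<in> P")
      case True
      then have "lt P 0 v" using prime_filter_mono[OF pr True le] neg prime_filterD(2)[OF pr] by (simp add: in_iff_lt)
      have "lt P 0 ((r - q s) *s v)" using lt_scale_zero[OF pr, of "r - q s" v] r(2)[OF s(1)] v \<open>lt P 0 v\<close> by simp
      then have "lt P (u + q s *s v) t" unfolding t_def lt_def by (simp add: scale_left_diff algebra_simps)
      then have 1: "lt P (u + q s *s v) s" using st t sU uU v lt_le_trans[OF pr, of "u + q s *s v" t s] by auto
      have "lt P u (u + q s *s v)" using lt_scale_zero[OF pr q(1)[OF s(1)] v] \<open>lt P 0 v\<close> lt_add(4) by simp
      then have "lt P u s" using lt_trans[OF pr _ 1] sU uU v by auto
      then have "p (s - u) \<curlywedge> p (s - u - q s *s v) \<in> P"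
        using 1 prime_filterD(3)[OF pr] unfolding lt_def by (simp add: algebra_simps)
      then have "c \<curlyvee> B s \<in> P" using prime_filter_mono[OF pr] q(2)[OF s(1)] by blast
      then have "B s \<in> P" using neg prime_filterD(2)[OF pr] by blast
      then show False using s cut_prime(1)[OF S(1) pr, of s] by blast
    next
      case False
      have "lt P s u" if "A s \<in> P" using cut_prime(2)[OF S(1) pr s(1) u that] False by blast
      moreover have "\<not> lt P s u" using lt_le_trans[OF pr, of s u t] tu st sU uU t by blast
      ultimately have "lt P t s" "B s \<notin> P" using s(2) by auto
      then have "lt P u s" using le_lt_trans[OF pr tu] t uU sU by blast
      then show False using cut_prime(4)[OF S(1) pr u s(1)] False \<open>B s \<notin> P\<close> by blast
    qed
  qed
  obtain A' B' where A': "\<And>s. s \<in> S \<Longrightarrow> A' s = A s \<and> B' s = B s" "cut (insert t S) A' B'"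
    "\<And>w z. (\<And>P. P \<in> above S A B t \<Longrightarrow> \<exists>g \<in> {c, p (- v)} \<inter> P. g \<curlywedge> w \<le> z) \<Longrightarrow> A' t \<curlywedge> w \<le> z"
    using insert_cut[OF completely_normal S t, of "{c, p (- v)}"] by (metis finite.emptyI finite.insertI)
  \<comment> \<open>Where v < 0, the hypothesis on \<open>A u\<close> leaves only \<open>c\<close>.
    So both members of the set handed to \<open>insert_cut\<close> control
    \<open>A u\<close>.\<close>
  have "p (- v) \<curlywedge> A u \<le> c"
  proof (rule le_by_prime_filter)
    fix P assume P: "prime_filter P" "p (- v) \<curlywedge> A u \<in> P" "c \<notin> P"
    then have "p (- v) \<in> P" "p v \<in> P"
      using prime_filter_mono[OF P(1) _ le] prime_filterD(2,3)[OF P(1)] by auto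
    then have "lt P v 0" "lt P 0 v" by (simp_all add: lt_def)
    then show False using lt_asym[OF P(1)] v by auto
  qed
  then have "\<exists>g \<in> {c, p (- v)} \<inter> P. g \<curlywedge> A u \<le> c" if "P \<in> above S A B t" for P
    using claim[OF that] unfolding lt_def by auto
  then have "A' t \<curlywedge> A u \<le> c" by (rule A'(3))
  then have "A' u \<curlywedge> A' (u + r *s v) \<le> c" using A'(1)[OF u] by (simp add: t_def inf_commute)
  moreover have "finite_cut (insert t S) A' B'" using A'(2) S t by (simp add: finite_cut_def)
  moreover have "extends S A B (insert t S) A' B'" using A'(1) by (auto simp: extends_def)
  moreover have "u + r *s v \<in> insert t S" by (simp add: t_def)
  ultimately show thesis using that r(1) by blast
qed

text \<open>The instance of archimedeanity for \<open>v\<close> and \<open>e - u\<close>.\<close>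

lemma finite_cut_below:
  assumes fc: "finite_cut S A B" and u: "u \<in> S" and v: "v \<in> U" and le: "p v \<le> A u \<curlyvee> c"
  obtains S' A' B' r where "finite_cut S' A' B'" "extends S A B S' A' B'"
    "r > 0" "u + r *s v \<in> S'" "p v \<curlywedge> B' (u + r *s v) \<le> c"
proof -
  have S: "cut S A B" "finite S" "S \<subseteq> U" using fc by (auto simp: finite_cut_def)
  have uU: "u \<in> U" using S u by blast
  have "\<exists>r>0. p v \<curlywedge> p (v - r *s (s - u)) \<le> A s \<curlyvee> c" if s: "s \<in> S" for s
  proof -
    have "A u \<le> A s \<curlyvee> p (s - u)" using S(1) s u unfolding cut_def by blast
    then have "A u \<curlyvee> c \<le> p (s - u) \<curlyvee> (A s \<curlyvee> c)" by (metis sup_assoc sup_commute sup_mono order_refl)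
    then have "p v \<le> p (s - u) \<curlyvee> (A s \<curlyvee> c)" using le by (rule order_trans[rotated])
    then show ?thesis using archimedean s S(3) uU v unfolding archimedean_def by (meson subsetD subspaceD(5) subspace)
  qed
  then obtain q where q: "\<And>s. s \<in> S \<Longrightarrow> q s > 0" "\<And>s. s \<in> S \<Longrightarrow> p v \<curlywedge> p (v - q s *s (s - u)) \<le> A s \<curlyvee> c"
    by metis
  obtain r where r: "r > 0" "\<And>s. s \<in> S \<Longrightarrow> q s < r" using finite_strict_upper_bound[OF S(2)] by metis
  \<comment> \<open>The bounds now concern multiples of s - u. Since r (t - u) = v, a point
    \<open>s\<close> with u < s \<le> t satisfies q s (s - u) < r (s - u) \<le> v; hence the
    inverse.\<close>
  define t where "t = u + inverse r *s v"
  have r': "inverse r > 0" using ordered_division_ring_pos(3) r by blast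
  have t: "t \<in> U" using uU v by (auto simp: t_def)
  have rt: "r *s (t - u) = v" using r(1) by (simp add: t_def)
  \<comment> \<open>For v > 0 the choice of \<open>r\<close> puts \<open>A s\<close> into
    \<open>P\<close>, impossible for a witness of e < t. Otherwise t \<le> u, and e < t gives e <
    u.\<close>
  have claim: "c \<in> P \<or> B u \<in> P" if P: "P \<in> below S A B t" for P
  proof (rule ccontr)
    assume "\<not> ?thesis"
    then have neg: "c \<notin> P" "B u \<notin> P" by auto
    have pr: "prime_filter P" using P by (auto simp: below_def)
    obtain s where s: "s \<in> S" "B s \<in> P \<and> \<not> lt P t s \<or> lt P s t \<and> A s \<notin> P" using P by (auto simp: below_def)
    have sU: "s \<in> U" using s S by blast
    have ts: "\<not> lt P t s" using s(2) lt_asym[OF pr, of s t] t sU by blast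
    show False
    proof (cases "lt P 0 v")
      case True
      have 1: "\<not> lt P v (r *s (s - u))"
        using ts lt_scale[OF pr r(1), of "t - u" "s - u"] t sU uU lt_add(3) rt by simp
      have "lt P (q s *s (s - u)) v"
      proof (cases "lt P u s")
        case True
        then have "lt P 0 (s - u)" by (simp add: lt_def)
        then have "lt P 0 ((r - q s) *s (s - u))" using lt_scale_zero[OF pr, of "r - q s" "s - u"] r(2)[OF s(1)] sU uU by simp
        then have "lt P (q s *s (s - u)) (r *s (s - u))" by (simp add: lt_def scale_left_diff)
        then show ?thesis using lt_le_trans[OF pr _ 1] sU uU v by auto
      next
        case False
        then have "\<not> lt P 0 (q s *s (s - u))" using lt_scale_zero[OF pr q(1)[OF s(1)], of "s - u"] sU uU by (simp add: lt_def)
        then show ?thesis using le_lt_trans[OF pr _ True] sU uU v by auto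
      qed
      then have "p v \<curlywedge> p (v - q s *s (s - u)) \<in> P"
        using True prime_filterD(3)[OF pr] unfolding lt_def by simp
      then have "A s \<curlyvee> c \<in> P" using prime_filter_mono[OF pr] q(2)[OF s(1)] by blast
      then have "A s \<in> P" using neg prime_filterD(2)[OF pr] by blast
      then show False using s cut_prime(1)[OF S(1) pr, of s] by blast
    next
      case False
      then have ut: "\<not> lt P u t" using lt_scale_zero[OF pr r' v] by (simp add: t_def lt_add)
      have us: "\<not> lt P u s" using lt_negtrans[OF pr, of u s t] ut ts t sU uU by blast
      then have "B s \<notin> P" using cut_prime(3)[OF S(1) pr s(1) u] neg by blast
      then have st: "lt P s t" "A s \<notin> P" using s(2) by auto
      then have "lt P s u" using lt_le_trans[OF pr, of s t u] ut t sU uU by blast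
      then show False using cut_prime(4)[OF S(1) pr s(1) u] neg st by blast
    qed
  qed
  obtain A' B' where A': "\<And>s. s \<in> S \<Longrightarrow> A' s = A s \<and> B' s = B s" "cut (insert t S) A' B'"
    "\<And>w z. (\<And>P. P \<in> below S A B t \<Longrightarrow> \<exists>g \<in> {c, B u} \<inter> P. g \<curlywedge> w \<le> z) \<Longrightarrow> B' t \<curlywedge> w \<le> z"
    using insert_cut[OF completely_normal S t, of "{c, B u}"] by (metis finite.emptyI finite.insertI)
  have "B u \<curlywedge> p v \<le> c"
  proof (rule le_by_prime_filter)
    fix P assume P: "prime_filter P" "B u \<curlywedge> p v \<in> P" "c \<notin> P"
    then have "B u \<in> P" "A u \<in> P"
      using prime_filter_mono[OF P(1) _ le] prime_filterD(2,3)[OF P(1)] by auto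
    then show False using cut_prime(1)[OF S(1) P(1) u] by blast
  qed
  then have "\<exists>g \<in> {c, B u} \<inter> P. g \<curlywedge> p v \<le> c" if "P \<in> below S A B t" for P
    using claim[OF that] by auto
  then have "B' t \<curlywedge> p v \<le> c" by (rule A'(3))
  then have "p v \<curlywedge> B' (u + inverse r *s v) \<le> c" by (simp add: t_def inf_commute)
  moreover have "finite_cut (insert t S) A' B'" using A'(2) S t by (simp add: finite_cut_def)
  moreover have "extends S A B (insert t S) A' B'" using A'(1) by (auto simp: extends_def)
  moreover have "u + inverse r *s v \<in> insert t S" by (simp add: t_def)
  ultimately show thesis using that r' by blast
qed

lemma finite_cut_uminus:
  assumes "finite_cut S A B" shows "finite_cut (uminus ` S) (\<lambda>s. B (- s)) (\<lambda>s. A (- s))"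
  using assms cut_uminus unfolding finite_cut_def by auto

lemma extends_uminus:
  assumes "extends (uminus ` S) (\<lambda>s. B (- s)) (\<lambda>s. A (- s)) S' A' B'"
  shows "extends S A B (uminus ` S') (\<lambda>s. B' (- s)) (\<lambda>s. A' (- s))"
  using assms unfolding extends_def by (auto simp: image_iff) (metis add.inverse_inverse imageI subset_iff)

text \<open>The first extension does not change \<open>A u\<close>, so the second hypothesis
  survives it; the values it adds survive the second extension.\<close>

lemma finite_cut_half_task:
  assumes fc: "finite_cut S A B" and u: "u \<in> S" and v: "v \<in> U"
    and le: "A u \<le> p v \<curlyvee> c" "p v \<le> A u \<curlyvee> d"
  obtains S' A' B' where "finite_cut S' A' B'" "extends S A B S' A' B'"
    "\<exists>r>0. u + r *s v \<in> S' \<and> A u \<curlywedge> A' (u + r *s v) \<le> c"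
    "\<exists>r>0. u + r *s v \<in> S' \<and> p v \<curlywedge> B' (u + r *s v) \<le> d"
proof -
  obtain S1 A1 B1 r1 where 1: "finite_cut S1 A1 B1" "extends S A B S1 A1 B1" "r1 > 0"
    "u + r1 *s v \<in> S1" "A1 u \<curlywedge> A1 (u + r1 *s v) \<le> c" using finite_cut_above[OF fc u v le(1)] .
  have u1: "u \<in> S1" "A1 u = A u" using 1(2) u by (auto simp: extends_def)
  obtain S2 A2 B2 r2 where 2: "finite_cut S2 A2 B2" "extends S1 A1 B1 S2 A2 B2" "r2 > 0"
    "u + r2 *s v \<in> S2" "p v \<curlywedge> B2 (u + r2 *s v) \<le> d"
    by (rule finite_cut_below[OF 1(1) u1(1) v]) (use le(2) u1 in auto)
  have "u + r1 *s v \<in> S2" "A u \<curlywedge> A2 (u + r1 *s v) \<le> c" using 2(2) 1(4,5) u1 by (auto simp: extends_def)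
  then show thesis using that[OF 2(1) extends_trans[OF 1(2) 2(2)]] 1(3) 2(3-5) by blast
qed

text \<open>The requirements on \<open>B u\<close> are those on \<open>A u\<close> for the vector -
  e at the point - u, with the same \<open>v\<close>.\<close>

lemma finite_cut_task:
  assumes fc: "finite_cut S A B" and u: "u \<in> S" and v: "v \<in> U"
    and le: "A u \<le> p v \<curlyvee> c" "B u \<le> p v \<curlyvee> c'" "p v \<le> A u \<curlyvee> d" "p v \<le> B u \<curlyvee> d'"
  shows "\<exists>S' A' B'. finite_cut S' A' B' \<and> extends S A B S' A' B' \<and>
    (\<exists>r>0. u + r *s v \<in> S' \<and> A u \<curlywedge> A' (u + r *s v) \<le> c) \<and>
    (\<exists>r>0. u - r *s v \<in> S' \<and> B u \<curlywedge> B' (u - r *s v) \<le> c') \<and>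
    (\<exists>r>0. u + r *s v \<in> S' \<and> p v \<curlywedge> B' (u + r *s v) \<le> d) \<and>
    (\<exists>r>0. u - r *s v \<in> S' \<and> p v \<curlywedge> A' (u - r *s v) \<le> d')"
proof -
  obtain S1 A1 B1 where 1: "finite_cut S1 A1 B1" "extends S A B S1 A1 B1"
    "\<exists>r>0. u + r *s v \<in> S1 \<and> A u \<curlywedge> A1 (u + r *s v) \<le> c"
    "\<exists>r>0. u + r *s v \<in> S1 \<and> p v \<curlywedge> B1 (u + r *s v) \<le> d"
    using finite_cut_half_task[OF fc u v le(1,3)] .
  have u1: "u \<in> S1" "B1 u = B u" using 1(2) u by (auto simp: extends_def)
  obtain S2 A2 B2 where 2: "finite_cut S2 A2 B2" "extends (uminus ` S1) (\<lambda>s. B1 (- s)) (\<lambda>s. A1 (- s)) S2 A2 B2"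
    "\<exists>r>0. - u + r *s v \<in> S2 \<and> B1 (- (- u)) \<curlywedge> A2 (- u + r *s v) \<le> c'"
    "\<exists>r>0. - u + r *s v \<in> S2 \<and> p v \<curlywedge> B2 (- u + r *s v) \<le> d'"
    by (rule finite_cut_half_task[OF finite_cut_uminus[OF 1(1)], of "- u" v c' d']) (use u1 v le in auto)
  define S' A' B' where "S' = uminus ` S2" and "A' = (\<lambda>s. B2 (- s))" and "B' = (\<lambda>s. A2 (- s))"
  have new: "finite_cut S' A' B'" "extends S1 A1 B1 S' A' B'"
    unfolding S'_def A'_def B'_def using finite_cut_uminus[OF 2(1)] extends_uminus[OF 2(2)] by auto
  have flip: "u - r *s v \<in> S' \<longleftrightarrow> - u + r *s v \<in> S2" "A' (u - r *s v) = B2 (- u + r *s v)" "B' (u - r *s v) = A2 (- u + r *s v)" for r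
  proof -
    have "x \<in> uminus ` S2 \<longleftrightarrow> - x \<in> S2" for x by (auto intro: image_eqI[of _ _ "- x"])
    from this[of "u - r *s v"] show "u - r *s v \<in> S' \<longleftrightarrow> - u + r *s v \<in> S2" by (simp add: S'_def)
  qed (simp_all add: A'_def B'_def)
  have "\<exists>r>0. u + r *s v \<in> S' \<and> A u \<curlywedge> A' (u + r *s v) \<le> c" "\<exists>r>0. u + r *s v \<in> S' \<and> p v \<curlywedge> B' (u + r *s v) \<le> d"
    using 1(3,4) new(2) unfolding extends_def by auto
  then show ?thesis using new(1) extends_trans[OF 1(2) new(2)] 2(3,4) u1(2)
    by (intro exI[of _ S'] exI[of _ A'] exI[of _ B']) (simp add: flip)
qed

end

section \<open>A complete cut as the union of a chain of finite cuts\<close>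

lemma countably_based_differences_sequence:
  assumes "countably_based_differences (TYPE('l::{distrib_lattice, bounded_lattice_bot}))"
  obtains \<beta> :: "'l \<Rightarrow> 'l \<Rightarrow> nat \<Rightarrow> 'l::{distrib_lattice, bounded_lattice_bot}" where
    "\<And>a b m. a \<le> b \<curlyvee> \<beta> a b m" "\<And>a b x. a \<le> b \<curlyvee> x \<Longrightarrow> \<exists>m. \<beta> a b m \<le> x"
proof -
  obtain C :: "'l \<Rightarrow> 'l \<Rightarrow> 'l set" where
    C: "\<And>a b. countable (C a b)" "\<And>a b x. a \<le> b \<curlyvee> x \<longleftrightarrow> (\<exists>c\<in>C a b. c \<le> x)"
    using assms unfolding countably_based_differences_def by metis
  have ne: "C a b \<noteq> {}" for a b using C(2)[of a b a] by auto
  show thesis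
  proof (rule that[of "\<lambda>a b. from_nat_into (C a b)"])
    show "a \<le> b \<curlyvee> from_nat_into (C a b) m" for a b m
      using C(2) from_nat_into[OF ne] by blast
    show "\<exists>m. from_nat_into (C a b) m \<le> x" if "a \<le> b \<curlyvee> x" for a b x
      using that C(2)[of a b x] from_nat_into_surj[OF C(1)] by metis
  qed
qed

context valued_space
begin

text \<open>The condition \<open>archimedean\<close> for the pairs (e - u, v), (u - e, v), (v, e -
  u) and (v, u - e); in the last two \<open>r\<close> is the inverse of the scalar occurring
  there.\<close>

definition archimedean_cut :: "('v \<Rightarrow> 'l) \<Rightarrow> ('v \<Rightarrow> 'l) \<Rightarrow> bool" where
  "archimedean_cut A B \<longleftrightarrow> (\<forall>u\<in>U. \<forall>v\<in>U. \<forall>c.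
     (A u \<le> p v \<curlyvee> c \<longrightarrow> (\<exists>r>0. A u \<curlywedge> A (u + r *s v) \<le> c)) \<and>
     (B u \<le> p v \<curlyvee> c \<longrightarrow> (\<exists>r>0. B u \<curlywedge> B (u - r *s v) \<le> c)) \<and>
     (p v \<le> A u \<curlyvee> c \<longrightarrow> (\<exists>r>0. p v \<curlywedge> B (u + r *s v) \<le> c)) \<and>
     (p v \<le> B u \<curlyvee> c \<longrightarrow> (\<exists>r>0. p v \<curlywedge> A (u - r *s v) \<le> c)))"

end

context archimedean_space
begin

text \<open>Values of the cut are never revised, so \<open>A u\<close> and \<open>B u\<close> are
  final once \<open>u\<close> has been reached, and the base of a difference can be enumerated from
  then on. A requirement met for every member of the base holds for every \<open>c\<close> by
  monotonicity.\<close>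

theorem archimedean_cut_exists:
  assumes cbd: "countably_based_differences TYPE('l)" and U: "countable U"
  obtains A B where "cut U A B" "archimedean_cut A B" "A 0 = l" "B 0 = bot"
proof -
  obtain \<beta> :: "'l \<Rightarrow> 'l \<Rightarrow> nat \<Rightarrow> 'l" where
    \<beta>: "\<And>a b m. a \<le> b \<curlyvee> \<beta> a b m" "\<And>a b x. a \<le> b \<curlyvee> x \<Longrightarrow> \<exists>m. \<beta> a b m \<le> x"
    using countably_based_differences_sequence[OF cbd] by metis
  define fc where "fc X = (case X of (S, A, B) \<Rightarrow> finite_cut S A B)" for X :: "'v set \<times> ('v \<Rightarrow> 'l) \<times> ('v \<Rightarrow> 'l)"
  define ext where "ext X Y = (case X of (S, A, B) \<Rightarrow> case Y of (S', A', B') \<Rightarrow> extends S A B S' A' B')" for X Y :: "'v set \<times> ('v \<Rightarrow> 'l) \<times> ('v \<Rightarrow> 'l)"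
  \<comment> \<open>One index \<open>m\<close> serves four different bases. As all triples are
    enumerated, each requirement still runs through its whole base.\<close>
  define task where "task u v m X = (case X of (S, A, B) \<Rightarrow> u \<in> S \<and>
    (\<exists>r>0. u + r *s v \<in> S \<and> A u \<curlywedge> A (u + r *s v) \<le> \<beta> (A u) (p v) m) \<and>
    (\<exists>r>0. u - r *s v \<in> S \<and> B u \<curlywedge> B (u - r *s v) \<le> \<beta> (B u) (p v) m) \<and>
    (\<exists>r>0. u + r *s v \<in> S \<and> p v \<curlywedge> B (u + r *s v) \<le> \<beta> (p v) (A u) m) \<and>
    (\<exists>r>0. u - r *s v \<in> S \<and> p v \<curlywedge> A (u - r *s v) \<le> \<beta> (p v) (B u) m))"
    for u v m and X :: "'v set \<times> ('v \<Rightarrow> 'l) \<times> ('v \<Rightarrow> 'l)"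
  have step: "\<exists>Y. fc Y \<and> ext X Y \<and> task u v m Y" if X: "fc X" and u: "u \<in> U" and v: "v \<in> U" for X u v m
  proof (cases X)
    case (fields S A B)
    then have "finite_cut S A B" using X by (simp add: fc_def)
    then obtain S1 A1 B1 where 1: "finite_cut S1 A1 B1" "extends S A B S1 A1 B1" "u \<in> S1"
      using finite_cut_extend[OF _ u] by metis
    obtain S2 A2 B2 where 2: "finite_cut S2 A2 B2" "extends S1 A1 B1 S2 A2 B2"
      "\<exists>r>0. u + r *s v \<in> S2 \<and> A1 u \<curlywedge> A2 (u + r *s v) \<le> \<beta> (A1 u) (p v) m"
      "\<exists>r>0. u - r *s v \<in> S2 \<and> B1 u \<curlywedge> B2 (u - r *s v) \<le> \<beta> (B1 u) (p v) m"
      "\<exists>r>0. u + r *s v \<in> S2 \<and> p v \<curlywedge> B2 (u + r *s v) \<le> \<beta> (p v) (A1 u) m"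
      "\<exists>r>0. u - r *s v \<in> S2 \<and> p v \<curlywedge> A2 (u - r *s v) \<le> \<beta> (p v) (B1 u) m"
      using finite_cut_task[OF 1(1,3) v \<beta>(1)[of "A1 u" "p v" m] \<beta>(1)[of "B1 u" "p v" m]
        \<beta>(1)[of "p v" "A1 u" m] \<beta>(1)[of "p v" "B1 u" m]] by blast
    have "A2 u = A1 u" "B2 u = B1 u" "u \<in> S2" using 2(2) 1(3) by (auto simp: extends_def)
    then have "task u v m (S2, A2, B2)" using 2(3-6) by (simp add: task_def)
    moreover have "extends S A B S2 A2 B2" using 1(2) 2(2) by (rule extends_trans)
    ultimately show ?thesis using 2(1) fields by (intro exI[of _ "(S2, A2, B2)"]) (simp add: fc_def ext_def)
  qed
  define T where "T = U \<times> U \<times> (UNIV :: nat set)"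
  have T: "countable T" "T \<noteq> {}" using U subspaceD(1)[OF subspace] by (auto simp: T_def)
  define f where "f = from_nat_into T"
  have "\<exists>X :: nat \<Rightarrow> 'v set \<times> ('v \<Rightarrow> 'l) \<times> ('v \<Rightarrow> 'l). \<forall>n. (fc (X n) \<and> (n = 0 \<longrightarrow> X n = ({0}, (\<lambda>_. l), (\<lambda>_. bot)))) \<and>
    (ext (X n) (X (Suc n)) \<and> (\<forall>u v m. f n = (u, v, m) \<longrightarrow> task u v m (X (Suc n))))"
    (is "\<exists>X. \<forall>n. ?chain X n")
  proof (rule dependent_nat_choice)
    \<comment> \<open>On the single point 0 the cut conditions reduce to disjointness of
      \<open>A 0\<close> and \<open>B 0\<close>; with \<open>B 0 = bot\<close> the value
      \<open>l\<close> of \<open>e\<close> can be arbitrary.\<close>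
    show "\<exists>x. fc x \<and> ((0::nat) = 0 \<longrightarrow> x = ({0}, (\<lambda>_. l), (\<lambda>_. bot)))"
      by (auto simp: fc_def finite_cut_def cut_def p_zero)
    fix X and n :: nat
    assume X: "fc X \<and> (n = 0 \<longrightarrow> X = ({0}, (\<lambda>_. l), (\<lambda>_. bot)))"
    obtain u v m where fn: "f n = (u, v, m)" by (cases "f n") auto
    have "f n \<in> T" unfolding f_def by (rule from_nat_into[OF T(2)])
    then have "u \<in> U" "v \<in> U" using fn by (auto simp: T_def)
    then show "\<exists>Y. (fc Y \<and> (Suc n = 0 \<longrightarrow> Y = ({0}, (\<lambda>_. l), (\<lambda>_. bot)))) \<and> ext X Y \<and>
      (\<forall>u v m. f n = (u, v, m) \<longrightarrow> task u v m Y)"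
      using step[of X u v m] X fn by auto
  qed
  then obtain X where chain: "\<forall>n. ?chain X n" by (rule exE)
  have fcX: "fc (X n)" and extX: "ext (X n) (X (Suc n))" for n using chain by simp_all
  have X0: "X 0 = ({0}, (\<lambda>_. l), (\<lambda>_. bot))" using chain by simp
  have task: "task u v m (X (Suc n))" if "f n = (u, v, m)" for n u v m using chain that by simp
  define S where "S n = fst (X n)" for n
  define a where "a n = fst (snd (X n))" for n
  define b where "b n = snd (snd (X n))" for n
  have X: "X n = (S n, a n, b n)" for n by (simp add: S_def a_def b_def)
  have S: "S n \<subseteq> U" "cut (S n) (a n) (b n)" for n
    using fcX[of n] by (auto simp: fc_def X finite_cut_def)
  have ext: "extends (S n) (a n) (b n) (S k) (a k) (b k)" if "n \<le> k" for n k
    using that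
  proof (induction rule: dec_induct)
    case base
    show ?case by (rule extends_refl)
  next
    case (step k)
    then show ?case using extX[of k] extends_trans unfolding ext_def X by blast
  qed
  define N where "N u = (LEAST n. u \<in> S n)" for u
  define A where "A u = a (N u) u" for u
  define B where "B u = b (N u) u" for u
  have AB: "A u = a n u" "B u = b n u" if "u \<in> S n" for u n
  proof -
    have "u \<in> S (N u)" "N u \<le> n" using that unfolding N_def by (auto intro: LeastI Least_le)
    then show "A u = a n u" "B u = b n u" using ext[of "N u" n] by (auto simp: A_def B_def extends_def)
  qed
  have t: "\<exists>n. task u v m (X n)" if "u \<in> U" "v \<in> U" for u v m
  proof -
    have "(u, v, m) \<in> T" using that by (simp add: T_def)
    then obtain n where "f n = (u, v, m)" using from_nat_into_surj[OF T(1)] unfolding f_def by blast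
    then show ?thesis using task by blast
  qed
  have cover: "\<exists>n. u \<in> S n" if "u \<in> U" for u
    using t[OF that that, of 0] by (auto simp: task_def X)
  have cut2: "\<exists>n. u \<in> S n \<and> v \<in> S n" if "u \<in> U" "v \<in> U" for u v
  proof -
    obtain n k where "u \<in> S n" "v \<in> S k" using cover \<open>u \<in> U\<close> \<open>v \<in> U\<close> by blast
    then show ?thesis using ext[of n "max n k"] ext[of k "max n k"] unfolding extends_def by (metis max.cobounded1 max.cobounded2 subsetD)
  qed
  have "cut U A B"
    unfolding cut_def
  proof (intro conjI ballI)
    fix u v assume uv: "u \<in> U" "v \<in> U"
    obtain n where n: "u \<in> S n" "v \<in> S n" using cut2[OF uv] by blast
    then show "A u \<curlywedge> B u = bot" "A u \<le> A v \<curlyvee> p (v - u)" "B u \<le> B v \<curlyvee> p (u - v)" "p (v - u) \<le> A u \<curlyvee> B v"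
      using S(2)[of n] unfolding cut_def by (simp_all add: AB)
  qed
  moreover have "archimedean_cut A B"
    unfolding archimedean_cut_def
  proof (intro ballI allI conjI impI)
    fix u v c assume uv: "u \<in> U" "v \<in> U"
    have lim: "task u v m (U, A, B)" for m using t[OF uv, of m] S(1) by (fastforce simp: task_def X AB)
    show "\<exists>r>0. A u \<curlywedge> A (u + r *s v) \<le> c" if le: "A u \<le> p v \<curlyvee> c"
    proof -
      obtain m where "\<beta> (A u) (p v) m \<le> c" using \<beta>(2)[OF le] by blast
      then show ?thesis using lim[of m] by (auto simp: task_def intro: order_trans)
    qed
    show "\<exists>r>0. B u \<curlywedge> B (u - r *s v) \<le> c" if le: "B u \<le> p v \<curlyvee> c"
    proof -
      obtain m where "\<beta> (B u) (p v) m \<le> c" using \<beta>(2)[OF le] by blast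
      then show ?thesis using lim[of m] by (auto simp: task_def intro: order_trans)
    qed
    show "\<exists>r>0. p v \<curlywedge> B (u + r *s v) \<le> c" if le: "p v \<le> A u \<curlyvee> c"
    proof -
      obtain m where "\<beta> (p v) (A u) m \<le> c" using \<beta>(2)[OF le] by blast
      then show ?thesis using lim[of m] by (auto simp: task_def intro: order_trans)
    qed
    show "\<exists>r>0. p v \<curlywedge> A (u - r *s v) \<le> c" if le: "p v \<le> B u \<curlyvee> c"
    proof -
      obtain m where "\<beta> (p v) (B u) m \<le> c" using \<beta>(2)[OF le] by blast
      then show ?thesis using lim[of m] by (auto simp: task_def intro: order_trans)
    qed
  qed
  moreover have "A 0 = l" "B 0 = bot"
    using AB[of 0 0] X0 by (simp_all add: X)
  ultimately show thesis by (rule that)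
qed

end

section \<open>Extending the valuation to the vectors u + r e\<close>

lemma inverse_less_inverse:
  fixes a b :: "'k::{division_ring, linordered_ring}"
  assumes "0 < b" "b < a" shows "inverse a < inverse b"
proof -
  have "inverse b - inverse a = inverse a * (a - b) * inverse b"
    using assms by (simp add: algebra_simps)
  also have "\<dots> > 0" using assms ordered_division_ring_pos(2,3)[where 'k='k] by simp
  finally show ?thesis by simp
qed

context valued_space
begin

text \<open>\<open>adjoin A B u r\<close> is the value of \<open>u + r e\<close>, where \<open>e\<close> is the vector described by the cut \<open>A\<close>, \<open>B\<close>.\<close>

definition adjoin :: "('v \<Rightarrow> 'l) \<Rightarrow> ('v \<Rightarrow> 'l) \<Rightarrow> 'v \<Rightarrow> 'k \<Rightarrow> 'l" where
  "adjoin A B u r = (if r = 0 then p u else if 0 < r then A (- (inverse r *s u)) else B (- (inverse r *s u)))"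

lemma adjoin_simps [simp]: "adjoin A B u 0 = p u" "0 < r \<Longrightarrow> adjoin A B u r = A (- (inverse r *s u))"
  "r < 0 \<Longrightarrow> adjoin A B u r = B (- (inverse r *s u))"
  by (auto simp: adjoin_def)

lemma adjoin_uminus: "adjoin (\<lambda>s. B (- s)) (\<lambda>s. A (- s)) u r = adjoin A B u (- r)"
  by (cases r "0::'k" rule: linorder_cases) (simp_all add: scale_minus_left)

lemma cut_UNIV_uminus: "cut U A B \<Longrightarrow> cut U (\<lambda>s. B (- s)) (\<lambda>s. A (- s))"
proof -
  have "uminus ` U = U" by (auto intro: image_eqI[of _ _ "- x" for x])
  then show "cut U A B \<Longrightarrow> cut U (\<lambda>s. B (- s)) (\<lambda>s. A (- s))" using cut_uminus[of U A B] by simp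
qed

lemma archimedean_cut_uminus:
  assumes "archimedean_cut A B" shows "archimedean_cut (\<lambda>s. B (- s)) (\<lambda>s. A (- s))"
  unfolding archimedean_cut_def
proof (intro ballI allI conjI)
  fix u v c assume "u \<in> U" "v \<in> U"
  then have *: "- u \<in> U" by simp
  have eq: "- (u + r *s v) = - u - r *s v" "- (u - r *s v) = - u + r *s v" for r by simp_all
  note h = assms[unfolded archimedean_cut_def, rule_format, OF * \<open>v \<in> U\<close>, of c]
  show "B (- u) \<le> p v \<curlyvee> c \<longrightarrow> (\<exists>r>0. B (- u) \<curlywedge> B (- (u + r *s v)) \<le> c)"
    "A (- u) \<le> p v \<curlyvee> c \<longrightarrow> (\<exists>r>0. A (- u) \<curlywedge> A (- (u - r *s v)) \<le> c)"
    "p v \<le> B (- u) \<curlyvee> c \<longrightarrow> (\<exists>r>0. p v \<curlywedge> A (- (u + r *s v)) \<le> c)"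
    "p v \<le> A (- u) \<curlyvee> c \<longrightarrow> (\<exists>r>0. p v \<curlywedge> B (- (u - r *s v)) \<le> c)"
    unfolding eq using h by blast+
qed

lemma adjoin_scale:
  assumes "0 < c" shows "adjoin A B (c *s u) (c * r) = (if r = 0 then p (c *s u) else adjoin A B u r)"
proof (cases r "0::'k" rule: linorder_cases)
  case less
  then have "c * r < 0" using ordered_division_ring_pos(2)[of c "- r"] assms by simp
  moreover have "inverse (c * r) *s c *s u = inverse r *s u"
    using assms less by (simp add: scale_scale nonzero_inverse_mult_distrib mult.assoc)
  moreover have "r \<noteq> 0" using less by simp
  ultimately show ?thesis using less by simp
next
  case greater
  then have "c * r > 0" using ordered_division_ring_pos(2)[of c r] assms by simp
  moreover have "inverse (c * r) *s c *s u = inverse r *s u"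
    using assms greater by (simp add: scale_scale nonzero_inverse_mult_distrib mult.assoc)
  moreover have "r \<noteq> 0" using greater by simp
  ultimately show ?thesis using greater by simp
qed simp

lemma adjoin_disjoint:
  assumes "cut U A B" "u \<in> U" shows "adjoin A B u r \<curlywedge> adjoin A B (- u) (- r) = bot"
proof (cases r "0::'k" rule: linorder_cases)
  case less
  then show ?thesis using assms by (simp add: cut_def scale_minus_left scale_minus_right inf_commute)
next
  case greater
  then show ?thesis using assms by (simp add: cut_def scale_minus_left scale_minus_right)
qed (use assms p_disjoint in simp)

text \<open>For r > 0 the vector u + r e is positive iff e > x, and the cut points satisfy (r + s) w
  = r x + s y. If e > w but not e > x, then w < x. For s > 0 this puts \<open>y\<close> below
  \<open>w\<close>, so e > y; for s < 0 it puts \<open>y\<close> above \<open>x\<close>, so e < y;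
  for s = 0 it says v > 0.\<close>

lemma adjoin_add_pos:
  assumes cut: "cut U A B" and u: "u \<in> U" and v: "v \<in> U" and r: "0 < r" "0 < r + s"
  shows "adjoin A B (u + v) (r + s) \<le> adjoin A B u r \<curlyvee> adjoin A B v s"
proof (rule le_by_prime_filter)
  fix P assume P: "prime_filter P" "adjoin A B (u + v) (r + s) \<in> P" "adjoin A B u r \<curlyvee> adjoin A B v s \<notin> P"
  define x where "x = - (inverse r *s u)"
  define w where "w = - (inverse (r + s) *s (u + v))"
  have U: "x \<in> U" "w \<in> U" using u v by (simp_all add: x_def w_def)
  have rx: "r *s x = - u" using r by (simp add: x_def scale_minus_right)
  have rw: "(r + s) *s w = - (u + v)" using r by (simp add: w_def scale_minus_right del: minus_add_distrib)
  have Aw: "A w \<in> P" and Ax: "A x \<notin> P" and vs: "adjoin A B v s \<notin> P"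
    using P r prime_filterD(2)[OF P(1)] by (simp_all add: x_def w_def)
  have wx: "lt P w x" using cut_prime(2)[OF cut P(1) U(2,1) Aw] Ax by blast
  show False
  proof (cases s "0::'k" rule: linorder_cases)
    case equal
    then have "v = r *s (x - w)" using rx rw by (simp add: scale_right_diff)
    then have "lt P 0 v" using lt_scale_zero[OF P(1) r(1), of "x - w"] wx U by (simp add: lt_def)
    then show False using vs equal by (simp add: lt_def)
  next
    case greater
    define y where "y = - (inverse s *s v)"
    have y: "y \<in> U" using v by (simp add: y_def)
    have "s *s y = - v" using greater by (simp add: y_def scale_minus_right)
    then have "s *s (w - y) = r *s (x - w)" using rx rw by (simp add: scale_right_diff scale_left_add algebra_simps)
    then have "lt P y w"
      using lt_scale_zero[OF P(1) greater, of "w - y"] lt_scale_zero[OF P(1) r(1), of "x - w"] wx U y by (simp add: lt_def)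
    then have "\<not> lt P w y" using lt_asym[OF P(1)] U y by blast
    then have "A y \<in> P" using cut_prime(2)[OF cut P(1) U(2) y Aw] by blast
    then show False using vs greater by (simp add: y_def)
  next
    case less
    define y where "y = - (inverse s *s v)"
    have y: "y \<in> U" using v by (simp add: y_def)
    have "s *s y = - v" using less by (simp add: y_def scale_minus_right)
    then have "(- s) *s (y - x) = (r + s) *s (x - w)"
      using rx rw by (simp add: scale_right_diff scale_left_add scale_minus_left algebra_simps)
    then have "lt P x y"
      using lt_scale_zero[OF P(1), of "- s" "y - x"] less lt_scale_zero[OF P(1) r(2), of "x - w"] wx U y by (simp add: lt_def)
    then have "B y \<in> P" using cut_prime(4)[OF cut P(1) U(1) y] Ax by blast
    then show False using vs less by (simp add: y_def)
  qed
qed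

text \<open>The two multiples of \<open>e\<close> cancel, and u + v is \<open>r\<close> times the
  difference of the two cut points, which the third condition on cuts controls.\<close>

lemma adjoin_add_zero:
  assumes cut: "cut U A B" and u: "u \<in> U" and v: "v \<in> U" and r: "0 < r"
  shows "p (u + v) \<le> adjoin A B u r \<curlyvee> adjoin A B v (- r)"
proof -
  define x where "x = - (inverse r *s u)"
  define y where "y = inverse r *s v"
  have "u + v = r *s (y - x)" using r by (simp add: x_def y_def scale_right_diff scale_right_add)
  then have "p (u + v) = p (y - x)" using r u v by (simp add: p_scale x_def y_def)
  also have "x \<in> U" "y \<in> U" using u v by (simp_all add: x_def y_def)
  then have "p (y - x) \<le> A x \<curlyvee> B y" using cut unfolding cut_def by blast
  finally show ?thesis using r by (simp add: x_def y_def scale_minus_left)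
qed

text \<open>If r + s > 0, one of the summands is positive and may be taken as the first. The case r
  + s < 0 follows on replacing \<open>e\<close> by - e.\<close>

lemma adjoin_add:
  assumes cut: "cut U A B" and u: "u \<in> U" and v: "v \<in> U"
  shows "adjoin A B (u + v) (r + s) \<le> adjoin A B u r \<curlyvee> adjoin A B v s"
proof -
  have pos: "adjoin A B (u + v) (r + s) \<le> adjoin A B u r \<curlyvee> adjoin A B v s"
    if cut: "cut U A B" and rs: "0 < r + s" for A B r s
  proof (cases "0 < r")
    case True
    then show ?thesis using adjoin_add_pos[OF cut u v _ rs] by blast
  next
    case False
    then have "0 < s" using rs by (metis add_nonpos_nonpos linorder_not_less)
    then show ?thesis using adjoin_add_pos[OF cut v u, of s r] rs by (simp add: add.commute sup_commute)
  qed
  show ?thesis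
  proof (cases "r + s" "0::'k" rule: linorder_cases)
    case greater
    then show ?thesis using pos[OF cut] by blast
  next
    case less
    have eq: "- (- r + - s) = r + s" by simp
    have "0 < - r + - s" using less by (metis eq neg_less_0_iff_less)
    from pos[OF cut_UNIV_uminus[OF cut] this] show ?thesis unfolding adjoin_uminus eq by simp
  next
    case equal
    then have s: "s = - r" by (simp add: add_eq_0_iff)
    show ?thesis
    proof (cases r "0::'k" rule: linorder_cases)
      case equal
      then show ?thesis using s p_add[OF u v] by simp
    next
      case greater
      then show ?thesis using s adjoin_add_zero[OF cut u v greater] by simp
    next
      case less
      then show ?thesis using s adjoin_add_zero[OF cut v u, of "- r"] by (simp add: add.commute sup_commute)
    qed
  qed
qed

end

context archimedean_space
begin

definition archimedean_pair :: "('v \<Rightarrow> 'l) \<Rightarrow> ('v \<Rightarrow> 'l) \<Rightarrow> 'v \<Rightarrow> 'k \<Rightarrow> 'v \<Rightarrow> 'k \<Rightarrow> bool" where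
  "archimedean_pair A B u r v s \<longleftrightarrow> (\<forall>c. adjoin A B u r \<le> adjoin A B v s \<curlyvee> c \<longrightarrow>
     (\<exists>q>0. adjoin A B u r \<curlywedge> adjoin A B (u - q *s v) (r - q * s) \<le> c))"

lemma archimedean_pair_uminus:
  "archimedean_pair (\<lambda>s. B (- s)) (\<lambda>s. A (- s)) u r v s = archimedean_pair A B u (- r) v (- s)"
  unfolding archimedean_pair_def adjoin_uminus by simp

text \<open>The scalar in front of b (v + s e) has to cancel \<open>b\<close> before
  \<open>q\<close> acts, and \<open>a\<close> is applied last. As scalars need not commute, this
  fixes the order in a q b^-1.\<close>

lemma archimedean_pair_scale:
  assumes arch: "archimedean_pair A B u r v s" and u: "u \<in> U" and v: "v \<in> U" and pos: "0 < a" "0 < b"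
  shows "archimedean_pair A B (a *s u) (a * r) (b *s v) (b * s)"
proof -
  have eq: "adjoin A B (c *s w) (c * t) = adjoin A B w t" if "w \<in> U" "0 < c" for c t w
    using that adjoin_scale[of c A B w t] p_scale[of c w] by simp
  show ?thesis
    unfolding archimedean_pair_def eq[OF u pos(1)] eq[OF v pos(2)]
  proof (intro allI impI)
    fix c assume "adjoin A B u r \<le> adjoin A B v s \<curlyvee> c"
    then obtain q where q: "q > 0" "adjoin A B u r \<curlywedge> adjoin A B (u - q *s v) (r - q * s) \<le> c"
      using arch unfolding archimedean_pair_def by blast
    have "a * q * inverse b > 0" using q pos by (intro ordered_division_ring_pos)
    moreover have "a *s u - (a * q * inverse b) *s b *s v = a *s (u - q *s v)"
      "a * r - a * q * inverse b * (b * s) = a * (r - q * s)"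
    proof -
      have "a * q * inverse b * b = a * q" using pos by (simp add: mult.assoc)
      then show "a *s u - (a * q * inverse b) *s b *s v = a *s (u - q *s v)"
        by (simp add: scale_scale scale_right_diff)
      show "a * r - a * q * inverse b * (b * s) = a * (r - q * s)"
        using \<open>a * q * inverse b * b = a * q\<close> by (simp add: mult.assoc[symmetric] right_diff_distrib)
    qed
    ultimately show "\<exists>q>0. adjoin A B u r \<curlywedge> adjoin A B (a *s u - q *s b *s v) (a * r - q * (b * s)) \<le> c"
      using q(2) eq[of "u - q *s v" a "r - q * s"] pos u v by (intro exI[of _ "a * q * inverse b"]) simp
  qed
qed

text \<open>The two pairs with a coefficient 0 are requirements on the cut. In the other two, both
  vectors involve \<open>e\<close>; eliminating it leaves a vector of \<open>U\<close>, which can be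
  compared with \<open>e\<close> by means of the cut.\<close>

lemma archimedean_pair_normalized:
  assumes cut: "cut U A B" and arch: "archimedean_cut A B" and u: "u \<in> U" and v: "v \<in> U"
  shows "archimedean_pair A B u 1 v 0" "archimedean_pair A B u 0 v 1"
    "archimedean_pair A B u 1 v 1" "archimedean_pair A B u 1 v (- 1)"
proof -
  have one: "0 < (1::'k)" "(-1::'k) < 0" by (simp_all add: ordered_division_ring_pos)
  have inv1: "inverse (-1::'k) = - 1" by (rule inverse_unique) simp
  have a1: "adjoin A B w 1 = A (- w)" "adjoin A B w (- 1) = B w" for w
    using one by (simp_all add: scale_one scale_minus_left inv1)
  note h = arch[unfolded archimedean_cut_def, rule_format]
  show "archimedean_pair A B u 1 v 0"
    unfolding archimedean_pair_def a1
  proof (intro allI impI)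
    fix c assume "A (- u) \<le> adjoin A B v 0 \<curlyvee> c"
    then obtain q where "q > 0" "A (- u) \<curlywedge> A (- u + q *s v) \<le> c" using h[of "- u" v c] u v by auto
    then show "\<exists>q>0. A (- u) \<curlywedge> adjoin A B (u - q *s v) (1 - q * 0) \<le> c" by (auto simp: a1 algebra_simps)
  qed
  show "archimedean_pair A B u 0 v 1"
    unfolding archimedean_pair_def a1
  proof (intro allI impI)
    fix c assume "adjoin A B u 0 \<le> A (- v) \<curlyvee> c"
    then obtain q where q: "q > 0" "p u \<curlywedge> B (- v + q *s u) \<le> c" using h[of "- v" u c] u v by auto
    have "inverse q > 0" using q by (simp add: ordered_division_ring_pos)
    moreover have "q *s (u - inverse q *s v) = - v + q *s u" using q by (simp add: scale_right_diff)
    ultimately have "adjoin A B (u - inverse q *s v) (0 - inverse q * 1) = B (- v + q *s u)"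
      using q by (simp add: scale_minus_left)
    then show "\<exists>q>0. adjoin A B u 0 \<curlywedge> adjoin A B (u - q *s v) (0 - q * 1) \<le> c"
      using q(2) \<open>inverse q > 0\<close> by (intro exI[of _ "inverse q"]) simp
  qed
  show "archimedean_pair A B u 1 v 1"
    unfolding archimedean_pair_def a1
  proof (intro allI impI)
    fix c assume le: "A (- u) \<le> A (- v) \<curlyvee> c"
    define x where "x = - u"
    define y where "y = - v"
    have U: "x \<in> U" "y \<in> U" using u v by (simp_all add: x_def y_def)
    have "p (y - x) \<le> A x \<curlyvee> B y" using cut U unfolding cut_def by blast
    also have "\<dots> \<le> A y \<curlyvee> (B y \<curlyvee> c)" 
    proof (intro le_supI)
      show "A x \<le> A y \<curlyvee> (B y \<curlyvee> c)"
        using le unfolding x_def[symmetric] y_def[symmetric] by (rule order_trans) (intro sup_mono order_refl sup_ge2)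
    qed (simp add: le_supI1 le_supI2)
    finally obtain r where r: "r > 0" "p (y - x) \<curlywedge> B (y + r *s (y - x)) \<le> B y \<curlyvee> c"
      using h[of y "y - x" "B y \<curlyvee> c"] U by auto
    \<comment> \<open>Chosen so that r ((e - x) - (1 + 1/r) (e - y)) = z - e. Thus the scalar 1 +
      1/r turns the difference to be bounded into \<open>B z\<close>.\<close>
    define z where "z = y + r *s (y - x)"
    have z: "z \<in> U" using U by (simp add: z_def)
    have r': "inverse r > 0" using r by (simp add: ordered_division_ring_pos)
    have "A x \<curlywedge> B z \<le> c"
    proof (rule le_by_prime_filter)
      fix P assume P: "prime_filter P" "A x \<curlywedge> B z \<in> P" "c \<notin> P"
      then have xz: "A x \<in> P" "B z \<in> P" by (auto simp: prime_filterD)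
      then have "A y \<in> P" using prime_filter_mono[OF P(1) _ le] P(3) prime_filterD(2)[OF P(1)] by (simp add: x_def y_def)
      then have By: "B y \<notin> P" using cut_prime(1)[OF cut P(1) U(2)] by blast
      then have "lt P y z" using cut_prime(3)[OF cut P(1) z U(2)] xz by blast
      then have "lt P x y" using lt_scale_zero[OF P(1) r(1), of "y - x"] U by (simp add: lt_def z_def)
      then have "p (y - x) \<curlywedge> B z \<in> P" using xz prime_filterD(3)[OF P(1)] by (simp add: lt_def)
      then show False using prime_filter_mono[OF P(1) _ r(2)] By P(3) prime_filterD(2)[OF P(1)] by (simp add: z_def)
    qed
    moreover have "adjoin A B (u - (1 + inverse r) *s v) (1 - (1 + inverse r) * 1) = B z"
    proof -
      have "r *s (u - (1 + inverse r) *s v) = z"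
        using r by (simp add: z_def x_def y_def scale_right_diff scale_left_add scale_right_add scale_one algebra_simps)
      then show ?thesis using r r' by (simp add: scale_minus_left)
    qed
    moreover have "1 + inverse r > 0" using r' one by (simp add: add_pos_pos)
    ultimately show "\<exists>q>0. A (- u) \<curlywedge> adjoin A B (u - q *s v) (1 - q * 1) \<le> c"
      by (intro exI[of _ "1 + inverse r"]) (simp add: x_def)
  qed
  show "archimedean_pair A B u 1 v (- 1)"
    unfolding archimedean_pair_def a1
  proof (intro allI impI)
    fix c assume le: "A (- u) \<le> B v \<curlyvee> c"
    define x where "x = - u"
    have x: "x \<in> U" using u by (simp add: x_def)
    have "p (v - x) \<le> A x \<curlyvee> B v" using cut x v unfolding cut_def by blast
    also have "\<dots> \<le> B v \<curlyvee> c" using le unfolding x_def[symmetric] by simp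
    finally obtain r where r: "r > 0" "p (v - x) \<curlywedge> A (v - r *s (v - x)) \<le> c"
      using h[of v "v - x" c] x v by auto
    define z where "z = v - r *s (v - x)"
    \<comment> \<open>With q = 1/r, the vector (e - x) - q (v - e) equals (1 + q) (e - w) for the
      point \<open>w\<close> below. Since (1 + q)^-1 < r, \<open>w\<close> lies above
      \<open>z\<close> where x < v, so the bound at \<open>z\<close> carries over.\<close>
    define q where "q = inverse r"
    have q: "q > 0" "1 + q > 0" "q < 1 + q" using r one by (simp_all add: q_def ordered_division_ring_pos add_pos_pos)
    have qr: "inverse (1 + q) < r" using inverse_less_inverse[OF q(1,3)] r by (simp add: q_def)
    define w where "w = v - inverse (1 + q) *s (v - x)"
    have U: "z \<in> U" "w \<in> U" using x v by (simp_all add: z_def w_def)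
    have "A x \<curlywedge> A w \<le> c"
    proof (rule le_by_prime_filter)
      fix P assume P: "prime_filter P" "A x \<curlywedge> A w \<in> P" "c \<notin> P"
      then have xw: "A x \<in> P" "A w \<in> P" by (auto simp: prime_filterD)
      then have "B v \<in> P" using prime_filter_mono[OF P(1) _ le] P(3) prime_filterD(2)[OF P(1)] by (simp add: x_def)
      then have "A v \<notin> P" using cut_prime(1)[OF cut P(1) v] by blast
      then have "lt P w v" using cut_prime(2)[OF cut P(1) U(2) v] xw by blast
      then have xv: "lt P 0 (v - x)"
        using lt_scale_zero[OF P(1), of "inverse (1 + q)" "v - x"] x v q ordered_division_ring_pos(3)[of "1 + q"] by (simp add: lt_def w_def)
      have "w - z = (r - inverse (1 + q)) *s (v - x)" by (simp add: w_def z_def scale_left_diff)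
      then have "lt P z w" using lt_scale_zero[OF P(1), of "r - inverse (1 + q)" "v - x"] x v xv qr by (simp add: lt_def)
      then have "\<not> lt P w z" using lt_asym[OF P(1)] U by blast
      then have "A z \<in> P" using cut_prime(2)[OF cut P(1) U(2,1)] xw by blast
      then have "p (v - x) \<curlywedge> A z \<in> P" using xv prime_filterD(3)[OF P(1)] by (simp add: lt_def)
      then show False using prime_filter_mono[OF P(1) _ r(2)] P(3) by (simp add: z_def)
    qed
    moreover have "adjoin A B (u - q *s v) (1 - q * (- 1)) = A w"
    proof -
      have "(1 + q) *s w = (1 + q) *s v - (1 + q) *s (inverse (1 + q) *s (v - x))"
        unfolding w_def by (rule scale_right_diff)
      also have "\<dots> = (1 + q) *s v - (v - x)" using q by simp
      also have "\<dots> = - (u - q *s v)" by (simp add: x_def scale_left_add scale_one)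
      finally have "(1 + q) *s w = - (u - q *s v)" .
      moreover have "inverse (1 + q) *s ((1 + q) *s w) = w" using q by simp
      ultimately have "w = - (inverse (1 + q) *s (u - q *s v))" by (simp only: scale_minus_right)
      then show ?thesis using q by simp
    qed
    ultimately show "\<exists>q>0. A (- u) \<curlywedge> adjoin A B (u - q *s v) (1 - q * - 1) \<le> c"
      using q by (intro exI[of _ q]) (simp add: x_def)
  qed
qed

text \<open>Positive factors reduce both coefficients of \<open>e\<close> to 0, 1 or -1, and passing
  to - e makes the first nonzero one positive. If both vanish, the claim is archimedeanity of
  \<open>U\<close>.\<close>

theorem adjoin_archimedean:
  assumes cut: "cut U A B" and arch: "archimedean_cut A B" and u: "u \<in> U" and v: "v \<in> U"
  shows "archimedean_pair A B u r v s"
proof -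
  have nonneg: "archimedean_pair A B u r v s"
    if cut: "cut U A B" and arch: "archimedean_cut A B" and r: "0 \<le> r" and s: "r = 0 \<Longrightarrow> 0 \<le> s" for A B r s
  proof -
    define sg where "sg t = (if t = 0 then 0 else if 0 < t then 1 else - 1 :: 'k)" for t :: 'k
    \<comment> \<open>The factor belonging to 0 is 1, so that it is positive in every case.\<close>
    define ab where "ab t = (if t = 0 then 1 else if 0 < t then t else - t)" for t :: 'k
    have ab: "ab t * sg t = t" "0 < ab t" for t
      using ordered_division_ring_pos(1)[where 'k='k] by (auto simp: ab_def sg_def)
    define u' where "u' = inverse (ab r) *s u"
    define v' where "v' = inverse (ab s) *s v"
    have uv: "u' \<in> U" "v' \<in> U" using u v by (simp_all add: u'_def v'_def)
    have "ab r *s u' = u" "ab s *s v' = v"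
      using ab(2)[of r] ab(2)[of s] by (simp_all add: u'_def v'_def)
    moreover have "archimedean_pair A B u' (sg r) v' (sg s)"
    proof (cases "r = 0 \<and> s = 0")
      case True
      then show ?thesis using archimedean uv unfolding archimedean_pair_def archimedean_def sg_def by simp
    next
      case False
      then show ?thesis using archimedean_pair_normalized[OF cut arch uv] r s unfolding sg_def by auto
    qed
    ultimately show ?thesis
      using archimedean_pair_scale[OF _ uv ab(2) ab(2), of A B "sg r" "sg s" r s] ab(1) by simp
  qed
  show ?thesis
  proof (cases "0 \<le> r \<and> (r = 0 \<longrightarrow> 0 \<le> s)")
    case True
    then show ?thesis using nonneg[OF cut arch] by blast
  next
    case False
    then show ?thesis
      using nonneg[OF cut_UNIV_uminus[OF cut] archimedean_cut_uminus[OF arch], of "- r" "- s"]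
      by (auto simp: archimedean_pair_uminus)
  qed
qed

end

section \<open>Transfinite construction of a surjective valuation\<close>

definition archimedean_valuation ::
    "('k::{division_ring, linordered_ring} \<Rightarrow> 'v::ab_group_add \<Rightarrow> 'v) \<Rightarrow> 'v set \<Rightarrow>
      ('v \<Rightarrow> 'l::{distrib_lattice, bounded_lattice_bot}) \<Rightarrow> bool" where
  "archimedean_valuation scale U p \<longleftrightarrow>
     kspace.subspace scale U \<and> kspace.valuation scale U p \<and> kspace.archimedean scale U p"

context kspace
begin

lemma archimedean_valuation_cong:
  assumes "archimedean_valuation scale U p" "\<And>u. u \<in> U \<Longrightarrow> p' u = p u"
  shows "archimedean_valuation scale U p'"
proof -
  have U: "subspace U" using assms(1) by (simp add: archimedean_valuation_def)
  note [simp] = subspaceD[OF U] assms(2)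
  show ?thesis using assms(1) unfolding archimedean_valuation_def valuation_def archimedean_def by simp
qed

text \<open>Each condition involves at most two vectors and is therefore inherited by directed
  unions. This takes care of limit steps.\<close>

lemma archimedean_valuation_directed:
  assumes "subspace U" and "\<And>u v. u \<in> U \<Longrightarrow> v \<in> U \<Longrightarrow> \<exists>W. u \<in> W \<and> v \<in> W \<and> archimedean_valuation scale W p"
  shows "archimedean_valuation scale U p"
  unfolding archimedean_valuation_def valuation_def archimedean_def
proof (intro conjI allI ballI impI)
  show "subspace U" by fact
  obtain W where "archimedean_valuation scale W p" using assms(2) subspaceD(1)[OF assms(1)] by blast
  then show "p 0 = bot" by (simp add: archimedean_valuation_def valuation_def)
  fix u assume u: "u \<in> U"
  obtain W where W: "u \<in> W" "archimedean_valuation scale W p" using assms(2) u by blast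
  then show "0 < c \<Longrightarrow> p (c *s u) = p u" "p u \<curlywedge> p (- u) = bot" for c
    by (auto simp: archimedean_valuation_def valuation_def)
  fix v assume v: "v \<in> U"
  obtain W' where W': "u \<in> W'" "v \<in> W'" "archimedean_valuation scale W' p" using assms(2) u v by blast
  then show "p (u + v) \<le> p u \<curlyvee> p v" by (simp add: archimedean_valuation_def valuation_def)
  show "\<exists>r>0. p u \<curlywedge> p (u - r *s v) \<le> c" if "p u \<le> p v \<curlyvee> c" for c
    using W' that unfolding archimedean_valuation_def archimedean_def by blast
qed

end

abbreviation "lookup \<equiv> Poly_Mapping.lookup"
abbreviation "keys \<equiv> Poly_Mapping.keys"

definition pscale :: "'k::{division_ring, linordered_ring} \<Rightarrow> ('i \<Rightarrow>\<^sub>0 'k) \<Rightarrow> 'i \<Rightarrow>\<^sub>0 'k" where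
  "pscale r v = Poly_Mapping.map ((*) r) v"

lemma lookup_pscale [simp]: "lookup (pscale r v) i = r * lookup v i"
  by (simp add: pscale_def Poly_Mapping.map.rep_eq when_def)

interpretation pm: kspace pscale
  by unfold_locales (auto intro!: poly_mapping_eqI simp: lookup_add algebra_simps)

text \<open>Well-orders of type at most omega_1. With countable scalars, the span of the basis
  vectors below an index is then countable.\<close>

locale countable_segments =
  fixes less :: "'i \<Rightarrow> 'i \<Rightarrow> bool" (infix "\<prec>" 50)
  assumes wf: "wf {(i, j). i \<prec> j}" and trans: "i \<prec> j \<Longrightarrow> j \<prec> k \<Longrightarrow> i \<prec> k"
    and total: "i \<noteq> j \<Longrightarrow> i \<prec> j \<or> j \<prec> i" and countable: "countable {i. i \<prec> j}"
begin

lemma irrefl: "\<not> i \<prec> i"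
  using wf wf_not_refl[OF wf, of i] by simp

lemma maximum:
  assumes "finite K" "K \<noteq> {}"
  shows "\<exists>i\<in>K. \<forall>j\<in>K. j = i \<or> j \<prec> i"
  using assms
proof (induction rule: finite_ne_induct)
  case (insert j K)
  then obtain i where i: "i \<in> K" "\<forall>j\<in>K. j = i \<or> j \<prec> i" by blast
  show ?case
  proof (cases "i \<prec> j")
    case True
    then have "\<forall>x\<in>K. x \<prec> j" using i trans[of _ i j] by auto
    then show ?thesis by blast
  next
    case False
    then have "j = i \<or> j \<prec> i" using total by blast
    then show ?thesis using i by blast
  qed
qed auto

text \<open>The spans before and, in \<open>weakly_below\<close>, after the basis vector with index
  \<open>a\<close> is adjoined.\<close>

definition strictly_below :: "'i \<Rightarrow> ('i \<Rightarrow>\<^sub>0 'k::{division_ring, linordered_ring}) set" where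
  "strictly_below a = {v. \<forall>i. lookup v i \<noteq> 0 \<longrightarrow> i \<prec> a}"

definition weakly_below :: "'i \<Rightarrow> ('i \<Rightarrow>\<^sub>0 'k::{division_ring, linordered_ring}) set" where
  "weakly_below a = {v. \<forall>i. lookup v i \<noteq> 0 \<longrightarrow> i = a \<or> i \<prec> a}"

lemma weakly_below_keys: "v \<in> weakly_below a \<longleftrightarrow> (\<forall>i\<in>keys v. i = a \<or> i \<prec> a)"
  by (auto simp: weakly_below_def in_keys_iff)

lemma subspace_below:
  fixes a :: 'i
  shows "pm.subspace (strictly_below a :: ('i \<Rightarrow>\<^sub>0 'k::{division_ring, linordered_ring}) set)"
    "pm.subspace (weakly_below a :: ('i \<Rightarrow>\<^sub>0 'k) set)"
proof -
  have "strictly_below a = {v :: 'i \<Rightarrow>\<^sub>0 'k. \<forall>i. \<not> i \<prec> a \<longrightarrow> lookup v i = 0}"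
    "weakly_below a = {v :: 'i \<Rightarrow>\<^sub>0 'k. \<forall>i. \<not> (i = a \<or> i \<prec> a) \<longrightarrow> lookup v i = 0}"
    by (auto simp: strictly_below_def weakly_below_def)
  then show "pm.subspace (strictly_below a :: ('i \<Rightarrow>\<^sub>0 'k) set)" "pm.subspace (weakly_below a :: ('i \<Rightarrow>\<^sub>0 'k) set)"
    unfolding pm.subspace_def by (simp_all add: lookup_add)
qed

lemma countable_strictly_below:
  assumes "countable (UNIV :: 'k::{division_ring, linordered_ring} set)"
  shows "countable (strictly_below a :: ('i \<Rightarrow>\<^sub>0 'k) set)"
proof -
  define graph where "graph v = (\<lambda>i. (i, lookup v i)) ` keys v" for v :: "'i \<Rightarrow>\<^sub>0 'k"
  have "inj graph"
  proof (rule injI, rule poly_mapping_eqI)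
    fix u v i assume eq: "graph u = graph v"
    have iff: "(i, c) \<in> graph w \<longleftrightarrow> c \<noteq> 0 \<and> lookup w i = c" for w c
      by (auto simp: graph_def in_keys_iff)
    show "lookup u i = lookup v i" using iff[of _ u] iff[of _ v] eq by metis
  qed
  moreover have "graph ` strictly_below a \<subseteq> {X. finite X \<and> X \<subseteq> {i. i \<prec> a} \<times> UNIV}"
    by (auto simp: graph_def strictly_below_def in_keys_iff)
  then have "countable (graph ` (strictly_below a :: ('i \<Rightarrow>\<^sub>0 'k) set))"
    by (rule countable_subset) (intro countable_Collect_finite_subset countable_SIGMA countable assms)
  ultimately show ?thesis by (metis countable_image_inj_on inj_on_subset subset_UNIV)
qed

text \<open>
  The pair \<open>f i\<close> is the cut of the basis vector with index \<open>i\<close> over the span of the previous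
  ones; a vector is evaluated at the cut of its largest index.
\<close>

definition top_index :: "('i \<Rightarrow>\<^sub>0 'k::{division_ring, linordered_ring}) \<Rightarrow> 'i" where
  "top_index v = (SOME i. lookup v i \<noteq> 0 \<and> v \<in> weakly_below i)"

definition cut_value ::
    "('i \<Rightarrow> (('i \<Rightarrow>\<^sub>0 'k) \<Rightarrow> 'l) \<times> (('i \<Rightarrow>\<^sub>0 'k) \<Rightarrow> 'l)) \<Rightarrow> ('i \<Rightarrow>\<^sub>0 'k::{division_ring, linordered_ring}) \<Rightarrow>
      'l::{distrib_lattice, bounded_lattice_bot}" where
  "cut_value f v = (if v = 0 then bot else
     let i = top_index v; r = lookup v i; u = - pscale (inverse r) (v - Poly_Mapping.single i r)
     in if 0 < r then fst (f i) u else snd (f i) u)"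

text \<open>Truncated so that, as a function on the whole space, it depends only on the cuts with
  index below \<open>a\<close>; recursion on the well-order requires this of the condition on the
  cut at \<open>a\<close>.\<close>

definition restricted_value ::
    "('i \<Rightarrow> (('i \<Rightarrow>\<^sub>0 'k) \<Rightarrow> 'l) \<times> (('i \<Rightarrow>\<^sub>0 'k) \<Rightarrow> 'l)) \<Rightarrow> 'i \<Rightarrow> ('i \<Rightarrow>\<^sub>0 'k::{division_ring, linordered_ring}) \<Rightarrow>
      'l::{distrib_lattice, bounded_lattice_bot}" where
  "restricted_value f a v = (if v \<in> strictly_below a then cut_value f v else bot)"

lemma top_index:
  assumes "v \<noteq> 0"
  shows "lookup v (top_index v) \<noteq> 0" "v \<in> weakly_below (top_index v)"
proof -
  have "keys v \<noteq> {}" using assms by simp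
  then have "\<exists>i. lookup v i \<noteq> 0 \<and> v \<in> weakly_below i"
    using maximum[of "keys v"] unfolding weakly_below_keys in_keys_iff[symmetric] by auto
  from someI_ex[OF this] show "lookup v (top_index v) \<noteq> 0" "v \<in> weakly_below (top_index v)"
    unfolding top_index_def by auto
qed

lemma top_index_eq:
  assumes "lookup v a \<noteq> 0" "v \<in> weakly_below a" shows "top_index v = a"
proof -
  have "v \<noteq> 0" using assms(1) by auto
  then show ?thesis using top_index[of v] assms irrefl trans unfolding weakly_below_def by blast
qed

lemma restricted_value_cong:
  assumes "\<And>b. b \<prec> a \<Longrightarrow> f b = g b" shows "restricted_value f a = restricted_value g a"
proof
  fix v
  show "restricted_value f a v = restricted_value g a v"
  proof (cases "v \<in> strictly_below a \<and> v \<noteq> 0")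
    case True
    then have "top_index v \<prec> a" using top_index(1)[of v] unfolding strictly_below_def by blast
    then show ?thesis using assms True by (simp add: restricted_value_def cut_value_def Let_def)
  qed (auto simp: restricted_value_def cut_value_def)
qed

definition residue :: "'i \<Rightarrow> ('i \<Rightarrow>\<^sub>0 'k::{division_ring, linordered_ring}) \<Rightarrow> 'i \<Rightarrow>\<^sub>0 'k" where
  "residue a v = v - Poly_Mapping.single a (lookup v a)"

lemma residue_simps:
  "residue a 0 = 0" "residue a (u + v) = residue a u + residue a v" "residue a (u - v) = residue a u - residue a v"
  "residue a (- v) = - residue a v" "residue a (pscale r v) = pscale r (residue a v)"
  by (rule poly_mapping_eqI; simp add: residue_def lookup_add lookup_minus lookup_single when_def algebra_simps)+

lemma residue_below: "v \<in> weakly_below a \<Longrightarrow> residue a v \<in> strictly_below a"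
  by (auto simp: residue_def weakly_below_def strictly_below_def lookup_minus lookup_single when_def split: if_splits)

lemma cut_value_adjoin:
  assumes vs: "valued_space pscale (strictly_below a) (restricted_value f a)" and v: "v \<in> weakly_below a"
  shows "cut_value f v = valued_space.adjoin pscale (restricted_value f a) (fst (f a)) (snd (f a)) (residue a v) (lookup v a)"
proof -
  interpret valued_space pscale "strictly_below a" "restricted_value f a" by fact
  show ?thesis
  proof (cases "lookup v a = 0")
    case True
    then have "residue a v = v" "v \<in> strictly_below a" using residue_below[OF v] by (simp_all add: residue_def)
    then show ?thesis using True by (simp add: restricted_value_def)
  next
    case False
    then have "top_index v = a" "v \<noteq> 0" using top_index_eq[OF _ v] by auto
    then show ?thesis using False by (simp add: cut_value_def adjoin_def residue_def Let_def)
  qed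
qed

text \<open>The successor step: every vector is its residue plus a multiple of the new basis vector,
  and on these coordinates \<open>cut_value\<close> is \<open>adjoin\<close>.\<close>

lemma archimedean_valuation_weakly_below:
  fixes f :: "'i \<Rightarrow> (('i \<Rightarrow>\<^sub>0 'k::{division_ring, linordered_ring}) \<Rightarrow> 'l::{distrib_lattice, bounded_lattice_bot}) \<times> (('i \<Rightarrow>\<^sub>0 'k) \<Rightarrow> 'l)"
  assumes arch: "archimedean_space pscale (strictly_below a) (restricted_value f a)"
    and cut: "valued_space.cut (restricted_value f a) (strictly_below a) (fst (f a)) (snd (f a))"
    and acut: "valued_space.archimedean_cut pscale (strictly_below a) (restricted_value f a) (fst (f a)) (snd (f a))"
  shows "archimedean_valuation pscale (weakly_below a) (cut_value f)"
proof -
  interpret archimedean_space pscale "strictly_below a" "restricted_value f a" by fact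
  have eq: "cut_value f v = adjoin (fst (f a)) (snd (f a)) (residue a v) (lookup v a)" if "v \<in> weakly_below a" for v
    using cut_value_adjoin[OF valued_space_axioms that] .
  have "pm.subspace (weakly_below a :: ('i \<Rightarrow>\<^sub>0 'k) set)" by (rule subspace_below)
  note W = pm.subspaceD[OF this]
  have "pm.valuation (weakly_below a) (cut_value f)"
    unfolding pm.valuation_def
  proof (intro conjI allI ballI impI)
    show "cut_value f 0 = bot" by (simp add: cut_value_def)
    fix u :: "'i \<Rightarrow>\<^sub>0 'k" assume u: "u \<in> weakly_below a"
    note u' = residue_below[OF u]
    show "cut_value f (pscale c u) = cut_value f u" if "0 < c" for c :: 'k
      using adjoin_scale[OF that, of "fst (f a)" "snd (f a)" "residue a u" "lookup u a"] u u' that W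
      by (simp add: eq residue_simps p_scale)
    show "cut_value f u \<curlywedge> cut_value f (- u) = bot"
      using adjoin_disjoint[OF cut u'] u W by (simp add: eq residue_simps)
    fix v :: "'i \<Rightarrow>\<^sub>0 'k" assume v: "v \<in> weakly_below a"
    show "cut_value f (u + v) \<le> cut_value f u \<curlyvee> cut_value f v"
      using adjoin_add[OF cut u' residue_below[OF v]] u v W by (simp add: eq residue_simps lookup_add)
  qed
  moreover have "pm.archimedean (weakly_below a) (cut_value f)"
    unfolding pm.archimedean_def
  proof (intro ballI allI impI)
    fix u v :: "'i \<Rightarrow>\<^sub>0 'k" and c assume uv: "u \<in> weakly_below a" "v \<in> weakly_below a" and le: "cut_value f u \<le> cut_value f v \<curlyvee> c"
    have "archimedean_pair (fst (f a)) (snd (f a)) (residue a u) (lookup u a) (residue a v) (lookup v a)"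
      by (rule adjoin_archimedean[OF cut acut residue_below residue_below]) (use uv in auto)
    then show "\<exists>r>0. cut_value f u \<curlywedge> cut_value f (u - pscale r v) \<le> c"
      using le uv W unfolding archimedean_pair_def by (simp add: eq residue_simps lookup_minus)
  qed
  ultimately show ?thesis using subspace_below by (simp add: archimedean_valuation_def)
qed

text \<open>The recursion needs a choice for every history \<open>f\<close>, good or bad. Hence
  \<open>Q\<close> demands the cut conditions only if the earlier values form an archimedean space;
  that they always do is a separate induction. The basis vector with index \<open>i\<close> has
  residue 0, and its value \<open>A 0\<close> is prescribed.\<close>

theorem surjective_valuation:
  fixes g :: "'i \<Rightarrow> 'l::{distrib_lattice, bounded_lattice_bot}"
  assumes k: "countable (UNIV :: 'k::{division_ring, linordered_ring} set)"
    and cn: "completely_normal TYPE('l)" and cbd: "countably_based_differences TYPE('l)"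
  obtains p :: "('i \<Rightarrow>\<^sub>0 'k::{division_ring, linordered_ring}) \<Rightarrow> 'l::{distrib_lattice, bounded_lattice_bot}"
    where "archimedean_valuation pscale UNIV p" "\<And>i. p (Poly_Mapping.single i 1) = g i"
proof -
  define Q where "Q f a r \<longleftrightarrow> (archimedean_space pscale (strictly_below a) (restricted_value f a) \<longrightarrow>
    valued_space.cut (restricted_value f a) (strictly_below a) (fst r) (snd r) \<and>
    valued_space.archimedean_cut pscale (strictly_below a) (restricted_value f a) (fst r) (snd r)) \<and>
    fst r 0 = g a"
    for f :: "'i \<Rightarrow> (('i \<Rightarrow>\<^sub>0 'k) \<Rightarrow> 'l) \<times> (('i \<Rightarrow>\<^sub>0 'k) \<Rightarrow> 'l)" and a r
  have "\<exists>f. \<forall>a. Q f a (f a)"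
  proof (rule dependent_wf_choice[OF wf])
    show "Q f a r = Q f' a r" if "\<And>b. (b, a) \<in> {(i, j). i \<prec> j} \<Longrightarrow> f b = f' b" for f f' a r
      using restricted_value_cong[of a f f'] that by (simp add: Q_def)
    show "\<exists>r. Q f a r" for a f
    proof (cases "archimedean_space pscale (strictly_below a) (restricted_value f a)")
      case True
      then interpret archimedean_space pscale "strictly_below a" "restricted_value f a" .
      obtain A B where "cut (strictly_below a) A B" "archimedean_cut A B" "A 0 = g a"
        using archimedean_cut_exists[OF cbd countable_strictly_below[OF k]] by metis
      then show ?thesis by (intro exI[of _ "(A, B)"]) (simp add: Q_def)
    next
      case False
      \<comment> \<open>A dummy for bad histories, for which only the value at 0 is
        demanded.\<close>
      then show ?thesis by (intro exI[of _ "(\<lambda>_. g a, \<lambda>_. g a)"]) (simp add: Q_def)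
    qed
  qed
  then obtain f where f: "\<And>a. Q f a (f a)" by blast
  have space: "archimedean_space pscale (strictly_below a) (restricted_value f a)"
    if "archimedean_valuation pscale (strictly_below a) (cut_value f)" for a
  proof -
    have "archimedean_valuation pscale (strictly_below a) (restricted_value f a)"
      using that by (rule pm.archimedean_valuation_cong) (simp add: restricted_value_def)
    then show ?thesis using cn by unfold_locales (auto simp: archimedean_valuation_def)
  qed
  have weak: "archimedean_valuation pscale (weakly_below a) (cut_value f)"
    if "archimedean_valuation pscale (strictly_below a) (cut_value f)" for a
    using archimedean_valuation_weakly_below[OF space[OF that]] f[of a] space[OF that] by (simp add: Q_def)
  \<comment> \<open>The zero vector has no largest index, so the pair u = v = 0 lies in none of the
    spans found through one.\<close>
  have zero: "archimedean_valuation pscale {0} (cut_value f)"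
    using ordered_division_ring_pos(1)[where 'k='k]
    by (auto simp: archimedean_valuation_def pm.subspace_def pm.valuation_def pm.archimedean_def cut_value_def)
  have bound: "\<exists>b\<in>keys u \<union> keys v. u \<in> weakly_below b \<and> v \<in> weakly_below b" if "\<not> (u = 0 \<and> v = 0)" for u v :: "'i \<Rightarrow>\<^sub>0 'k"
    using maximum[of "keys u \<union> keys v"] that unfolding weakly_below_keys by fastforce
  have strict: "archimedean_valuation pscale (strictly_below a) (cut_value f)" for a
    using wf
  proof (induction a rule: wf_induct_rule)
    case (less a)
    show ?case
    proof (rule pm.archimedean_valuation_directed[OF subspace_below(1)])
      fix u v :: "'i \<Rightarrow>\<^sub>0 'k" assume uv: "u \<in> strictly_below a" "v \<in> strictly_below a"
      show "\<exists>W. u \<in> W \<and> v \<in> W \<and> archimedean_valuation pscale W (cut_value f)"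
      proof (cases "u = 0 \<and> v = 0")
        case True
        then show ?thesis using zero by blast
      next
        case False
        then obtain b where b: "b \<in> keys u \<union> keys v" "u \<in> weakly_below b" "v \<in> weakly_below b" using bound by blast
        then have "b \<prec> a" using uv by (auto simp: strictly_below_def in_keys_iff)
        then show ?thesis using less weak b by blast
      qed
    qed
  qed
  have "archimedean_valuation pscale UNIV (cut_value f)"
  proof (rule pm.archimedean_valuation_directed)
    fix u v :: "'i \<Rightarrow>\<^sub>0 'k"
    show "\<exists>W. u \<in> W \<and> v \<in> W \<and> archimedean_valuation pscale W (cut_value f)"
      using zero bound[of u v] weak[OF strict] by (cases "u = 0 \<and> v = 0") auto
  qed (simp add: pm.subspace_def)
  moreover have "cut_value f (Poly_Mapping.single i 1) = g i" for i
  proof -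
    have "top_index (Poly_Mapping.single i (1::'k)) = i"
      by (rule top_index_eq) (auto simp: weakly_below_def lookup_single when_def)
    moreover have "Poly_Mapping.single i (1::'k) \<noteq> 0" by (metis lookup_single_eq lookup_zero zero_neq_one)
    ultimately show ?thesis
      using f[of i] ordered_division_ring_pos(1)[where 'k='k] by (simp add: cut_value_def Q_def Let_def)
  qed
  ultimately show thesis by (rule that)
qed

end

section \<open>Lattices of principal ideals\<close>

definition inclusion_order :: "'a set set \<Rightarrow> 'a set gorder" where
  "inclusion_order C = \<lparr>carrier = C, eq = (=), le = (\<subseteq>)\<rparr>"

lemma inclusion_order_simps [simp]:
  "carrier (inclusion_order C) = C" "X .=\<^bsub>inclusion_order C\<^esub> Y \<longleftrightarrow> X = Y" "X \<sqsubseteq>\<^bsub>inclusion_order C\<^esub> Y \<longleftrightarrow> X \<subseteq> Y"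
  by (simp_all add: inclusion_order_def)

lemma inclusion_order_join:
  assumes "X \<in> C" "Y \<in> C" "Z \<in> C" "X \<subseteq> Z" "Y \<subseteq> Z" "\<And>W. W \<in> C \<Longrightarrow> X \<subseteq> W \<Longrightarrow> Y \<subseteq> W \<Longrightarrow> Z \<subseteq> W"
  shows "X \<squnion>\<^bsub>inclusion_order C\<^esub> Y = Z"
proof -
  have U: "Upper (inclusion_order C) {X, Y} = {W \<in> C. X \<subseteq> W \<and> Y \<subseteq> W}"
    using assms(1,2) by (auto simp: Upper_def)
  have Z: "least (inclusion_order C) Z (Upper (inclusion_order C) {X, Y})"
    unfolding U least_def inclusion_order_simps using assms(3-6) by auto
  have "l = Z" if "least (inclusion_order C) l (Upper (inclusion_order C) {X, Y})" for l
    using that Z unfolding U least_def inclusion_order_simps by (simp add: subset_antisym)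
  then have "least (inclusion_order C) l (Upper (inclusion_order C) {X, Y}) \<longleftrightarrow> l = Z" for l
    using Z by blast
  then show ?thesis by (simp add: join_def sup_def)
qed

lemma inclusion_order_meet:
  assumes "X \<in> C" "Y \<in> C" "Z \<in> C" "Z \<subseteq> X" "Z \<subseteq> Y" "\<And>W. W \<in> C \<Longrightarrow> W \<subseteq> X \<Longrightarrow> W \<subseteq> Y \<Longrightarrow> W \<subseteq> Z"
  shows "X \<sqinter>\<^bsub>inclusion_order C\<^esub> Y = Z"
proof -
  have L: "Lower (inclusion_order C) {X, Y} = {W \<in> C. W \<subseteq> X \<and> W \<subseteq> Y}"
    using assms(1,2) by (auto simp: Lower_def)
  have Z: "greatest (inclusion_order C) Z (Lower (inclusion_order C) {X, Y})"
    unfolding L greatest_def inclusion_order_simps using assms(3-6) by auto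
  have "l = Z" if "greatest (inclusion_order C) l (Lower (inclusion_order C) {X, Y})" for l
    using that Z unfolding L greatest_def inclusion_order_simps by (simp add: subset_antisym)
  then have "greatest (inclusion_order C) l (Lower (inclusion_order C) {X, Y}) \<longleftrightarrow> l = Z" for l
    using Z by blast
  then show ?thesis by (simp add: meet_def inf_def)
qed

lemma lattice_iso_inclusion_orderI:
  assumes bij: "bij_betw f UNIV C" and le: "\<And>x y. f x \<subseteq> f y \<longleftrightarrow> x \<le> y"
  shows "lattice_iso f (inclusion_order C)"
proof -
  have C: "f x \<in> C" "W \<in> C \<Longrightarrow> \<exists>z. W = f z" for x W
    using bij by (auto simp: bij_betw_def)
  have "f x \<squnion>\<^bsub>inclusion_order C\<^esub> f y = f (x \<curlyvee> y)" for x y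
  proof (rule inclusion_order_join)
    show "f (x \<curlyvee> y) \<subseteq> W" if "W \<in> C" "f x \<subseteq> W" "f y \<subseteq> W" for W
      using C(2)[OF that(1)] that(2,3) by (elim exE) (simp add: le)
  qed (simp_all add: C(1) le)
  moreover have "f x \<sqinter>\<^bsub>inclusion_order C\<^esub> f y = f (x \<curlywedge> y)" for x y
  proof (rule inclusion_order_meet)
    show "W \<subseteq> f (x \<curlywedge> y)" if "W \<in> C" "W \<subseteq> f x" "W \<subseteq> f y" for W
      using C(2)[OF that(1)] that(2,3) by (elim exE) (simp add: le)
  qed (simp_all add: C(1) le)
  ultimately show ?thesis using bij by (simp add: lattice_iso_def)
qed

text \<open>The join of a carrier is chosen among least upper bounds and is meaningful only if one
  exists. The second hypothesis supplies it, and then the order is recovered from preservation of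
  joins.\<close>

lemma lattice_iso_inclusion_order_le:
  assumes iso: "lattice_iso f (inclusion_order C)"
    and lub: "\<And>X Y. X \<in> C \<Longrightarrow> Y \<in> C \<Longrightarrow> \<exists>Z\<in>C. X \<subseteq> Z \<and> Y \<subseteq> Z \<and> (\<forall>W\<in>C. X \<subseteq> W \<longrightarrow> Y \<subseteq> W \<longrightarrow> Z \<subseteq> W)"
  shows "f x \<subseteq> f y \<longleftrightarrow> x \<le> y"
proof -
  have C: "f x \<in> C" for x using iso by (auto simp: lattice_iso_def bij_betw_def)
  obtain Z where Z: "Z \<in> C" "f x \<subseteq> Z" "f y \<subseteq> Z" "\<forall>W\<in>C. f x \<subseteq> W \<longrightarrow> f y \<subseteq> W \<longrightarrow> Z \<subseteq> W"
    using lub[OF C C] by blast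
  have Zj: "f (x \<curlyvee> y) = Z"
    using inclusion_order_join[OF C C Z(1-3)] Z(4) iso by (simp add: lattice_iso_def)
  have inj: "inj f" using iso by (auto simp: lattice_iso_def bij_betw_def)
  show ?thesis
  proof
    assume "f x \<subseteq> f y"
    then have "Z = f y" using Z C by blast
    then show "x \<le> y" using Zj injD[OF inj] by (metis sup_ge1)
  next
    assume "x \<le> y"
    then show "f x \<subseteq> f y" using Zj Z by (simp add: sup_absorb2)
  qed
qed

section \<open>Elementary facts on Abelian lattice-ordered groups\<close>

context abelian_lgroup
begin

abbreviation lle (infix "\<preceq>" 50) where "x \<preceq> y \<equiv> lgroup_le G x y"

sublocale order: Lattice.lattice "lgroup_order G"
  rewrites "carrier (lgroup_order G) = carrier G" and "le (lgroup_order G) = lgroup_le G"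
    and "eq (lgroup_order G) = (=)"
  using lattice_order by (simp_all add: lgroup_order_def)

abbreviation ljoin (infixl "\<squnion>\<^sub>G" 65) where "x \<squnion>\<^sub>G y \<equiv> x \<squnion>\<^bsub>lgroup_order G\<^esub> y"
abbreviation lmeet (infixl "\<sqinter>\<^sub>G" 70) where "x \<sqinter>\<^sub>G y \<equiv> x \<sqinter>\<^bsub>lgroup_order G\<^esub> y"

lemma lle_add_right: "x \<preceq> y \<Longrightarrow> x \<in> carrier G \<Longrightarrow> y \<in> carrier G \<Longrightarrow> z \<in> carrier G \<Longrightarrow> x \<oplus> z \<preceq> y \<oplus> z"
  using translation_invariant by blast

lemma lle_trans: "x \<preceq> y \<Longrightarrow> y \<preceq> z \<Longrightarrow> x \<in> carrier G \<Longrightarrow> y \<in> carrier G \<Longrightarrow> z \<in> carrier G \<Longrightarrow> x \<preceq> z"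
  by (rule order.le_trans)

lemma lle_antisym: "x \<preceq> y \<Longrightarrow> y \<preceq> x \<Longrightarrow> x \<in> carrier G \<Longrightarrow> y \<in> carrier G \<Longrightarrow> x = y"
  by (rule order.le_antisym)

lemma lle_add_mono:
  assumes "x \<preceq> y" "z \<preceq> w" "x \<in> carrier G" "y \<in> carrier G" "z \<in> carrier G" "w \<in> carrier G"
  shows "x \<oplus> z \<preceq> y \<oplus> w"
proof -
  have "x \<oplus> z \<preceq> y \<oplus> z" "y \<oplus> z \<preceq> y \<oplus> w"
    using lle_add_right[of x y z] lle_add_right[of z w y] assms by (simp_all add: a_comm)
  then show ?thesis using assms lle_trans[of "x \<oplus> z" "y \<oplus> z" "y \<oplus> w"] by simp
qed

lemma add_diff_cancel:
  assumes "x \<in> carrier G" "y \<in> carrier G" shows "y \<oplus> (x \<ominus> y) = x"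
proof -
  have "y \<oplus> (x \<ominus> y) = x \<oplus> (\<ominus> y \<oplus> y)" using assms a_comm[of y] by (simp add: a_minus_def a_assoc)
  then show ?thesis using assms by (simp add: l_neg)
qed

lemma lle_diff_iff:
  assumes "x \<in> carrier G" "y \<in> carrier G" "z \<in> carrier G"
  shows "x \<ominus> y \<preceq> z \<longleftrightarrow> x \<preceq> y \<oplus> z"
proof
  assume "x \<ominus> y \<preceq> z"
  from lle_add_right[OF this, of y] have "x \<oplus> (\<ominus> y \<oplus> y) \<preceq> z \<oplus> y" using assms by (simp add: a_minus_def a_assoc)
  then show "x \<preceq> y \<oplus> z" using assms a_comm[of z y] by (simp add: l_neg)
next
  assume "x \<preceq> y \<oplus> z"
  from lle_add_right[OF this, of "\<ominus> y"] show "x \<ominus> y \<preceq> z"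
    using assms a_comm[of y z] by (simp add: a_minus_def a_assoc r_neg)
qed

lemma positive_coneD: "x \<in> positive_cone G \<Longrightarrow> x \<in> carrier G" "x \<in> positive_cone G \<Longrightarrow> \<zero> \<preceq> x"
  by (auto simp: positive_cone_def)

lemma positive_coneI: "x \<in> carrier G \<Longrightarrow> \<zero> \<preceq> x \<Longrightarrow> x \<in> positive_cone G"
  by (simp add: positive_cone_def)

lemma positive_zero: "\<zero> \<in> positive_cone G"
  using order.le_refl[of \<zero>] by (simp add: positive_cone_def)

lemma positive_add: "x \<in> positive_cone G \<Longrightarrow> y \<in> positive_cone G \<Longrightarrow> x \<oplus> y \<in> positive_cone G"
  using lle_add_mono[of \<zero> x \<zero> y] by (auto simp: positive_cone_def)

lemma lle_add_positive:
  assumes "x \<in> carrier G" "y \<in> positive_cone G" shows "x \<preceq> x \<oplus> y" "x \<preceq> y \<oplus> x"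
  using lle_add_mono[of x x \<zero> y] order.le_refl[of x] assms positive_coneD[of y] by (simp_all add: a_comm)

lemma labs_positive:
  assumes "x \<in> positive_cone G" shows "labs G x = x"
proof -
  note x = positive_coneD[OF assms]
  have "\<ominus> x \<preceq> \<zero>" using lle_add_right[OF x(2), of "\<ominus> x"] x by (simp add: r_neg)
  then have "\<ominus> x \<preceq> x" using lle_trans[of "\<ominus> x" \<zero> x] x by simp
  then have "x \<squnion>\<^sub>G \<ominus> x \<preceq> x" using x by (intro order.join_le) auto
  moreover have "x \<preceq> x \<squnion>\<^sub>G \<ominus> x" using x by (intro order.join_left) auto
  ultimately show ?thesis unfolding labs_def using x by (intro lle_antisym) auto
qed

definition disjoint :: "'a \<Rightarrow> 'a \<Rightarrow> bool" where
  "disjoint x y \<longleftrightarrow> (\<forall>z\<in>positive_cone G. z \<preceq> x \<longrightarrow> z \<preceq> y \<longrightarrow> z = \<zero>)"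

text \<open>Subtract the meet: a positive \<open>z\<close> below both remainders makes
  \<open>m + z\<close> a common lower bound of \<open>a\<close> and \<open>b\<close>, so z \<le> 0.
  The remainders will witness complete normality.\<close>

lemma disjoint_decomposition:
  assumes a: "a \<in> positive_cone G" and b: "b \<in> positive_cone G"
  obtains m a' b' where "m \<in> positive_cone G" "a' \<in> positive_cone G" "b' \<in> positive_cone G"
    "a = m \<oplus> a'" "b = m \<oplus> b'" "disjoint a' b'"
proof -
  note car = a[THEN positive_coneD(1)] b[THEN positive_coneD(1)]
  define m where "m = a \<sqinter>\<^sub>G b"
  have m: "m \<in> carrier G" "m \<preceq> a" "m \<preceq> b" "\<zero> \<preceq> m"
    using car a b positive_coneD(2) by (auto simp: m_def intro: order.meet_left order.meet_right order.meet_le)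
  have car': "a \<ominus> m \<in> carrier G" "b \<ominus> m \<in> carrier G" using car m by simp_all
  have sums: "m \<oplus> (a \<ominus> m) = a" "m \<oplus> (b \<ominus> m) = b" using car m by (simp_all add: add_diff_cancel)
  have "a \<ominus> m \<in> positive_cone G" "b \<ominus> m \<in> positive_cone G"
    using lle_add_right[OF m(2), of "\<ominus> m"] lle_add_right[OF m(3), of "\<ominus> m"] m car car'
    by (auto intro!: positive_coneI simp: a_minus_def r_neg)
  moreover have "disjoint (a \<ominus> m) (b \<ominus> m)"
    unfolding disjoint_def
  proof (intro ballI impI)
    fix z assume z: "z \<in> positive_cone G" "z \<preceq> a \<ominus> m" "z \<preceq> b \<ominus> m"
    note zc = positive_coneD[OF z(1)]
    have "m \<oplus> z \<preceq> a" "m \<oplus> z \<preceq> b"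
      using lle_add_mono[OF order.le_refl[OF m(1)] z(2)] lle_add_mono[OF order.le_refl[OF m(1)] z(3)] m zc car' sums by auto
    then have "z \<oplus> m \<preceq> \<zero> \<oplus> m" using order.meet_le[of "m \<oplus> z" a b] car m zc a_comm[of z m] by (simp add: m_def)
    then have "z \<preceq> \<zero>" using lle_add_right[of "z \<oplus> m" "\<zero> \<oplus> m" "\<ominus> m"] m zc by (simp add: a_assoc r_neg)
    then show "z = \<zero>" using zc by (intro lle_antisym) auto
  qed
  ultimately show thesis using that[of m "a \<ominus> m" "b \<ominus> m"] m sums by (simp add: positive_coneI)
qed

lemma disjoint_commute: "disjoint x y \<longleftrightarrow> disjoint y x"
  by (auto simp: disjoint_def)

end

text \<open>
  Multipliers abstract from multiplication by natural numbers and by positive scalars, so that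
  both kinds of principal ideals are treated at once.
\<close>

locale multipliers = abelian_lgroup +
  fixes mul :: "'i \<Rightarrow> 'a \<Rightarrow> 'a"
  assumes countable_multipliers: "countable (UNIV :: 'i set)"
    and mul_positive: "x \<in> positive_cone G \<Longrightarrow> mul i x \<in> positive_cone G"
    and mul_mono: "x \<preceq> y \<Longrightarrow> x \<in> positive_cone G \<Longrightarrow> y \<in> positive_cone G \<Longrightarrow> mul i x \<preceq> mul i y"
    and mul_add: "x \<in> positive_cone G \<Longrightarrow> y \<in> positive_cone G \<Longrightarrow> mul i (x \<oplus> y) = mul i x \<oplus> mul i y"
    and mul_one: "\<exists>i. \<forall>x\<in>positive_cone G. x \<preceq> mul i x"
    and mul_mul: "\<exists>k. \<forall>x\<in>positive_cone G. mul i (mul j x) \<preceq> mul k x"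
    and mul_plus: "\<exists>k. \<forall>x\<in>positive_cone G. mul i x \<oplus> mul j x \<preceq> mul k x"
    and mul_disjoint: "disjoint x y \<Longrightarrow> x \<in> positive_cone G \<Longrightarrow> y \<in> positive_cone G \<Longrightarrow> disjoint (mul i x) (mul j y)"
begin

definition ideal :: "'a \<Rightarrow> 'a set" where
  "ideal a = {x \<in> carrier G. \<exists>i. labs G x \<preceq> mul i (labs G a)}"

lemma ideal_subset_iff:
  assumes a: "a \<in> positive_cone G" and b: "b \<in> positive_cone G"
  shows "ideal a \<subseteq> ideal b \<longleftrightarrow> (\<exists>i. a \<preceq> mul i b)"
proof
  assume sub: "ideal a \<subseteq> ideal b"
  have "a \<in> ideal a" using mul_one a by (auto simp: ideal_def labs_positive positive_coneD)
  then have "a \<in> ideal b" using sub by blast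
  then show "\<exists>i. a \<preceq> mul i b" by (simp add: ideal_def labs_positive[OF a] labs_positive[OF b])
next
  assume "\<exists>i. a \<preceq> mul i b"
  then obtain i where i: "a \<preceq> mul i b" by blast
  show "ideal a \<subseteq> ideal b"
  proof
    fix x assume "x \<in> ideal a"
    then obtain j where x: "x \<in> carrier G" and j: "labs G x \<preceq> mul j a" by (auto simp: ideal_def labs_positive[OF a])
    obtain k where k: "mul j (mul i b) \<preceq> mul k b" using mul_mul[of j i] b by blast
    have c: "labs G x \<in> carrier G" using x by (simp add: labs_def)
    note pos = a b mul_positive[OF a] mul_positive[OF b] mul_positive[OF mul_positive[OF b]]
    note car = pos[THEN positive_coneD(1)]
    have "mul j a \<preceq> mul j (mul i b)" using mul_mono[OF i] pos by blast
    then have "labs G x \<preceq> mul k b"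
      using j k c car lle_trans[of "labs G x" "mul j a" "mul j (mul i b)"] lle_trans[of "labs G x" "mul j (mul i b)" "mul k b"]
      by blast
    then show "x \<in> ideal b" using x by (auto simp: ideal_def labs_positive[OF b])
  qed
qed

text \<open>Sums play the part of joins: for positive elements a + b and a \<or> b generate the same
  ideal, and sums are compatible with multipliers.\<close>

lemma ideal_add:
  assumes a: "a \<in> positive_cone G" and b: "b \<in> positive_cone G" and c: "c \<in> positive_cone G"
  shows "ideal (a \<oplus> b) \<subseteq> ideal c \<longleftrightarrow> ideal a \<subseteq> ideal c \<and> ideal b \<subseteq> ideal c"
proof -
  have ab: "a \<oplus> b \<in> positive_cone G" using positive_add[OF a b] .
  note car = a[THEN positive_coneD(1)] b[THEN positive_coneD(1)] mul_positive[OF c, THEN positive_coneD(1)] ab[THEN positive_coneD(1)]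
  have le: "a \<preceq> a \<oplus> b" "b \<preceq> a \<oplus> b" using lle_add_positive a b car by auto
  have "(\<exists>i. a \<oplus> b \<preceq> mul i c) \<longleftrightarrow> (\<exists>i. a \<preceq> mul i c) \<and> (\<exists>i. b \<preceq> mul i c)"
  proof (intro iffI conjI; (elim exE conjE)?)
    fix i assume "a \<oplus> b \<preceq> mul i c"
    then show "\<exists>i. a \<preceq> mul i c" "\<exists>i. b \<preceq> mul i c" using le lle_trans car by blast+
  next
    fix i j assume "a \<preceq> mul i c" "b \<preceq> mul j c"
    then have 1: "a \<oplus> b \<preceq> mul i c \<oplus> mul j c" using lle_add_mono car by blast
    obtain k where "mul i c \<oplus> mul j c \<preceq> mul k c" using mul_plus[of i j] c by blast
    then show "\<exists>i. a \<oplus> b \<preceq> mul i c" using 1 lle_trans[of "a \<oplus> b" "mul i c \<oplus> mul j c" "mul k c"] car by auto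
  qed
  then show ?thesis using ideal_subset_iff a b c ab by simp
qed

lemma ideal_mono:
  assumes "a \<preceq> b" "a \<in> positive_cone G" "b \<in> positive_cone G" shows "ideal a \<subseteq> ideal b"
proof -
  obtain i where "b \<preceq> mul i b" using mul_one assms(3) by blast
  then have "a \<preceq> mul i b" by (rule lle_trans[OF assms(1)]) (use assms mul_positive positive_coneD(1) in blast)+
  then show ?thesis using ideal_subset_iff assms by blast
qed

lemma ideal_add_cong:
  assumes "a \<in> positive_cone G" "b \<in> positive_cone G" "c \<in> positive_cone G" "b \<preceq> a \<oplus> c" "c \<preceq> a \<oplus> b"
  shows "ideal (a \<oplus> b) = ideal (a \<oplus> c)"
proof -
  have pos: "a \<oplus> b \<in> positive_cone G" "a \<oplus> c \<in> positive_cone G" using assms(1-3) positive_add by simp_all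
  have "ideal b \<subseteq> ideal (a \<oplus> c)" "ideal c \<subseteq> ideal (a \<oplus> b)"
    by (rule ideal_mono[OF assms(4,2) pos(2)], rule ideal_mono[OF assms(5,3) pos(1)])
  then show ?thesis
    using ideal_add[OF assms(1,2) pos(2)] ideal_add[OF assms(1,3) pos(1)]
      ideal_add[OF assms(1,2) pos(1)] ideal_add[OF assms(1,3) pos(2)] by (intro subset_antisym) simp_all
qed

text \<open>Separate multipliers for \<open>b\<close> and \<open>c\<close> allow the term with
  \<open>b\<close> to be moved to the left, which leaves a condition on \<open>c\<close> alone for
  each of countably many indices.\<close>

lemma dominated_by_sum_iff:
  assumes a: "a \<in> positive_cone G" and b: "b \<in> positive_cone G" and c: "c \<in> positive_cone G"
  shows "(\<exists>i. a \<preceq> mul i (b \<oplus> c)) \<longleftrightarrow> (\<exists>i j. a \<preceq> mul i b \<oplus> mul j c)"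
proof
  assume "\<exists>i. a \<preceq> mul i (b \<oplus> c)"
  then show "\<exists>i j. a \<preceq> mul i b \<oplus> mul j c" using mul_add[OF b c] by auto
next
  assume "\<exists>i j. a \<preceq> mul i b \<oplus> mul j c"
  then obtain i j where ij: "a \<preceq> mul i b \<oplus> mul j c" by blast
  have bc: "b \<oplus> c \<in> positive_cone G" using positive_add[OF b c] .
  obtain k where k: "mul i (b \<oplus> c) \<oplus> mul j (b \<oplus> c) \<preceq> mul k (b \<oplus> c)" using mul_plus[of i j] bc by blast
  note car = a[THEN positive_coneD(1)] b[THEN positive_coneD(1)] c[THEN positive_coneD(1)]
    mul_positive[OF b, THEN positive_coneD(1)] mul_positive[OF c, THEN positive_coneD(1)] mul_positive[OF bc, THEN positive_coneD(1)]
  have "mul i b \<oplus> mul j c \<preceq> mul i (b \<oplus> c) \<oplus> mul j (b \<oplus> c)"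
    by (rule lle_add_mono[OF mul_mono[OF lle_add_positive(1)[OF car(2) c] b bc] mul_mono[OF lle_add_positive(2)[OF car(3) b] c bc]])
      (rule car)+
  then have "a \<preceq> mul k (b \<oplus> c)"
    using lle_trans[OF lle_trans[OF ij] k] car by simp
  then show "\<exists>i. a \<preceq> mul i (b \<oplus> c)" by blast
qed

text \<open>If a = m + a' and b = m + b' with \<open>a'\<close>, \<open>b'\<close> disjoint, the
  ideals of \<open>a'\<close> and \<open>b'\<close> witness complete normality. The bases of
  differences are indexed by the multipliers, which is why these have to be countable.\<close>

lemma ideal_lattice_iso:
  fixes f :: "'l::{distrib_lattice, bounded_lattice_bot} \<Rightarrow> 'a set"
  assumes iso: "lattice_iso f (inclusion_order (ideal ` positive_cone G))"
  shows "completely_normal TYPE('l)" "countably_based_differences TYPE('l)"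
proof -
  let ?C = "ideal ` positive_cone G"
  have join: "ideal a \<subseteq> ideal (a \<oplus> b)" "ideal b \<subseteq> ideal (a \<oplus> b)" "ideal (a \<oplus> b) \<in> ?C"
    "\<And>W. W \<in> ?C \<Longrightarrow> ideal a \<subseteq> W \<Longrightarrow> ideal b \<subseteq> W \<Longrightarrow> ideal (a \<oplus> b) \<subseteq> W"
    if ab: "a \<in> positive_cone G" "b \<in> positive_cone G" for a b
  proof -
    show "ideal a \<subseteq> ideal (a \<oplus> b)" "ideal b \<subseteq> ideal (a \<oplus> b)" "ideal (a \<oplus> b) \<in> ?C"
      using ideal_add[OF ab positive_add[OF ab]] positive_add[OF ab] by simp_all
    show "ideal (a \<oplus> b) \<subseteq> W" if "W \<in> ?C" "ideal a \<subseteq> W" "ideal b \<subseteq> W" for W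
      using \<open>W \<in> ?C\<close> that(2,3) ideal_add[OF ab] by (elim imageE) simp
  qed
  have le: "f x \<subseteq> f y \<longleftrightarrow> x \<le> y" for x y
  proof (rule lattice_iso_inclusion_order_le[OF iso])
    fix X Y assume "X \<in> ?C" "Y \<in> ?C"
    then obtain a b where ab: "a \<in> positive_cone G" "b \<in> positive_cone G" "X = ideal a" "Y = ideal b" by blast
    show "\<exists>Z\<in>?C. X \<subseteq> Z \<and> Y \<subseteq> Z \<and> (\<forall>W\<in>?C. X \<subseteq> W \<longrightarrow> Y \<subseteq> W \<longrightarrow> Z \<subseteq> W)"
      unfolding ab(3,4) by (intro bexI[OF _ join(3)[OF ab(1,2)]] conjI ballI impI join ab(1,2))
  qed
  have sup: "f (x \<curlyvee> y) = ideal (a \<oplus> b)"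
    if "f x = ideal a" "f y = ideal b" and ab: "a \<in> positive_cone G" "b \<in> positive_cone G" for x y a b
    using inclusion_order_join[of "ideal a" ?C "ideal b", OF _ _ join(3,1,2,4)[OF ab]] iso ab that(1,2)
    by (simp add: lattice_iso_def)
  have eqI: "x = y" if "f x = f y" for x y using le[of x y] le[of y x] that by simp
  have range: "range f = ?C" using iso by (simp add: lattice_iso_def bij_betw_def)
  have preimage: "\<exists>a\<in>positive_cone G. f x = ideal a" for x
  proof -
    have "f x \<in> ?C" using range by blast
    then show ?thesis by blast
  qed
  have "\<exists>x. f x = ideal a" if "a \<in> positive_cone G" for a
  proof -
    have "ideal a \<in> range f" using range that by simp
    then show ?thesis by (metis rangeE)
  qed
  then obtain h where h: "\<And>a. a \<in> positive_cone G \<Longrightarrow> f (h a) = ideal a" by metis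
  show "completely_normal TYPE('l)"
    unfolding completely_normal_def
  proof (intro allI)
    fix x y :: 'l
    obtain a b where ab: "a \<in> positive_cone G" "f x = ideal a" "b \<in> positive_cone G" "f y = ideal b"
      using preimage[of x] preimage[of y] by blast
    obtain m a' b' where split: "m \<in> positive_cone G" "a' \<in> positive_cone G" "b' \<in> positive_cone G"
      "a = m \<oplus> a'" "b = m \<oplus> b'" "disjoint a' b'"
      using disjoint_decomposition[OF ab(1,3)] .
    note car = split(1-3)[THEN positive_coneD(1)] ab(1,3)[THEN positive_coneD(1)]
    \<comment> \<open>All sums are expressed through \<open>m\<close>, \<open>a'\<close> and
      \<open>b'\<close>: a + b' = b + a' shows that \<open>b\<close> is below a + b', and the others
      that \<open>b'\<close> is below a + b.\<close>
    have sums: "a \<oplus> b' = b \<oplus> a'" "a \<oplus> b = (a \<oplus> m) \<oplus> b'" "b \<oplus> a = (b \<oplus> m) \<oplus> a'"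
      using car by (simp_all add: split(4,5) a_ac)
    have "b \<preceq> a \<oplus> b'" "b' \<preceq> a \<oplus> b"
      using lle_add_positive(1)[OF car(5) split(2)] lle_add_positive(2)[OF car(3) positive_add[OF ab(1) split(1)]]
      by (simp_all only: sums)
    then have "f (x \<curlyvee> y) = f (x \<curlyvee> h b')"
      using sup[OF ab(2,4,1,3)] sup[OF ab(2) h ab(1)] split(3) ideal_add_cong[OF ab(1,3) split(3)] by simp
    moreover have "a \<preceq> b \<oplus> a'" "a' \<preceq> b \<oplus> a"
      using lle_add_positive(1)[OF car(4) split(3)] lle_add_positive(2)[OF car(2) positive_add[OF ab(3) split(1)]]
      by (simp_all only: sums)
    then have "f (y \<curlyvee> x) = f (y \<curlyvee> h a')"
      using sup[OF ab(4,2,3,1)] sup[OF ab(4) h ab(3)] split(2) ideal_add_cong[OF ab(3,1) split(2)] by simp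
    moreover have "h a' \<curlywedge> h b' = bot"
    proof (rule eqI)
      define z where "z = h a' \<curlywedge> h b'"
      obtain c d where c: "c \<in> positive_cone G" "f z = ideal c" and d: "d \<in> positive_cone G" "f bot = ideal d"
        using preimage by meson
      \<comment> \<open>The meet of the two ideals is not computed: a generator \<open>c\<close> of
        it is below a multiple of \<open>a'\<close> and a multiple of \<open>b'\<close>, and such
        multiples are disjoint.\<close>
      have "f z \<subseteq> ideal a'" "f z \<subseteq> ideal b'"
        using le[of z "h a'"] le[of z "h b'"] h split(2,3) by (simp_all add: z_def)
      then obtain i j where "c \<preceq> mul i a'" "c \<preceq> mul j b'" using ideal_subset_iff c split(2,3) by auto
      then have "c = \<zero>" using mul_disjoint[OF split(6,2,3)] c unfolding disjoint_def by blast
      then have "f z \<subseteq> f bot" using ideal_mono[OF positive_coneD(2)[OF d(1)] positive_zero d(1)] c d by simp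
      then show "f (h a' \<curlywedge> h b') = f bot" using le[of bot z] by (simp add: z_def)
    qed
    ultimately show "\<exists>x' y'. x \<curlyvee> y = x \<curlyvee> y' \<and> x \<curlyvee> y = x' \<curlyvee> y \<and> x' \<curlywedge> y' = bot"
      using eqI[of "x \<curlyvee> y" "x \<curlyvee> h b'"] eqI[of "y \<curlyvee> x" "y \<curlyvee> h a'"]
      by (intro exI[of _ "h a'"] exI[of _ "h b'"]) (simp add: sup_commute)
  qed
  show "countably_based_differences TYPE('l)"
    unfolding countably_based_differences_def
  proof (intro allI)
    fix x y :: 'l
    obtain a b where ab: "a \<in> positive_cone G" "f x = ideal a" "b \<in> positive_cone G" "f y = ideal b"
      using preimage[of x] preimage[of y] by blast
    define d where "d i = (a \<ominus> mul i b) \<squnion>\<^sub>G \<zero>" for i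
    have t: "a \<ominus> mul i b \<in> carrier G" "a \<in> carrier G" "mul i b \<in> carrier G" for i
      using ab mul_positive positive_coneD(1) by auto
    have d: "d i \<in> positive_cone G" for i
      using t order.join_right[OF t(1) zero_closed] by (auto intro!: positive_coneI simp: d_def)
    have d_le: "d i \<preceq> c \<longleftrightarrow> a \<preceq> mul i b \<oplus> c" if c: "c \<in> positive_cone G" for i c
    proof -
      note cc = positive_coneD[OF c]
      have "d i \<preceq> c \<longleftrightarrow> a \<ominus> mul i b \<preceq> c"
      proof
        assume "d i \<preceq> c"
        then show "a \<ominus> mul i b \<preceq> c"
          using lle_trans[OF order.join_left[OF t(1)[of i] zero_closed] _ t(1) _ cc(1)] d[of i, THEN positive_coneD(1)]
          by (simp add: d_def)
      next
        assume "a \<ominus> mul i b \<preceq> c"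
        then show "d i \<preceq> c" unfolding d_def using t cc by (intro order.join_le) auto
      qed
      then show ?thesis using lle_diff_iff t cc by simp
    qed
    have "x \<le> y \<curlyvee> z \<longleftrightarrow> (\<exists>i. h (d i) \<le> z)" for z
    proof -
      obtain c where c: "c \<in> positive_cone G" "f z = ideal c" using preimage by blast
      have "x \<le> y \<curlyvee> z \<longleftrightarrow> ideal a \<subseteq> ideal (b \<oplus> c)" using le[of x "y \<curlyvee> z"] sup[OF ab(4) c(2) ab(3) c(1)] ab by simp
      also have "\<dots> \<longleftrightarrow> (\<exists>i j. a \<preceq> mul i b \<oplus> mul j c)"
        using ideal_subset_iff[OF ab(1) positive_add[OF ab(3) c(1)]] dominated_by_sum_iff[OF ab(1,3) c(1)] by simp
      also have "\<dots> \<longleftrightarrow> (\<exists>i. h (d i) \<le> z)"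
        using d_le[OF mul_positive[OF c(1)]] ideal_subset_iff[OF d c(1)] le[of "h (d _)" z] h[OF d] c(2) by simp
      finally show ?thesis .
    qed
    then show "\<exists>C. countable C \<and> (\<forall>z. x \<le> y \<curlyvee> z \<longleftrightarrow> (\<exists>c\<in>C. c \<le> z))"
      using countable_image[OF countable_multipliers, of "\<lambda>i. h (d i)"]
      by (intro exI[of _ "range (\<lambda>i. h (d i))"]) auto
  qed
qed

end

context abelian_lgroup
begin

text \<open>For \<open>w\<close> below x + z and \<open>y\<close>, the element w - x is below
  \<open>w\<close> and \<open>z\<close>, hence below their meet. That meet is 0 since
  \<open>z\<close> is disjoint from \<open>y\<close>; so w \<le> x, and disjointness from
  \<open>x\<close> finishes.\<close>

lemma disjoint_add:
  assumes "disjoint x y" "disjoint z y" "x \<in> positive_cone G" "z \<in> positive_cone G" "y \<in> positive_cone G"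
  shows "disjoint (x \<oplus> z) y"
  unfolding disjoint_def
proof (intro ballI impI)
  fix w assume w: "w \<in> positive_cone G" "w \<preceq> x \<oplus> z" "w \<preceq> y"
  note car = w(1)[THEN positive_coneD(1)] assms(3-5)[THEN positive_coneD(1)]
  define m where "m = w \<sqinter>\<^sub>G z"
  have m: "m \<in> carrier G" "m \<preceq> w" "m \<preceq> z" "\<zero> \<preceq> m"
    using car w(1) assms(4) positive_coneD(2) by (auto simp: m_def intro: order.meet_left order.meet_right order.meet_le)
  have "m \<preceq> y" using lle_trans[OF m(2) w(3)] m car by blast
  moreover have "m \<in> positive_cone G" using m by (simp add: positive_coneI)
  ultimately have "m = \<zero>" using assms(2) m(3) unfolding disjoint_def by blast
  have "w \<ominus> x \<preceq> w" "w \<ominus> x \<preceq> z"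
    using lle_add_positive(2)[OF car(1) assms(3)] w(2) car by (simp_all add: lle_diff_iff)
  then have "w \<ominus> x \<preceq> m" unfolding m_def using car by (intro order.meet_le) auto
  then have "w \<preceq> x" using \<open>m = \<zero>\<close> car by (simp add: lle_diff_iff)
  then show "w = \<zero>" using assms(1) w unfolding disjoint_def by blast
qed

lemma disjoint_zero: "y \<in> positive_cone G \<Longrightarrow> disjoint \<zero> y"
  unfolding disjoint_def by (intro ballI impI lle_antisym) (simp_all add: positive_coneD)

lemma nat_multipliers: "multipliers G (\<lambda>n x. [(n::nat)] \<cdot> x)"
proof unfold_locales
  have pos: "[n] \<cdot> x \<in> positive_cone G" if "x \<in> positive_cone G" for n :: nat and x
    using that positive_zero positive_add positive_coneD(1) by (induction n) auto
  show "countable (UNIV :: nat set)" by simp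
  show "[i] \<cdot> x \<in> positive_cone G" if "x \<in> positive_cone G" for i :: nat and x using pos[OF that] .
  show "[i] \<cdot> x \<preceq> [i] \<cdot> y" if "x \<preceq> y" "x \<in> positive_cone G" "y \<in> positive_cone G" for i :: nat and x y
  proof (induction i)
    case (Suc i)
    then show ?case using lle_add_mono[OF Suc that(1)] that(2,3)[THEN positive_coneD(1)] by simp
  qed (simp add: order.le_refl)
  show "[i] \<cdot> (x \<oplus> y) = [i] \<cdot> x \<oplus> [i] \<cdot> y" if "x \<in> positive_cone G" "y \<in> positive_cone G" for i :: nat and x y
    using that[THEN positive_coneD(1)] by (simp add: add.nat_pow_distrib)
  show "\<exists>i::nat. \<forall>x\<in>positive_cone G. x \<preceq> [i] \<cdot> x"
    by (intro exI[of _ 1] ballI) (simp add: positive_coneD(1) order.le_refl)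
  show "\<exists>k::nat. \<forall>x\<in>positive_cone G. [i] \<cdot> ([j] \<cdot> x) \<preceq> [k] \<cdot> x" for i j :: nat
    by (intro exI[of _ "j * i"] ballI) (simp add: positive_coneD(1) add.nat_pow_pow order.le_refl)
  show "\<exists>k::nat. \<forall>x\<in>positive_cone G. [i] \<cdot> x \<oplus> [j] \<cdot> x \<preceq> [k] \<cdot> x" for i j :: nat
    by (intro exI[of _ "i + j"] ballI) (simp add: positive_coneD(1) add.nat_pow_mult order.le_refl)
  have one_side: "disjoint ([i] \<cdot> x) y"
    if "disjoint x y" "x \<in> positive_cone G" "y \<in> positive_cone G" for x y and i :: nat
  proof (induction i)
    case 0
    then show ?case using disjoint_zero that by simp
  next
    case (Suc i)
    then show ?case using disjoint_add[OF Suc that(1)] pos that by simp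
  qed
  show "disjoint ([i] \<cdot> x) ([j] \<cdot> y)"
    if "disjoint x y" "x \<in> positive_cone G" "y \<in> positive_cone G" for x y and i j :: nat
    using one_side[OF _ _ pos] one_side that disjoint_commute by blast
qed

lemma Idc_group_eq: "Idc_group G = inclusion_order (multipliers.ideal G (\<lambda>n x. [(n::nat)] \<cdot> x) ` positive_cone G)"
proof -
  interpret multipliers G "\<lambda>n x. [(n::nat)] \<cdot> x" by (rule nat_multipliers)
  have "principal_lideal G = ideal" by (simp add: fun_eq_iff principal_lideal_def ideal_def)
  then show ?thesis by (simp add: Idc_group_def inclusion_order_def)
qed

end

context vector_lattice
begin

notation lle (infix "\<preceq>" 50)

lemma scal_zero_right: "r \<star> \<zero> = \<zero>"
proof -
  have "r \<star> \<zero> \<oplus> r \<star> \<zero> = r \<star> \<zero>" using scal_add_right[of \<zero> \<zero> r] by simp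
  then show ?thesis using scal_closed[of \<zero> r] by (simp add: add.l_cancel_one)
qed

lemma scal_mono:
  assumes "0 \<le> r" "x \<preceq> y" "x \<in> carrier E" "y \<in> carrier E" shows "r \<star> x \<preceq> r \<star> y"
proof -
  have "y \<ominus> x \<in> positive_cone E"
    using lle_add_right[OF assms(2-4), of "\<ominus> x"] assms by (intro positive_coneI) (simp_all add: a_minus_def r_neg)
  then have "r \<star> (y \<ominus> x) \<in> positive_cone E" using scal_positive assms(1) by blast
  then have "r \<star> x \<preceq> r \<star> x \<oplus> r \<star> (y \<ominus> x)" by (rule lle_add_positive(1)[OF scal_closed[OF assms(3)]])
  moreover have "r \<star> x \<oplus> r \<star> (y \<ominus> x) = r \<star> y" using scal_add_right[of x "y \<ominus> x" r] add_diff_cancel assms by simp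
  ultimately show ?thesis by simp
qed

lemma scal_mono_left:
  assumes "r \<le> s" "x \<in> positive_cone E" shows "r \<star> x \<preceq> s \<star> x"
proof -
  have "(s - r) \<star> x \<in> positive_cone E" using scal_positive assms by simp
  then have "r \<star> x \<preceq> r \<star> x \<oplus> (s - r) \<star> x"
    by (rule lle_add_positive(1)[OF scal_closed[OF positive_coneD(1)[OF assms(2)]]])
  then show ?thesis using scal_add_left[of x r "s - r"] assms positive_coneD(1) by simp
qed

text \<open>Absolute values make the whole type \<open>'k\<close> an index set for multiplication by
  nonnegative scalars.\<close>

lemma scalar_multipliers:
  assumes "countable (UNIV :: 'k set)" shows "multipliers E (\<lambda>r x. \<bar>r\<bar> \<star> x)"
proof unfold_locales
  show "countable (UNIV :: 'k set)" by fact
  have car: "x \<in> carrier E" if "x \<in> positive_cone E" for x using that positive_coneD(1) by blast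
  show pos: "\<bar>r\<bar> \<star> x \<in> positive_cone E" if "x \<in> positive_cone E" for r :: 'k and x
    using scal_positive[of "\<bar>r\<bar>"] that by simp
  show "\<bar>r\<bar> \<star> x \<preceq> \<bar>r\<bar> \<star> y" if "x \<preceq> y" "x \<in> positive_cone E" "y \<in> positive_cone E" for r :: 'k and x y
    using scal_mono[of "\<bar>r\<bar>" x y] that car by simp
  show "\<bar>r\<bar> \<star> (x \<oplus> y) = \<bar>r\<bar> \<star> x \<oplus> \<bar>r\<bar> \<star> y" if "x \<in> positive_cone E" "y \<in> positive_cone E" for r :: 'k and x y
    using scal_add_right that car by blast
  have one: "\<bar>1 :: 'k\<bar> = 1" using ordered_division_ring_pos(1)[where 'k='k] by simp
  show "\<exists>r::'k. \<forall>x\<in>positive_cone E. x \<preceq> \<bar>r\<bar> \<star> x"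
    by (intro exI[of _ 1] ballI) (simp add: one scal_one car order.le_refl)
  show "\<exists>t::'k. \<forall>x\<in>positive_cone E. \<bar>r\<bar> \<star> \<bar>s\<bar> \<star> x \<preceq> \<bar>t\<bar> \<star> x" for r s :: 'k
    by (intro exI[of _ "\<bar>r\<bar> * \<bar>s\<bar>"] ballI) (simp add: car scal_closed scal_assoc order.le_refl)
  show "\<exists>t::'k. \<forall>x\<in>positive_cone E. \<bar>r\<bar> \<star> x \<oplus> \<bar>s\<bar> \<star> x \<preceq> \<bar>t\<bar> \<star> x" for r s :: 'k
    by (intro exI[of _ "\<bar>r\<bar> + \<bar>s\<bar>"] ballI) (simp add: car scal_closed scal_add_left order.le_refl)
  show "disjoint (\<bar>r\<bar> \<star> x) (\<bar>s\<bar> \<star> y)"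
    if dis: "disjoint x y" and xy: "x \<in> positive_cone E" "y \<in> positive_cone E" for r s :: 'k and x y
    unfolding disjoint_def
  proof (intro ballI impI)
    fix z assume z: "z \<in> positive_cone E" "z \<preceq> \<bar>r\<bar> \<star> x" "z \<preceq> \<bar>s\<bar> \<star> y"
    \<comment> \<open>A common bound of both factors, made positive by the summand 1, so that one
      can divide by it.\<close>
    define t where "t = \<bar>r\<bar> + \<bar>s\<bar> + 1"
    have t: "\<bar>r\<bar> \<le> t" "\<bar>s\<bar> \<le> t" "0 < t"
      using ordered_division_ring_pos(1)[where 'k='k] by (auto simp: t_def add_nonneg_pos add_increasing add_increasing2 add_increasing2[of 1])
    then have it: "0 \<le> inverse t" "inverse t * t = 1" using ordered_division_ring_pos(3)[of t] by auto
    have "z \<preceq> t \<star> x" "z \<preceq> t \<star> y"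
      using lle_trans[OF z(2) scal_mono_left[OF t(1) xy(1)]] lle_trans[OF z(3) scal_mono_left[OF t(2) xy(2)]]
        scal_closed xy z car by blast+
    then have "inverse t \<star> z \<preceq> x" "inverse t \<star> z \<preceq> y"
      using scal_mono[OF it(1)] scal_assoc[of x "inverse t" t] scal_assoc[of y "inverse t" t] it(2)
        scal_one scal_closed xy z car by metis+
    moreover have "inverse t \<star> z \<in> positive_cone E" using scal_positive it(1) z by blast
    ultimately have "inverse t \<star> z = \<zero>" using dis by (simp add: disjoint_def)
    then have "t \<star> (inverse t \<star> z) = \<zero>" by (simp add: scal_zero_right)
    then show "z = \<zero>" using scal_assoc[of z t "inverse t"] t(3) scal_one z car by simp
  qed
qed

lemma Idc_vector_eq:
  assumes "countable (UNIV :: 'k set)"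
  shows "Idc_vector E = inclusion_order (multipliers.ideal E (\<lambda>r x. \<bar>r\<bar> \<star> x) ` positive_cone E)"
proof -
  interpret multipliers E "\<lambda>r x. \<bar>r\<bar> \<star> x" using assms by (rule scalar_multipliers)
  have "(\<exists>r\<ge>0. a \<preceq> r \<star> b) \<longleftrightarrow> (\<exists>r. a \<preceq> \<bar>r\<bar> \<star> b)" for a b
    by (metis abs_ge_zero abs_of_nonneg)
  then have "principal_videal E = ideal" by (simp add: fun_eq_iff principal_videal_def ideal_def)
  then show ?thesis by (simp add: Idc_vector_def inclusion_order_def)
qed

end

lemma Idc_group_properties:
  fixes f :: "'l::{distrib_lattice, bounded_lattice_bot} \<Rightarrow> 'a set"
  assumes "abelian_lgroup G" "lattice_iso f (Idc_group G)"
  shows "completely_normal TYPE('l)" "countably_based_differences TYPE('l)"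
proof -
  interpret abelian_lgroup G by fact
  interpret multipliers G "\<lambda>n x. [(n::nat)] \<cdot>\<^bsub>G\<^esub> x" by (rule nat_multipliers)
  show "completely_normal TYPE('l)" "countably_based_differences TYPE('l)"
    using ideal_lattice_iso assms(2) unfolding Idc_group_eq by blast+
qed

lemma Idc_vector_properties:
  fixes f :: "'l::{distrib_lattice, bounded_lattice_bot} \<Rightarrow> 'a set"
    and E :: "('k::{division_ring, linordered_ring}, 'a) vlattice"
  assumes "vector_lattice E" "lattice_iso f (Idc_vector E)" and k: "countable (UNIV :: 'k set)"
  shows "completely_normal TYPE('l)" "countably_based_differences TYPE('l)"
proof -
  interpret vector_lattice E by fact
  interpret multipliers E "\<lambda>r x. \<bar>r\<bar> \<star>\<^bsub>E\<^esub> x" using k by (rule scalar_multipliers)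
  show "completely_normal TYPE('l)" "countably_based_differences TYPE('l)"
    using ideal_lattice_iso assms(2) unfolding Idc_vector_eq[OF k] by blast+
qed

section \<open>Vector lattices of piecewise linear functions\<close>

text \<open>
  At every prime filter \<open>P\<close> the valuation \<open>p\<close> totally preorders the space \<open>'v\<close>. A vector lattice
  is formed by the functions that are represented, at each \<open>P\<close>, by one of finitely many
  vectors, in such a way that comparisons with constants correspond to elements of the lattice.
\<close>

locale archimedean_valued_space = valued_space scale UNIV p
  for scale :: "'k::{division_ring, linordered_ring} \<Rightarrow> 'v::ab_group_add \<Rightarrow> 'v" (infixr "*s" 75)
    and p :: "'v \<Rightarrow> 'l::{distrib_lattice, bounded_lattice_bot}" +
  assumes arch: "archimedean UNIV p" and surjective: "surj p"
begin

text \<open>The compact open sets of the prime filter space. They are closed under finite unions and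
  nonempty finite intersections, but in general not under complements: strict comparisons are
  definable, weak ones need not be.\<close>

definition definable :: "('l set \<Rightarrow> bool) \<Rightarrow> bool" where
  "definable \<Phi> \<longleftrightarrow> (\<exists>l. \<forall>P. prime_filter P \<longrightarrow> (\<Phi> P \<longleftrightarrow> l \<in> P))"

lemma definable_cong: "(\<And>P. prime_filter P \<Longrightarrow> \<Phi> P \<longleftrightarrow> \<Psi> P) \<Longrightarrow> definable \<Phi> \<longleftrightarrow> definable \<Psi>"
  by (auto simp: definable_def)

lemma definable_lt: "definable (\<lambda>P. lt P u v)"
  unfolding definable_def lt_def by blast

lemma definable_disj: "definable \<Phi> \<Longrightarrow> definable \<Psi> \<Longrightarrow> definable (\<lambda>P. \<Phi> P \<or> \<Psi> P)"
  unfolding definable_def by (elim exE, rule_tac x="l \<curlyvee> la" in exI) (auto simp: prime_filterD)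

lemma definable_conj: "definable \<Phi> \<Longrightarrow> definable \<Psi> \<Longrightarrow> definable (\<lambda>P. \<Phi> P \<and> \<Psi> P)"
  unfolding definable_def by (elim exE, rule_tac x="l \<curlywedge> la" in exI) (auto simp: prime_filterD)

lemma definable_ball:
  assumes "finite I" "I \<noteq> {}" "\<And>i. i \<in> I \<Longrightarrow> definable (\<Phi> i)"
  shows "definable (\<lambda>P. \<forall>i\<in>I. \<Phi> i P)"
  using assms
proof (induction rule: finite_ne_induct)
  case (insert i I)
  then show ?case using definable_conj[of "\<Phi> i" "\<lambda>P. \<forall>i\<in>I. \<Phi> i P"] by simp
qed simp

definition vals :: "('l set \<Rightarrow> 'v) \<Rightarrow> 'v set" where
  "vals x = x ` {P. prime_filter P}"

definition piecewise :: "('l set \<Rightarrow> 'v) \<Rightarrow> bool" where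
  "piecewise x \<longleftrightarrow> finite (vals x) \<and> (\<forall>v. definable (\<lambda>P. lt P v (x P)) \<and> definable (\<lambda>P. lt P (x P) v))"

lemma vals_nonempty: "vals x \<noteq> {}"
proof -
  have "prime_filter ({} :: 'l set)" by (simp add: prime_filter_def)
  then show ?thesis by (auto simp: vals_def)
qed

lemma vals_finite: "piecewise x \<Longrightarrow> finite (vals x)"
  by (simp add: piecewise_def)

lemma in_vals: "prime_filter P \<Longrightarrow> x P \<in> vals x"
  by (simp add: vals_def)

lemma finite_vals_binary:
  assumes "piecewise x" "piecewise y" "\<And>P. z P = f P (x P) (y P)" "\<And>P a b. f P a b \<in> S a b" "\<And>a b. finite (S a b)"
  shows "finite (vals z)"
proof (rule finite_subset)
  have "z P \<in> S (x P) (y P)" for P using assms(3,4) by simp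
  then show "vals z \<subseteq> (\<Union>a\<in>vals x. \<Union>b\<in>vals y. S a b)" unfolding vals_def by blast
  show "finite (\<Union>a\<in>vals x. \<Union>b\<in>vals y. S a b)" using assms vals_finite by blast
qed

lemma piecewise_const: "piecewise (\<lambda>_. v)"
proof -
  have "vals (\<lambda>_. v) \<subseteq> {v}" by (auto simp: vals_def)
  then show ?thesis unfolding piecewise_def using definable_lt finite_subset by blast
qed

lemma piecewise_uminus:
  assumes "piecewise x" shows "piecewise (\<lambda>P. - x P)"
proof -
  have "lt P v (- x P) \<longleftrightarrow> lt P (x P) (- v)" "lt P (- x P) v \<longleftrightarrow> lt P (- v) (x P)" for P v
    using lt_minus[of P "- v" "x P"] lt_minus[of P "x P" "- v"] by simp_all
  moreover have "vals (\<lambda>P. - x P) = uminus ` vals x" by (auto simp: vals_def)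
  ultimately show ?thesis using assms unfolding piecewise_def by simp
qed

text \<open>Whether \<open>x\<close> takes the value \<open>f\<close> at \<open>P\<close> need not
  be definable. The right side uses strict comparisons only: constants f \<ge> x and g \<ge> y must
  satisfy v < f + g. Conversely the values at \<open>P\<close> themselves are such
  constants.\<close>

lemma lt_plus_iff:
  assumes "piecewise x" "piecewise y" and P: "prime_filter P"
  shows "lt P v (x P + y P) \<longleftrightarrow> (\<forall>(f, g)\<in>vals x \<times> vals y. lt P f (x P) \<or> lt P g (y P) \<or> lt P v (f + g))"
proof
  assume lt: "lt P v (x P + y P)"
  have "lt P v (f + g)" if "\<not> lt P f (x P)" "\<not> lt P g (y P)" for f g
  proof -
    have "\<not> lt P (f + g) (x P + g)" "\<not> lt P (x P + g) (x P + y P)" using that lt_add by blast+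
    then have "\<not> lt P (f + g) (x P + y P)" using lt_negtrans[OF P] by blast
    then show ?thesis using lt_negtrans[OF P lt] by blast
  qed
  then show "\<forall>(f, g)\<in>vals x \<times> vals y. lt P f (x P) \<or> lt P g (y P) \<or> lt P v (f + g)" by blast
next
  assume "\<forall>(f, g)\<in>vals x \<times> vals y. lt P f (x P) \<or> lt P g (y P) \<or> lt P v (f + g)"
  then show "lt P v (x P + y P)" using in_vals[OF P] lt_irrefl[OF P] by blast
qed

lemma piecewise_plus:
  assumes x: "piecewise x" and y: "piecewise y" shows "piecewise (\<lambda>P. x P + y P)"
proof -
  have half: "definable (\<lambda>P. lt P v (x P + y P))" if x: "piecewise x" and y: "piecewise y" for v x y
  proof -
    have "definable (\<lambda>P. \<forall>i\<in>vals x \<times> vals y. (case i of (f, g) \<Rightarrow> \<lambda>P. lt P f (x P) \<or> lt P g (y P) \<or> lt P v (f + g)) P)"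
    proof (rule definable_ball)
      show "finite (vals x \<times> vals y)" "vals x \<times> vals y \<noteq> {}"
        using x y vals_finite vals_nonempty by auto
      show "definable (case i of (f, g) \<Rightarrow> \<lambda>P. lt P f (x P) \<or> lt P g (y P) \<or> lt P v (f + g))" for i
        using x y unfolding piecewise_def by (cases i) (auto intro!: definable_disj definable_lt)
    qed
    then show ?thesis
      by (rule definable_cong[THEN iffD1, rotated]) (simp add: lt_plus_iff[OF x y] split_def)
  qed
  have "lt P (x P + y P) v \<longleftrightarrow> lt P (- v) (- x P + - y P)" for P v
    using lt_minus[of P v "x P + y P"] by (simp add: algebra_simps)
  then have "definable (\<lambda>P. lt P (x P + y P) v)" for v
    using half[OF piecewise_uminus[OF x] piecewise_uminus[OF y], of "- v"] by simp
  moreover have "finite (vals (\<lambda>P. x P + y P))"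
    by (rule finite_vals_binary[OF x y, of _ "\<lambda>_ a b. a + b" "\<lambda>a b. {a + b}"]) auto
  ultimately show ?thesis using half[OF x y] unfolding piecewise_def by blast
qed

lemma piecewise_scale:
  assumes x: "piecewise x" shows "piecewise (\<lambda>P. r *s x P)"
proof -
  have pos: "piecewise (\<lambda>P. r *s x P)" if r: "0 < r" and x: "piecewise x" for r x
  proof -
    have "lt P v (r *s x P) \<longleftrightarrow> lt P (inverse r *s v) (x P)" "lt P (r *s x P) v \<longleftrightarrow> lt P (x P) (inverse r *s v)"
      if "prime_filter P" for P v
      using lt_scale[OF that r, of "inverse r *s v" "x P"] lt_scale[OF that r, of "x P" "inverse r *s v"] r by simp_all
    then have "definable (\<lambda>P. lt P v (r *s x P))" "definable (\<lambda>P. lt P (r *s x P) v)" for v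
      using x definable_cong[of "\<lambda>P. lt P v (r *s x P)" "\<lambda>P. lt P (inverse r *s v) (x P)"]
        definable_cong[of "\<lambda>P. lt P (r *s x P) v" "\<lambda>P. lt P (x P) (inverse r *s v)"] unfolding piecewise_def by blast+
    moreover have "vals (\<lambda>P. r *s x P) = (*s) r ` vals x" by (auto simp: vals_def)
    ultimately show ?thesis using x unfolding piecewise_def by simp
  qed
  show ?thesis
  proof (cases r "0::'k" rule: linorder_cases)
    case less
    then show ?thesis using piecewise_uminus[OF pos[of "- r" x]] x by (simp add: scale_minus_left)
  next
    case equal
    then show ?thesis using piecewise_const[of 0] by simp
  next
    case greater
    then show ?thesis using pos x by blast
  qed
qed

definition pmax :: "('l set \<Rightarrow> 'v) \<Rightarrow> ('l set \<Rightarrow> 'v) \<Rightarrow> 'l set \<Rightarrow> 'v" where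
  "pmax x y P = (if lt P (x P) (y P) then y P else x P)"

lemma lt_pmax:
  assumes "prime_filter P"
  shows "lt P v (pmax x y P) \<longleftrightarrow> lt P v (x P) \<or> lt P v (y P)" "lt P (pmax x y P) v \<longleftrightarrow> lt P (x P) v \<and> lt P (y P) v"
  using lt_trans[OF assms, of v "x P" "y P"] lt_le_trans[OF assms, of v "y P" "x P"]
    lt_trans[OF assms, of "x P" "y P" v] le_lt_trans[OF assms, of "x P" "y P" v]
  by (auto simp: pmax_def)

lemma piecewise_pmax:
  assumes "piecewise x" "piecewise y" shows "piecewise (pmax x y)"
proof -
  have "finite (vals (pmax x y))"
    by (rule finite_vals_binary[OF assms, of _ "\<lambda>P a b. if lt P a b then b else a" "\<lambda>a b. {a, b}"]) (auto simp: pmax_def)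
  moreover have "definable (\<lambda>P. lt P v (pmax x y P))" "definable (\<lambda>P. lt P (pmax x y P) v)" for v
    using assms definable_disj[of "\<lambda>P. lt P v (x P)" "\<lambda>P. lt P v (y P)"] definable_conj[of "\<lambda>P. lt P (x P) v" "\<lambda>P. lt P (y P) v"]
      definable_cong[OF lt_pmax(1)] definable_cong[OF lt_pmax(2)] unfolding piecewise_def by auto
  ultimately show ?thesis unfolding piecewise_def by blast
qed

definition pw_le :: "('l set \<Rightarrow> 'v) \<Rightarrow> ('l set \<Rightarrow> 'v) \<Rightarrow> bool" where
  "pw_le x y \<longleftrightarrow> (\<forall>P. prime_filter P \<longrightarrow> \<not> lt P (y P) (x P))"

definition pw_eq :: "('l set \<Rightarrow> 'v) \<Rightarrow> ('l set \<Rightarrow> 'v) \<Rightarrow> bool" where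
  "pw_eq x y \<longleftrightarrow> pw_le x y \<and> pw_le y x"

lemma pw_le_refl: "pw_le x x"
  using lt_irrefl by (auto simp: pw_le_def)

lemma pw_le_trans: "pw_le x y \<Longrightarrow> pw_le y z \<Longrightarrow> pw_le x z"
  unfolding pw_le_def using lt_negtrans by blast

lemma pw_le_add: "pw_le x y \<Longrightarrow> pw_le (\<lambda>P. x P + z P) (\<lambda>P. y P + z P)"
  by (simp add: pw_le_def lt_add)

lemma pw_le_add2:
  assumes "pw_le x y" "pw_le z w" shows "pw_le (\<lambda>P. x P + z P) (\<lambda>P. y P + w P)"
  using pw_le_trans[OF pw_le_add[OF assms(1), of z] pw_le_add[OF assms(2), of y, unfolded add.commute[of _ "y _"]]] .

lemma pw_le_scale: "0 \<le> r \<Longrightarrow> pw_le x y \<Longrightarrow> pw_le (\<lambda>P. r *s x P) (\<lambda>P. r *s y P)"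
  using lt_scale[of _ r] lt_irrefl by (cases "r = 0") (auto simp: pw_le_def)

lemma pw_le_uminus: "pw_le x y \<Longrightarrow> pw_le (\<lambda>P. - y P) (\<lambda>P. - x P)"
  by (simp add: pw_le_def lt_minus)

lemma pw_le_pmax: "pw_le x (pmax x y)" "pw_le y (pmax x y)" "pw_le x z \<Longrightarrow> pw_le y z \<Longrightarrow> pw_le (pmax x y) z"
  using lt_irrefl lt_asym by (auto simp: pw_le_def lt_pmax)

lemma pw_eq_congs:
  assumes "pw_eq x x'"
  shows "pw_eq y y' \<Longrightarrow> pw_eq (\<lambda>P. x P + y P) (\<lambda>P. x' P + y' P)" "pw_eq (\<lambda>P. - x P) (\<lambda>P. - x' P)"
    "pw_eq (\<lambda>P. r *s x P) (\<lambda>P. r *s x' P)" "pw_eq y y' \<Longrightarrow> pw_le x y \<longleftrightarrow> pw_le x' y'"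
proof -
  show "pw_eq y y' \<Longrightarrow> pw_eq (\<lambda>P. x P + y P) (\<lambda>P. x' P + y' P)"
    using assms pw_le_add2 unfolding pw_eq_def by blast
  show "pw_eq (\<lambda>P. - x P) (\<lambda>P. - x' P)" using assms pw_le_uminus unfolding pw_eq_def by blast
  show "pw_eq (\<lambda>P. r *s x P) (\<lambda>P. r *s x' P)"
  proof (cases "0 \<le> r")
    case True
    then show ?thesis using assms pw_le_scale unfolding pw_eq_def by blast
  next
    case False
    then have "pw_eq (\<lambda>P. (- r) *s x P) (\<lambda>P. (- r) *s x' P)"
      using assms pw_le_scale[of "- r"] unfolding pw_eq_def by simp
    then have "pw_eq (\<lambda>P. - ((- r) *s x P)) (\<lambda>P. - ((- r) *s x' P))"
      using pw_le_uminus unfolding pw_eq_def by blast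
    then show ?thesis by (simp add: scale_minus_left)
  qed
  show "pw_eq y y' \<Longrightarrow> pw_le x y \<longleftrightarrow> pw_le x' y'" using assms pw_le_trans unfolding pw_eq_def by blast
qed

text \<open>Agreement with \<open>v\<close> is a closed condition, so the lattice element records
  where it fails.\<close>

lemma piecewise_equality_element:
  assumes "piecewise x" shows "\<exists>l. \<forall>v P. prime_filter P \<longrightarrow> (l v \<in> P \<longleftrightarrow> lt P v (x P) \<or> lt P (x P) v)"
proof -
  have "\<exists>l. \<forall>P. prime_filter P \<longrightarrow> (l \<in> P \<longleftrightarrow> lt P v (x P) \<or> lt P (x P) v)" for v
    using definable_disj[of "\<lambda>P. lt P v (x P)" "\<lambda>P. lt P (x P) v"] assms
    unfolding piecewise_def definable_def[of "\<lambda>P. lt P v (x P) \<or> lt P (x P) v"] by blast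
  then have "\<forall>v. \<exists>l. \<forall>P. prime_filter P \<longrightarrow> (l \<in> P \<longleftrightarrow> lt P v (x P) \<or> lt P (x P) v)" by blast
  then show ?thesis by (rule choice)
qed

text \<open>A piecewise function is encoded by its values, each with the element where it is not attained.\<close>

lemma piecewise_code:
  assumes x: "piecewise x"
  shows "\<exists>xs :: ('v \<times> 'l) list. \<forall>P. prime_filter P \<longrightarrow> (\<exists>(f, l)\<in>set xs. l \<notin> P) \<and>
    (\<forall>(f, l)\<in>set xs. l \<notin> P \<longrightarrow> \<not> lt P f (x P) \<and> \<not> lt P (x P) f)"
proof -
  obtain l where l: "\<And>v P. prime_filter P \<Longrightarrow> l v \<in> P \<longleftrightarrow> lt P v (x P) \<or> lt P (x P) v"
    using piecewise_equality_element[OF x] by blast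
  obtain fs where fs: "set fs = vals x" using finite_list vals_finite[OF x] by metis
  show ?thesis
  proof (intro exI[of _ "map (\<lambda>f. (f, l f)) fs"] allI impI conjI)
    fix P :: "'l set" assume P: "prime_filter P"
    have "(x P, l (x P)) \<in> set (map (\<lambda>f. (f, l f)) fs)" using fs in_vals[OF P] by auto
    moreover have "l (x P) \<notin> P" using l[OF P] lt_irrefl[OF P] by blast
    ultimately show "\<exists>(f, l)\<in>set (map (\<lambda>f. (f, l f)) fs). l \<notin> P" by blast
    show "\<forall>(f, l)\<in>set (map (\<lambda>f. (f, l f)) fs). l \<notin> P \<longrightarrow> \<not> lt P f (x P) \<and> \<not> lt P (x P) f"
      using l[OF P] by auto
  qed
qed

text \<open>There may be more functions on the prime filters than elements of \<open>'e\<close>, but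
  a class modulo \<open>pw_eq\<close> is determined by a finite code. The chosen code depends only
  on the set of all codes of \<open>x\<close>, so equivalent functions receive the same one.\<close>

lemma piecewise_encoding:
  fixes j :: "('v \<times> 'l) list \<Rightarrow> 'e"
  assumes j: "inj j"
  obtains h :: "('l set \<Rightarrow> 'v) \<Rightarrow> 'e" where "\<And>x y. piecewise x \<Longrightarrow> piecewise y \<Longrightarrow> h x = h y \<longleftrightarrow> pw_eq x y"
proof -
  define C where "C x xs \<longleftrightarrow> (\<forall>P. prime_filter P \<longrightarrow> (\<exists>(f, l)\<in>set xs. l \<notin> P) \<and>
    (\<forall>(f, l)\<in>set xs. l \<notin> P \<longrightarrow> \<not> lt P f (x P) \<and> \<not> lt P (x P) f))" for x and xs :: "('v \<times> 'l) list"
  have eq: "pw_eq x y" if C: "C x xs" "C y xs" for x y xs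
    unfolding pw_eq_def pw_le_def
  proof (intro conjI allI impI)
    fix P :: "'l set" assume P: "prime_filter P"
    obtain f l where fl: "(f, l) \<in> set xs" "l \<notin> P" using C(1) P unfolding C_def by blast
    then have "\<not> lt P f (x P)" "\<not> lt P (x P) f" "\<not> lt P f (y P)" "\<not> lt P (y P) f"
      using C P unfolding C_def by blast+
    then show "\<not> lt P (y P) (x P)" "\<not> lt P (x P) (y P)" using lt_negtrans[OF P] by blast+
  qed
  have tr: "C y xs" if "pw_eq x y" "C x xs" for x y xs
    unfolding C_def
  proof (intro allI impI conjI)
    fix P :: "'l set" assume P: "prime_filter P"
    show "\<exists>(f, l)\<in>set xs. l \<notin> P" using that(2) P unfolding C_def by blast
    have "\<not> lt P (y P) (x P)" "\<not> lt P (x P) (y P)" using that(1) P by (auto simp: pw_eq_def pw_le_def)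
    moreover have "\<forall>(f, l)\<in>set xs. l \<notin> P \<longrightarrow> \<not> lt P f (x P) \<and> \<not> lt P (x P) f" using that(2) P unfolding C_def by blast
    ultimately show "\<forall>(f, l)\<in>set xs. l \<notin> P \<longrightarrow> \<not> lt P f (y P) \<and> \<not> lt P (y P) f"
      using lt_negtrans[OF P] by blast
  qed
  define code where "code x = (SOME xs. C x xs)" for x
  have code: "C x (code x)" if "piecewise x" for x
    using piecewise_code[OF that] someI_ex[of "C x"] unfolding C_def code_def by blast
  have "code x = code y \<longleftrightarrow> pw_eq x y" if "piecewise x" "piecewise y" for x y
  proof
    show "code x = code y \<Longrightarrow> pw_eq x y" using code[OF that(1)] code[OF that(2)] eq by metis
    assume "pw_eq x y"
    then have "C x = C y" using tr[of x y] tr[of y x] by (auto simp: pw_eq_def fun_eq_iff)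
    then show "code x = code y" by (simp add: code_def)
  qed
  then show thesis using inj_eq[OF j] by (intro that[of "\<lambda>x. j (code x)"]) simp
qed

text \<open>Archimedeanity is applied to every pair of values \<open>f\<close>, \<open>g\<close>,
  with an error term that is absent from a prime filter exactly if \<open>x\<close> and
  \<open>y\<close> agree there with \<open>f\<close> and \<open>g\<close>. As there are finitely
  many pairs, one scalar suffices.\<close>

lemma piecewise_dominated:
  assumes x: "piecewise x" and y: "piecewise y" and y0: "pw_le (\<lambda>_. 0) y"
    and sub: "\<And>P. prime_filter P \<Longrightarrow> lt P 0 (x P) \<Longrightarrow> lt P 0 (y P)"
  shows "\<exists>r>0. pw_le x (\<lambda>P. r *s y P)"
proof -
  obtain c where c: "\<And>v P. prime_filter P \<Longrightarrow> c v \<in> P \<longleftrightarrow> lt P v (x P) \<or> lt P (x P) v"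
    using piecewise_equality_element[OF x] by blast
  obtain d where d: "\<And>v P. prime_filter P \<Longrightarrow> d v \<in> P \<longleftrightarrow> lt P v (y P) \<or> lt P (y P) v"
    using piecewise_equality_element[OF y] by blast
  have "\<exists>r>0. p f \<curlywedge> p (f - r *s g) \<le> c f \<curlyvee> d g" for f g
  proof -
    have "p f \<le> p g \<curlyvee> (c f \<curlyvee> d g)"
    proof (rule le_by_prime_filter)
      fix P assume P: "prime_filter P" "p f \<in> P" "p g \<curlyvee> (c f \<curlyvee> d g) \<notin> P"
      then have "lt P 0 f" "\<not> lt P 0 g" "\<not> lt P (x P) f" "\<not> lt P g (y P)"
        using c[OF P(1)] d[OF P(1)] prime_filterD(2)[OF P(1)] by (auto simp: lt_def)
      moreover from this have "lt P 0 (x P)" using lt_negtrans[OF P(1), of 0 f "x P"] by simp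
      ultimately show False using sub[OF P(1)] lt_negtrans[OF P(1), of 0 "y P" g] by simp
    qed
    then show ?thesis using arch unfolding archimedean_def by blast
  qed
  then obtain q where q: "\<And>f g. q f g > 0" "\<And>f g. p f \<curlywedge> p (f - q f g *s g) \<le> c f \<curlyvee> d g" by metis
  have "finite (vals x \<times> vals y)" using vals_finite x y by blast
  from finite_strict_upper_bound[OF this, of "\<lambda>(f, g). q f g"]
  obtain r where r: "r > 0" "\<And>f g. f \<in> vals x \<Longrightarrow> g \<in> vals y \<Longrightarrow> q f g < r" by auto
  have "\<not> lt P (r *s y P) (x P)" if P: "prime_filter P" for P
  proof
    assume lt: "lt P (r *s y P) (x P)"
    let ?q = "q (x P) (y P)"
    have y0P: "\<not> lt P (y P) 0" using y0 P by (simp add: pw_le_def)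
    have "\<not> lt P (r *s y P) 0" using lt_scale[OF P r(1), of "y P" 0] y0P by simp
    then have "lt P 0 (x P)" using le_lt_trans[OF P _ lt] by simp
    have "0 < r - ?q" using r(2) in_vals[OF P] by simp
    then have "\<not> lt P ((r - ?q) *s y P) 0" using lt_scale[OF P, of "r - ?q" "y P" 0] y0P by simp
    then have "\<not> lt P (r *s y P) (?q *s y P)" using lt_add(3)[of P "r *s y P" "?q *s y P" "?q *s y P"] by (simp add: scale_left_diff)
    then have "lt P (?q *s y P) (x P)" using le_lt_trans[OF P _ lt] by simp
    then have "p (x P) \<curlywedge> p (x P - ?q *s y P) \<in> P" using \<open>lt P 0 (x P)\<close> prime_filterD(3)[OF P] by (simp add: lt_def)
    then have "c (x P) \<curlyvee> d (y P) \<in> P" using prime_filter_mono[OF P _ q(2)] by blast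
    then show False using c[OF P] d[OF P] lt_irrefl[OF P] prime_filterD(2)[OF P] by blast
  qed
  then show ?thesis using r(1) by (auto simp: pw_le_def)
qed

end

section \<open>The vector lattice of encoded piecewise functions and its ideals\<close>

locale encoded_space = archimedean_valued_space scale p
  for scale :: "'k::{division_ring, linordered_ring} \<Rightarrow> 'v::ab_group_add \<Rightarrow> 'v" (infixr "*s" 75)
    and p :: "'v \<Rightarrow> 'l::{distrib_lattice, bounded_lattice_bot}" +
  fixes h :: "('l set \<Rightarrow> 'v) \<Rightarrow> 'e"
  assumes h_eq: "piecewise x \<Longrightarrow> piecewise y \<Longrightarrow> h x = h y \<longleftrightarrow> pw_eq x y"
begin

definition elements :: "'e set" where
  "elements = h ` {x. piecewise x}"

definition rep :: "'e \<Rightarrow> 'l set \<Rightarrow> 'v" where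
  "rep a = (SOME x. piecewise x \<and> h x = a)"

lemma elementsE: "a \<in> elements \<Longrightarrow> (\<And>x. piecewise x \<Longrightarrow> a = h x \<Longrightarrow> thesis) \<Longrightarrow> thesis"
  by (auto simp: elements_def)

lemma h_in_elements: "piecewise x \<Longrightarrow> h x \<in> elements"
  by (simp add: elements_def)

lemma rep:
  assumes "piecewise x" shows "piecewise (rep (h x))" "pw_eq (rep (h x)) x"
proof -
  have "piecewise (rep (h x)) \<and> h (rep (h x)) = h x" unfolding rep_def by (rule someI[of _ x]) (simp add: assms)
  then show "piecewise (rep (h x))" "pw_eq (rep (h x)) x" using h_eq assms by blast+
qed

definition "zero_element = h (\<lambda>_. 0)"
definition "plus_element a b = h (\<lambda>P. rep a P + rep b P)"
definition "scale_element r a = h (\<lambda>P. r *s rep a P)"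
definition "le_element a b = pw_le (rep a) (rep b)"

lemma element_simps:
  assumes "piecewise x" "piecewise y"
  shows "plus_element (h x) (h y) = h (\<lambda>P. x P + y P)" "scale_element r (h x) = h (\<lambda>P. r *s x P)"
    "le_element (h x) (h y) \<longleftrightarrow> pw_le x y"
  using assms rep[of x] rep[of y] pw_eq_congs[of "rep (h x)" x]
  by (simp_all add: plus_element_def scale_element_def le_element_def h_eq piecewise_plus piecewise_scale)

lemma h_antisym: "piecewise x \<Longrightarrow> piecewise y \<Longrightarrow> pw_le x y \<Longrightarrow> pw_le y x \<Longrightarrow> h x = h y"
  by (simp add: h_eq pw_eq_def)

lemma abelian_lgroup_elements:
  fixes R :: "('e, 'm) lgroup_scheme" (structure)
  assumes R: "carrier R = elements" "zero R = zero_element" "add R = plus_element" "lgroup_le R = le_element"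
  shows "abelian_lgroup R"
proof -
  note pw = piecewise_const piecewise_plus piecewise_uminus h_in_elements
  have group: "abelian_group R"
  proof (rule abelian_groupI, unfold R)
    fix a b c assume "a \<in> elements" "b \<in> elements" "c \<in> elements"
    then obtain x y z where xyz: "piecewise x" "piecewise y" "piecewise z" "a = h x" "b = h y" "c = h z"
      by (meson elementsE)
    show "plus_element a b \<in> elements" using xyz by (simp add: element_simps pw)
    show "plus_element (plus_element a b) c = plus_element a (plus_element b c)"
      "plus_element a b = plus_element b a" "plus_element zero_element a = a"
      using xyz by (simp_all add: element_simps pw zero_element_def add_ac)
    have "plus_element (h (\<lambda>P. - x P)) a = zero_element"
      using xyz by (simp add: element_simps pw zero_element_def)
    then show "\<exists>b\<in>elements. plus_element b a = zero_element" using xyz pw by blast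
  next
    show "zero_element \<in> elements" by (simp add: zero_element_def pw)
  qed
  have le_h: "le_element a b \<longleftrightarrow> pw_le x y" if "a = h x" "b = h y" "piecewise x" "piecewise y" for a b x y
    using that element_simps(3) by simp
  have lattice: "Lattice.lattice (lgroup_order R)"
  proof (unfold_locales, unfold lgroup_order_def R, simp_all)
    fix a assume "a \<in> elements"
    then show "le_element a a" using pw_le_refl by (simp add: le_element_def)
  next
    fix a b assume "le_element a b" "le_element b a" "a \<in> elements" "b \<in> elements"
    then obtain x y where xy: "piecewise x" "piecewise y" "a = h x" "b = h y" by (meson elementsE)
    have "pw_le x y" "pw_le y x" using \<open>le_element a b\<close> \<open>le_element b a\<close> xy by (simp_all add: le_h)
    then show "a = b" using xy h_antisym by blast
  next
    fix a b c assume "le_element a b" "le_element b c"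
    then show "le_element a c" unfolding le_element_def by (rule pw_le_trans)
  next
    fix a b assume "a \<in> elements" "b \<in> elements"
    then obtain x y where xy: "piecewise x" "piecewise y" "a = h x" "b = h y" by (meson elementsE)
    have m: "piecewise (pmax x y)" using xy piecewise_pmax by blast
    have up: "Upper \<lparr>carrier = elements, eq = (=), le = le_element\<rparr> {a, b} = {c \<in> elements. le_element a c \<and> le_element b c}"
      using xy h_in_elements by (auto simp: Upper_def)
    have "le_element (h (pmax x y)) c" if "c \<in> elements" "le_element a c" "le_element b c" for c
    proof -
      obtain z where z: "piecewise z" "c = h z" using \<open>c \<in> elements\<close> by (rule elementsE)
      then show ?thesis using xy m that by (simp add: element_simps pw_le_pmax)
    qed
    moreover have "le_element a (h (pmax x y))" "le_element b (h (pmax x y))"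
      using xy m by (simp_all add: element_simps pw_le_pmax)
    ultimately show "\<exists>s. is_lub \<lparr>carrier = elements, eq = (=), le = le_element\<rparr> s {a, b}"
      unfolding least_def up using h_in_elements[OF m] by (intro exI[of _ "h (pmax x y)"]) simp
    \<comment> \<open>The meet is obtained from maxima by changing signs twice.\<close>
    define n where "n = (\<lambda>P. - pmax (\<lambda>P. - x P) (\<lambda>P. - y P) P)"
    have n: "piecewise n" using xy unfolding n_def by (intro piecewise_uminus piecewise_pmax)
    have n_le: "pw_le n x" "pw_le n y" "\<And>z. pw_le z x \<Longrightarrow> pw_le z y \<Longrightarrow> pw_le z n"
      using pw_le_uminus[OF pw_le_pmax(1)[of "\<lambda>P. - x P" "\<lambda>P. - y P"]] pw_le_uminus[OF pw_le_pmax(2)[of "\<lambda>P. - y P" "\<lambda>P. - x P"]]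
        pw_le_uminus[OF pw_le_pmax(3)[OF pw_le_uminus pw_le_uminus], of _ x y]
      by (simp_all add: n_def)
    have low: "Lower \<lparr>carrier = elements, eq = (=), le = le_element\<rparr> {a, b} = {c \<in> elements. le_element c a \<and> le_element c b}"
      using xy h_in_elements by (auto simp: Lower_def)
    have "le_element c (h n)" if "c \<in> elements" "le_element c a" "le_element c b" for c
    proof -
      obtain z where z: "piecewise z" "c = h z" using \<open>c \<in> elements\<close> by (rule elementsE)
      then show ?thesis using xy n n_le(3) that by (simp add: element_simps)
    qed
    moreover have "le_element (h n) a" "le_element (h n) b" using xy n n_le by (simp_all add: element_simps)
    ultimately show "\<exists>s. is_glb \<lparr>carrier = elements, eq = (=), le = le_element\<rparr> s {a, b}"
      unfolding greatest_def low using h_in_elements[OF n] by (intro exI[of _ "h n"]) simp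
  qed
  have trans_inv: "lgroup_le R (a \<oplus> c) (b \<oplus> c)"
    if abc: "a \<in> carrier R" "b \<in> carrier R" "c \<in> carrier R" "lgroup_le R a b" for a b c
  proof -
    obtain x y z where xyz: "piecewise x" "piecewise y" "piecewise z" "a = h x" "b = h y" "c = h z"
      using abc(1-3) unfolding R by (meson elementsE)
    then show ?thesis using abc(4) pw_le_add unfolding R by (simp add: element_simps piecewise_plus)
  qed
  show ?thesis
    by (intro abelian_lgroup.intro abelian_lgroup_axioms.intro group lattice trans_inv)
qed

definition absolute :: "('l set \<Rightarrow> 'v) \<Rightarrow> 'l set \<Rightarrow> 'v" where
  "absolute x = pmax x (\<lambda>P. - x P)"

lemma piecewise_absolute: "piecewise x \<Longrightarrow> piecewise (absolute x)"
  by (simp add: absolute_def piecewise_pmax piecewise_uminus)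

lemma absolute_positive: "pw_le (\<lambda>_. 0) x \<Longrightarrow> pw_eq (absolute x) x"
  unfolding pw_eq_def absolute_def using pw_le_uminus[of "\<lambda>_. 0" x]
  by (auto intro!: pw_le_pmax pw_le_refl intro: pw_le_trans)

lemma labs_elements:
  fixes R :: "('e, 'm) lgroup_scheme" (structure)
  assumes R: "carrier R = elements" "zero R = zero_element" "add R = plus_element" "lgroup_le R = le_element"
    and x: "piecewise x"
  shows "labs R (h x) = h (absolute x)"
proof -
  interpret abelian_lgroup R using R by (rule abelian_lgroup_elements)
  have nx: "piecewise (\<lambda>P. - x P)" using piecewise_uminus x by blast
  have ax: "piecewise (absolute x)" using x by (rule piecewise_absolute)
  have car: "h x \<in> carrier R" "h (\<lambda>P. - x P) \<in> carrier R" "h (absolute x) \<in> carrier R"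
    using x nx ax by (simp_all add: R h_in_elements)
  have "h (\<lambda>P. - x P) \<oplus> h x = \<zero>" using x nx by (simp add: R element_simps zero_element_def)
  then have neg: "\<ominus> h x = h (\<lambda>P. - x P)" using car by (intro minus_equality)
  have "h x \<squnion>\<^bsub>lgroup_order R\<^esub> h (\<lambda>P. - x P) = h (absolute x)"
  proof (rule lle_antisym)
    show "lgroup_le R (h x \<squnion>\<^bsub>lgroup_order R\<^esub> h (\<lambda>P. - x P)) (h (absolute x))"
      by (rule order.join_le) (use car x nx ax in \<open>simp_all add: R element_simps absolute_def pw_le_pmax\<close>)
    obtain z where z: "piecewise z" "h x \<squnion>\<^bsub>lgroup_order R\<^esub> h (\<lambda>P. - x P) = h z"
      using order.join_closed[OF car(1,2)] by (auto simp: R elim: elementsE)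
    have "pw_le x z" "pw_le (\<lambda>P. - x P) z"
      using order.join_left[OF car(1,2)] order.join_right[OF car(1,2)] x nx z by (simp_all add: R element_simps)
    then show "lgroup_le R (h (absolute x)) (h x \<squnion>\<^bsub>lgroup_order R\<^esub> h (\<lambda>P. - x P))"
      using ax z by (simp add: R element_simps absolute_def pw_le_pmax)
  qed (use car order.join_closed in auto)
  then show ?thesis by (simp add: labs_def neg)
qed

text \<open>The ideal meant to correspond to \<open>l\<close>: domination by a multiple is replaced
  by inclusion of supports.\<close>

definition support_ideal :: "'l \<Rightarrow> 'e set" where
  "support_ideal l = h ` {x. piecewise x \<and> (\<forall>P. prime_filter P \<longrightarrow> lt P 0 (absolute x P) \<longrightarrow> l \<in> P)}"

text \<open>Passing from included supports to a single multiple is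
  \<open>piecewise_dominated\<close>, hence archimedeanity of \<open>p\<close>; the converse is
  order arithmetic at each prime filter.\<close>

lemma dominated_iff:
  assumes x: "piecewise x" and a: "piecewise a" "pw_le (\<lambda>_. 0) a"
    and l: "\<And>P. prime_filter P \<Longrightarrow> l \<in> P \<longleftrightarrow> lt P 0 (a P)"
  shows "(\<exists>r\<ge>0. pw_le (absolute x) (\<lambda>P. r *s a P)) \<longleftrightarrow> (\<forall>P. prime_filter P \<longrightarrow> lt P 0 (absolute x P) \<longrightarrow> l \<in> P)"
proof
  assume "\<exists>r\<ge>0. pw_le (absolute x) (\<lambda>P. r *s a P)"
  then obtain r where r: "r \<ge> 0" "pw_le (absolute x) (\<lambda>P. r *s a P)" by blast
  show "\<forall>P. prime_filter P \<longrightarrow> lt P 0 (absolute x P) \<longrightarrow> l \<in> P"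
  proof (intro allI impI)
    fix P assume P: "prime_filter P" "lt P 0 (absolute x P)"
    have "lt P 0 (r *s a P)" using lt_le_trans[OF P] r(2) P(1) by (simp add: pw_le_def)
    then have "r \<noteq> 0" using lt_irrefl[OF P(1)] by auto
    then have "lt P 0 (a P)" using lt_scale_zero[OF P(1), of r "a P"] r(1) \<open>lt P 0 (r *s a P)\<close> by simp
    then show "l \<in> P" using l[OF P(1)] by blast
  qed
next
  assume "\<forall>P. prime_filter P \<longrightarrow> lt P 0 (absolute x P) \<longrightarrow> l \<in> P"
  then show "\<exists>r\<ge>0. pw_le (absolute x) (\<lambda>P. r *s a P)"
    using piecewise_dominated[OF piecewise_absolute[OF x] a] l by (meson less_imp_le)
qed

lemma positive_support:
  assumes "piecewise a" shows "\<exists>l. \<forall>P. prime_filter P \<longrightarrow> (l \<in> P \<longleftrightarrow> lt P 0 (a P))"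
proof -
  have "definable (\<lambda>P. lt P 0 (a P))" using assms by (simp add: piecewise_def)
  then show ?thesis unfolding definable_def by blast
qed

text \<open>Surjectivity of \<open>p\<close> provides \<open>v\<close> with \<open>p v = l\<close>,
  and the positive part of \<open>v\<close> has the desired support.\<close>

lemma positive_with_support:
  obtains a where "piecewise a" "pw_le (\<lambda>_. 0) a" "\<And>P. prime_filter P \<Longrightarrow> l \<in> P \<longleftrightarrow> lt P 0 (a P)"
proof -
  obtain v where v: "p v = l" using surjective by (metis surjD)
  let ?a = "pmax (\<lambda>_. 0) (\<lambda>_. v)"
  have "piecewise ?a" using piecewise_pmax piecewise_const by blast
  moreover have "pw_le (\<lambda>_. 0) ?a" by (rule pw_le_pmax)
  moreover have "l \<in> P \<longleftrightarrow> lt P 0 (?a P)" if "prime_filter P" for P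
    using lt_irrefl[OF that] by (simp add: lt_pmax[OF that]) (simp add: lt_def v)
  ultimately show thesis by (rule that)
qed

lemma support_ideal_subset_iff: "support_ideal l \<subseteq> support_ideal m \<longleftrightarrow> l \<le> m"
proof
  assume sub: "support_ideal l \<subseteq> support_ideal m"
  obtain a where a: "piecewise a" "pw_le (\<lambda>_. 0) a" "\<And>P. prime_filter P \<Longrightarrow> l \<in> P \<longleftrightarrow> lt P 0 (a P)"
    using positive_with_support by metis
  have iff: "lt P 0 (absolute a P) \<longleftrightarrow> lt P 0 (a P)" if "prime_filter P" for P
  proof -
    have "\<not> lt P (a P) (absolute a P)" "\<not> lt P (absolute a P) (a P)"
      using absolute_positive[OF a(2)] that by (auto simp: pw_eq_def pw_le_def)
    then show ?thesis using lt_le_trans[OF that] by blast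
  qed
  have "h a \<in> support_ideal l" unfolding support_ideal_def by (rule imageI) (simp add: a iff)
  then have "h a \<in> support_ideal m" using sub by blast
  then obtain x where x: "h a = h x" "piecewise x" "\<forall>P. prime_filter P \<longrightarrow> lt P 0 (absolute x P) \<longrightarrow> m \<in> P"
    unfolding support_ideal_def by blast
  then have "pw_le a x" using h_eq a(1) by (simp add: pw_eq_def)
  then have ax: "pw_le a (absolute x)" unfolding absolute_def using pw_le_trans pw_le_pmax(1) by blast
  show "l \<le> m"
  proof (rule le_by_prime_filter)
    fix P assume P: "prime_filter P" "l \<in> P" "m \<notin> P"
    have "\<not> lt P (absolute x P) (a P)" using ax P(1) by (simp add: pw_le_def)
    moreover have "lt P 0 (a P)" using a(3)[OF P(1)] P(2) by blast
    ultimately have "lt P 0 (absolute x P)" using lt_le_trans[OF P(1)] by blast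
    then show False using x(3) P by blast
  qed
next
  assume "l \<le> m"
  then show "support_ideal l \<subseteq> support_ideal m"
    unfolding support_ideal_def using prime_filter_mono[of _ l m] by (intro image_mono Collect_mono) blast
qed

lemma lattice_iso_support_ideal: "lattice_iso support_ideal (inclusion_order (range support_ideal))"
proof (rule lattice_iso_inclusion_orderI)
  show iff: "support_ideal l \<subseteq> support_ideal m \<longleftrightarrow> l \<le> m" for l m by (rule support_ideal_subset_iff)
  have "inj support_ideal"
  proof (rule injI)
    fix l m assume "support_ideal l = support_ideal m"
    then have "l \<le> m" "m \<le> l" using iff[of l m] iff[of m l] by simp_all
    then show "l = m" by simp
  qed
  then show "bij_betw support_ideal UNIV (range support_ideal)" by (simp add: bij_betw_def)
qed

text \<open>
  For \<open>Idc_group\<close> the index \<open>i\<close> runs through the natural numbers, for \<open>Idc_vector\<close> through the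
  nonnegative scalars.
\<close>

lemma ideals_eq_support_ideals:
  fixes R :: "('e, 'm) lgroup_scheme" (structure)
  assumes R: "carrier R = elements" "zero R = zero_element" "add R = plus_element" "lgroup_le R = le_element"
    and ideal: "\<And>a. ideal a = {x \<in> carrier R. \<exists>i. M i \<and> lgroup_le R (labs R x) (m i (labs R a))}"
    and m: "\<And>a i. piecewise a \<Longrightarrow> M i \<Longrightarrow> m i (h a) = h (\<lambda>P. c i *s a P)"
    and c: "\<And>i. M i \<Longrightarrow> 0 \<le> c i" "\<And>r. 0 \<le> r \<Longrightarrow> \<exists>i. M i \<and> r \<le> c i"
  shows "ideal ` positive_cone R = range support_ideal"
proof -
  have pos: "positive_cone R = h ` {a. piecewise a \<and> pw_le (\<lambda>_. 0) a}"
    by (auto simp: positive_cone_def R zero_element_def element_simps piecewise_const elements_def)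
  have eq: "ideal (h a) = support_ideal l"
    if a: "piecewise a" "pw_le (\<lambda>_. 0) a" and l: "\<And>P. prime_filter P \<Longrightarrow> l \<in> P \<longleftrightarrow> lt P 0 (a P)" for a l
  proof -
    have "labs R (h a) = h a"
      using labs_elements[OF R a(1)] absolute_positive[OF a(2)] h_eq[OF piecewise_absolute[OF a(1)] a(1)] by simp
    moreover have "lgroup_le R (labs R (h x)) (m i (h a)) \<longleftrightarrow> pw_le (absolute x) (\<lambda>P. c i *s a P)" if "piecewise x" "M i" for x i
      using labs_elements[OF R that(1)] m[OF a(1) that(2)] piecewise_absolute[OF that(1)] piecewise_scale[OF a(1)]
      by (simp add: R(4) element_simps)
    ultimately have "ideal (h a) = h ` {x. piecewise x \<and> (\<exists>i. M i \<and> pw_le (absolute x) (\<lambda>P. c i *s a P))}"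
      unfolding ideal R(1) elements_def by auto
    moreover have "(\<exists>i. M i \<and> pw_le (absolute x) (\<lambda>P. c i *s a P)) \<longleftrightarrow> (\<exists>r\<ge>0. pw_le (absolute x) (\<lambda>P. r *s a P))" for x
    proof
      assume "\<exists>i. M i \<and> pw_le (absolute x) (\<lambda>P. c i *s a P)"
      then show "\<exists>r\<ge>0. pw_le (absolute x) (\<lambda>P. r *s a P)" using c(1) by blast
    next
      assume "\<exists>r\<ge>0. pw_le (absolute x) (\<lambda>P. r *s a P)"
      then obtain r where r: "r \<ge> 0" "pw_le (absolute x) (\<lambda>P. r *s a P)" by blast
      obtain i where i: "M i" "r \<le> c i" using c(2) r by blast
      have "pw_le (\<lambda>P. (c i - r) *s 0) (\<lambda>P. (c i - r) *s a P)" using pw_le_scale[OF _ a(2)] i by simp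
      then have "pw_le (\<lambda>P. (c i - r) *s 0 + r *s a P) (\<lambda>P. (c i - r) *s a P + r *s a P)" by (rule pw_le_add)
      then have "pw_le (\<lambda>P. r *s a P) (\<lambda>P. c i *s a P)" by (simp add: scale_left_diff)
      then show "\<exists>i. M i \<and> pw_le (absolute x) (\<lambda>P. c i *s a P)" using pw_le_trans[OF r(2)] i by blast
    qed
    ultimately have "ideal (h a) = h ` {x. piecewise x \<and> (\<exists>r\<ge>0. pw_le (absolute x) (\<lambda>P. r *s a P))}" by simp
    also have "{x. piecewise x \<and> (\<exists>r\<ge>0. pw_le (absolute x) (\<lambda>P. r *s a P))} =
      {x. piecewise x \<and> (\<forall>P. prime_filter P \<longrightarrow> lt P 0 (absolute x P) \<longrightarrow> l \<in> P)}"
      by (intro Collect_cong conj_cong refl dominated_iff[OF _ a l])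
    finally show ?thesis by (simp only: support_ideal_def)
  qed
  show ?thesis
  proof (intro equalityI subsetI)
    fix I assume "I \<in> ideal ` positive_cone R"
    then obtain a where a: "piecewise a" "pw_le (\<lambda>_. 0) a" "I = ideal (h a)" unfolding pos by blast
    obtain l where "\<And>P. prime_filter P \<Longrightarrow> l \<in> P \<longleftrightarrow> lt P 0 (a P)" using positive_support[OF a(1)] by blast
    then show "I \<in> range support_ideal" using eq[OF a(1,2)] a(3) by blast
  next
    fix I assume "I \<in> range support_ideal"
    then obtain l where I: "I = support_ideal l" by blast
    obtain a where a: "piecewise a" "pw_le (\<lambda>_. 0) a" "\<And>P. prime_filter P \<Longrightarrow> l \<in> P \<longleftrightarrow> lt P 0 (a P)"
      using positive_with_support by metis
    then show "I \<in> ideal ` positive_cone R" using eq[OF a] I pos by blast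
  qed
qed

theorem vector_lattice_exists: "\<exists>E :: ('k, 'e) vlattice. vector_lattice E \<and> (\<exists>f :: 'l \<Rightarrow> 'e set. lattice_iso f (Idc_vector E))"
proof -
  define E :: "('k, 'e) vlattice" where "E = \<lparr>carrier = elements, monoid.mult = undefined, one = undefined,
    zero = zero_element, add = plus_element, lgroup_le = le_element, scal = scale_element\<rparr>"
  have E: "carrier E = elements" "zero E = zero_element" "add E = plus_element" "lgroup_le E = le_element"
    "scal E = scale_element" by (simp_all add: E_def)
  note pw = piecewise_const piecewise_plus piecewise_scale h_in_elements
  have pos: "positive_cone E = h ` {a. piecewise a \<and> pw_le (\<lambda>_. 0) a}"
    by (auto simp: positive_cone_def E zero_element_def element_simps piecewise_const elements_def)
  have "vector_lattice E"
  proof (intro vector_lattice.intro abelian_lgroup_elements vector_lattice_axioms.intro E)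
    fix a b r s
    assume "a \<in> carrier E" then obtain x where x: "piecewise x" "a = h x" unfolding E by (rule elementsE)
    show "scal E r a \<in> carrier E" "scal E (r + s) a = scal E r a \<oplus>\<^bsub>E\<^esub> scal E s a"
      "scal E (r * s) a = scal E r (scal E s a)" "scal E 1 a = a"
      using x by (simp_all add: E element_simps pw scale_left_add scale_scale scale_one)
    assume "b \<in> carrier E" then obtain y where y: "piecewise y" "b = h y" unfolding E by (rule elementsE)
    show "scal E r (a \<oplus>\<^bsub>E\<^esub> b) = scal E r a \<oplus>\<^bsub>E\<^esub> scal E r b"
      using x y by (simp add: E element_simps pw scale_right_add)
  next
    fix r :: 'k and a assume r: "0 \<le> r" and "a \<in> positive_cone E"
    then obtain x where x: "piecewise x" "pw_le (\<lambda>_. 0) x" "a = h x" unfolding pos by blast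
    have "pw_le (\<lambda>P. 0) (\<lambda>P. r *s x P)" using pw_le_scale[OF r x(2)] by simp
    then show "scal E r a \<in> positive_cone E" unfolding pos using x by (auto simp: E element_simps pw)
  qed
  moreover have "principal_videal E ` positive_cone E = range support_ideal"
  proof (rule ideals_eq_support_ideals[OF E(1-4), where M = "\<lambda>r. 0 \<le> r" and c = "\<lambda>r. r" and m = "scal E"])
    show "principal_videal E a = {x \<in> carrier E. \<exists>r. 0 \<le> r \<and> lgroup_le E (labs E x) (scal E r (labs E a))}" for a
      by (simp add: principal_videal_def)
    show "scal E r (h a) = h (\<lambda>P. r *s a P)" if "piecewise a" for a r
      using element_simps(2)[OF that that] by (simp add: E)
  qed auto
  then have "Idc_vector E = inclusion_order (range support_ideal)"
    by (simp add: Idc_vector_def inclusion_order_def)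
  ultimately show ?thesis using lattice_iso_support_ideal by metis
qed

text \<open>If every scalar is below a natural number, natural multiples dominate all scalar
  multiples of a positive element, so group ideals and vector lattice ideals agree.\<close>

theorem abelian_lgroup_exists:
  assumes archimedean_scalars: "\<And>r::'k. \<exists>n. r \<le> of_nat n"
  shows "\<exists>G :: 'e lgroup. abelian_lgroup G \<and> (\<exists>f :: 'l \<Rightarrow> 'e set. lattice_iso f (Idc_group G))"
proof -
  define G :: "'e lgroup" where "G = \<lparr>carrier = elements, monoid.mult = undefined, one = undefined,
    zero = zero_element, add = plus_element, lgroup_le = le_element\<rparr>"
  have G: "carrier G = elements" "zero G = zero_element" "add G = plus_element" "lgroup_le G = le_element"
    by (simp_all add: G_def)
  interpret G: abelian_lgroup G using G by (rule abelian_lgroup_elements)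
  have pow: "[n] \<cdot>\<^bsub>G\<^esub> h a = h (\<lambda>P. of_nat n *s a P)" if "piecewise a" for a and n :: nat
  proof (induction n)
    case 0
    then show ?case by (simp add: G zero_element_def)
  next
    case (Suc n)
    then show ?case using that
      by (simp add: G element_simps piecewise_scale scale_left_add scale_one add.commute)
  qed
  have of_nat: "(0::'k) \<le> of_nat n" for n
    by (induction n) (use ordered_division_ring_pos(1)[where 'k='k] in \<open>auto intro: add_nonneg_nonneg\<close>)
  have "principal_lideal G ` positive_cone G = range support_ideal"
  proof (rule ideals_eq_support_ideals[OF G, where M = "\<lambda>_. True" and c = of_nat and m = "\<lambda>n a. [n] \<cdot>\<^bsub>G\<^esub> a"])
    show "principal_lideal G a = {x \<in> carrier G. \<exists>n::nat. True \<and> lgroup_le G (labs G x) ([n] \<cdot>\<^bsub>G\<^esub> labs G a)}" for a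
      by (simp add: principal_lideal_def)
  qed (use pow of_nat archimedean_scalars in auto)
  then have "Idc_group G = inclusion_order (range support_ideal)"
    by (simp add: Idc_group_def inclusion_order_def)
  then show ?thesis using lattice_iso_support_ideal G.abelian_lgroup_axioms by metis
qed

end

section \<open>Cardinalities\<close>

lemma card_of_lists_ordLeq:
  fixes \<kappa> :: "'b rel"
  assumes \<kappa>: "Cinfinite \<kappa>" and A: "|UNIV :: 'a set| \<le>o \<kappa>"
  shows "|UNIV :: 'a list set| \<le>o \<kappa>"
proof -
  have inf: "\<not> finite (Field \<kappa>)" "Card_order \<kappa>" using \<kappa> by (auto simp: cinfinite_def)
  have len: "|{xs :: 'a list. length xs = n}| \<le>o \<kappa>" for n
  proof (induction n)
    case 0
    have "{xs :: 'a list. length xs = 0} = {[]}" by auto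
    then show ?case using card_of_singl_ordLeq[of "Field \<kappa>" "[] :: 'a list"] inf card_of_Field_ordIso
      by (metis finite.emptyI ordLeq_ordIso_trans)
  next
    case (Suc n)
    have "{xs :: 'a list. length xs = Suc n} = (\<lambda>(x, xs). x # xs) ` (UNIV \<times> {xs. length xs = n})"
      by (auto simp: length_Suc_conv image_iff)
    moreover have "|(UNIV :: 'a set) \<times> {xs :: 'a list. length xs = n}| \<le>o \<kappa>"
      using inf A Suc by (intro card_of_Times_ordLeq_infinite_Field)
    ultimately show ?case using card_of_image ordLeq_transitive by metis
  qed
  have "|UNIV :: nat set| \<le>o \<kappa>"
    using ordIso_ordLeq_trans[OF card_of_nat natLeq_ordLeq_cinfinite[OF \<kappa>]] .
  then have "|\<Union>n. {xs :: 'a list. length xs = n}| \<le>o \<kappa>"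
    using inf len by (intro card_of_UNION_ordLeq_infinite_Field) auto
  moreover have "(\<Union>n. {xs :: 'a list. length xs = n}) = UNIV" by auto
  ultimately show ?thesis by simp
qed

lemma card_of_pair_ordLeq:
  fixes \<kappa> :: "'c rel"
  assumes "Cinfinite \<kappa>" "|UNIV :: 'a set| \<le>o \<kappa>" "|UNIV :: 'b set| \<le>o \<kappa>"
  shows "|UNIV :: ('a \<times> 'b) set| \<le>o \<kappa>"
  using card_of_Times_ordLeq_infinite_Field[of \<kappa> "UNIV :: 'a set" "UNIV :: 'b set"] assms
  by (simp add: cinfinite_def)

lemma card_of_poly_mapping_ordLeq:
  fixes \<kappa> :: "'c rel"
  assumes "Cinfinite \<kappa>" "|UNIV :: 'i set| \<le>o \<kappa>" "|UNIV :: 'k::zero set| \<le>o \<kappa>"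
  shows "|UNIV :: ('i \<Rightarrow>\<^sub>0 'k) set| \<le>o \<kappa>"
proof -
  define code where "code v = (SOME xs. set xs = (\<lambda>i. (i, lookup v i)) ` keys v)" for v :: "'i \<Rightarrow>\<^sub>0 'k"
  have code: "set (code v) = (\<lambda>i. (i, lookup v i)) ` keys v" for v
    unfolding code_def by (rule someI_ex) (simp add: finite_list)
  have "inj code"
  proof (rule injI, rule poly_mapping_eqI)
    fix u v i assume "code u = code v"
    then have eq: "set (code u) = set (code v)" by simp
    have "(i, c) \<in> set (code w) \<longleftrightarrow> c \<noteq> 0 \<and> lookup w i = c" for w c
      unfolding code by (auto simp: in_keys_iff)
    then show "lookup u i = lookup v i" using eq by metis
  qed
  then have "|UNIV :: ('i \<Rightarrow>\<^sub>0 'k) set| \<le>o |UNIV :: ('i \<times> 'k) list set|"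
    by (intro card_of_ordLeqI[of code]) auto
  then show ?thesis
    using ordLeq_transitive card_of_lists_ordLeq[OF assms(1) card_of_pair_ordLeq[OF assms]] by blast
qed

lemma Cinfinite_aleph1: "Cinfinite (cardSuc natLeq)"
  using Cinfinite_cardSuc[OF natLeq_Cinfinite] .

text \<open>With the bound aleph_1 on the number of codes, this makes every uncountable type large
  enough to carry the constructed lattice.\<close>

lemma uncountable_aleph1:
  assumes "uncountable A" shows "cardSuc natLeq \<le>o |A|"
proof -
  have "\<not> |A| \<le>o natLeq" using assms by (simp add: countable_card_le_natLeq)
  then have "natLeq <o |A|" using natLeq_Card_order card_of_Card_order not_ordLeq_iff_ordLess by (metis card_order_on_well_order_on)
  then show ?thesis using cardSuc_ordLess_ordLeq natLeq_Card_order card_of_Card_order by blast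
qed

text \<open>The cardinal of a type is a well-order whose proper initial segments are strictly
  smaller than it; below aleph_1 this means countable.\<close>

lemma countable_segments_aleph1:
  assumes "|UNIV :: 'l set| \<le>o cardSuc natLeq"
  obtains less :: "'l \<Rightarrow> 'l \<Rightarrow> bool" where "countable_segments less"
proof -
  define r where "r = |UNIV :: 'l set|"
  have r: "Card_order r" "well_order_on UNIV r" "Field r = UNIV"
    unfolding r_def by (rule card_of_Card_order card_of_well_order_on Field_card_of)+
  have "countable_segments (\<lambda>i j. (i, j) \<in> r - Id)"
  proof
    have "{(i, j). (i, j) \<in> r - Id} = r - Id" by auto
    then show "wf {(i, j). (i, j) \<in> r - Id}" using r(2) by (simp only: well_order_on_def)
    fix i j k
    show "(i, j) \<in> r - Id \<Longrightarrow> (j, k) \<in> r - Id \<Longrightarrow> (i, k) \<in> r - Id"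
      using r(2) unfolding well_order_on_def linear_order_on_def partial_order_on_def preorder_on_def
      by (auto dest: transD antisymD)
    show "i \<noteq> j \<Longrightarrow> (i, j) \<in> r - Id \<or> (j, i) \<in> r - Id"
      using r(2) unfolding well_order_on_def linear_order_on_def total_on_def by blast
    have "|underS r j| <o r" using card_of_underS[OF r(1)] r(3) by blast
    then have "|underS r j| <o cardSuc natLeq" using assms unfolding r_def by (rule ordLess_ordLeq_trans)
    then have "|underS r j| \<le>o natLeq" using cardSuc_ordLeq_ordLess[OF natLeq_Card_order card_of_Card_order] by blast
    moreover have "underS r j = {i. (i, j) \<in> r - Id}" by (auto simp: underS_def)
    ultimately show "countable {i. (i, j) \<in> r - Id}" by (simp add: countable_card_le_natLeq)
  qed
  then show thesis by (rule that)
qed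

text \<open>The basis is indexed by the lattice itself and the vector with index \<open>l\<close>
  receives the value \<open>l\<close>, so \<open>p\<close> is surjective. Scalars, vectors and codes
  all number at most aleph_1.\<close>

lemma encoded_space_exists:
  assumes k: "countable (UNIV :: 'k::{division_ring, linordered_ring} set)"
    and L: "|UNIV :: 'l::{distrib_lattice, bounded_lattice_bot} set| \<le>o cardSuc natLeq"
    and e: "uncountable (UNIV :: 'e set)"
    and cn: "completely_normal TYPE('l)" and cbd: "countably_based_differences TYPE('l)"
  shows "\<exists>(p :: ('l \<Rightarrow>\<^sub>0 'k) \<Rightarrow> 'l) (h :: ('l set \<Rightarrow> 'l \<Rightarrow>\<^sub>0 'k) \<Rightarrow> 'e). encoded_space pscale p h"
proof -
  obtain less :: "'l \<Rightarrow> 'l \<Rightarrow> bool" where "countable_segments less" using countable_segments_aleph1[OF L] .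
  then interpret countable_segments less .
  obtain p :: "('l \<Rightarrow>\<^sub>0 'k) \<Rightarrow> 'l"
    where p: "archimedean_valuation pscale UNIV p" "\<And>i. p (Poly_Mapping.single i 1) = i"
    using surjective_valuation[OF k cn cbd, of "\<lambda>i. i"] by metis
  have "surj p" using p(2) by (rule surjI)
  then interpret archimedean_valued_space pscale p
    using p(1) by unfold_locales (auto simp: archimedean_valuation_def)
  have "|UNIV :: 'k set| \<le>o cardSuc natLeq"
    using k natLeq_ordLeq_cinfinite[OF Cinfinite_aleph1] ordLeq_transitive by (auto simp: countable_card_le_natLeq)
  then have "|UNIV :: (('l \<Rightarrow>\<^sub>0 'k) \<times> 'l) list set| \<le>o cardSuc natLeq"
    using L by (intro card_of_lists_ordLeq card_of_pair_ordLeq card_of_poly_mapping_ordLeq Cinfinite_aleph1)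
  then have "|UNIV :: (('l \<Rightarrow>\<^sub>0 'k) \<times> 'l) list set| \<le>o |UNIV :: 'e set|"
    using uncountable_aleph1[OF e] ordLeq_transitive by blast
  then obtain j :: "(('l \<Rightarrow>\<^sub>0 'k) \<times> 'l) list \<Rightarrow> 'e" where "inj j"
    unfolding card_of_ordLeq[symmetric] by blast
  then obtain h :: "('l set \<Rightarrow> 'l \<Rightarrow>\<^sub>0 'k) \<Rightarrow> 'e"
    where "\<And>x y. piecewise x \<Longrightarrow> piecewise y \<Longrightarrow> h x = h y \<longleftrightarrow> pw_eq x y"
    using piecewise_encoding by blast
  then have "encoded_space pscale p h" by unfold_locales
  then show ?thesis by blast
qed

theorem corollary8p5:
  assumes scalars_countable: "countable (UNIV :: 'k::{division_ring, linordered_ring} set)"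
    and card_L: "|UNIV :: 'l::{distrib_lattice, bounded_lattice_bot} set| \<le>o cardSuc natLeq"
    and E_universe: "uncountable (UNIV :: 'e set)"
    and G_universe: "uncountable (UNIV :: 'g set)"
  shows
    "((\<exists>E :: ('k, 'e) vlattice. vector_lattice E \<and>
         (\<exists>f :: 'l \<Rightarrow> 'e set. lattice_iso f (Idc_vector E)))
      \<longleftrightarrow>
      (\<exists>G :: 'g lgroup. abelian_lgroup G \<and>
         (\<exists>f :: 'l \<Rightarrow> 'g set. lattice_iso f (Idc_group G))))
     \<and>
     ((\<exists>G :: 'g lgroup. abelian_lgroup G \<and>
         (\<exists>f :: 'l \<Rightarrow> 'g set. lattice_iso f (Idc_group G)))
      \<longleftrightarrow>
      completely_normal TYPE('l) \<and> countably_based_differences TYPE('l))"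
    (is "(?E \<longleftrightarrow> ?G) \<and> (?G \<longleftrightarrow> ?L)")
proof -
  have "?E \<Longrightarrow> ?L" using Idc_vector_properties scalars_countable by blast
  moreover have "?G \<Longrightarrow> ?L" using Idc_group_properties by blast
  moreover have ?E if L: ?L
  proof -
    obtain p :: "('l \<Rightarrow>\<^sub>0 'k) \<Rightarrow> 'l" and h :: "('l set \<Rightarrow> 'l \<Rightarrow>\<^sub>0 'k) \<Rightarrow> 'e" where "encoded_space pscale p h"
      using encoded_space_exists[OF scalars_countable card_L E_universe] L by blast
    then interpret encoded_space pscale p h .
    show ?E by (rule vector_lattice_exists)
  qed
  moreover have ?G if L: ?L
  proof -
    \<comment> \<open>For groups the scalars are the rationals, whatever \<open>'k\<close> is: a
      countable ordered field in which the natural numbers are cofinal.\<close>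
    have "countable (UNIV :: rat set)" by simp
    then obtain p :: "('l \<Rightarrow>\<^sub>0 rat) \<Rightarrow> 'l" and h :: "('l set \<Rightarrow> 'l \<Rightarrow>\<^sub>0 rat) \<Rightarrow> 'g" where "encoded_space pscale p h"
      using encoded_space_exists[OF _ card_L G_universe] L by blast
    then interpret encoded_space pscale p h .
    show ?G by (rule abelian_lgroup_exists) (rule real_arch_simple)
  qed
  ultimately show ?thesis by blast
qed

end
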